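(* Let $N,m\in\mathbb N$, $m>1$, let $\mathcal G=(\mathcal V,\mathcal E)$ be a directed graph without self-loops on $\mathcal V=\{1,\dots,N\}$ with adjacency matrix $A=[a_{ij}]$ ($a_{ij}=1$ if $(i,j)\in\mathcal E$, $a_{ij}=0$ otherwise), and let $\mathcal P=\{\mathcal P_1,\dots,\mathcal P_m\}$ be a partition of $\mathcal V$ into nonempty subsets. Let $w_1,\dots,w_N\in\mathbb R$, $\gamma,\tilde\mu,\mu\in\mathbb R_{>0}$, and let $\Gamma:\mathcal T_1\to\mathbb R$ be $C^1$ with $|\Gamma|_1=\max\{\max|\Gamma|,\max|\Gamma'|\}=\delta>0$. Consider the adaptive Kuramoto network $\Sigma(\tilde\mu,\mu)$ defined in the context. In each cluster $\mathcal P_s$ let a node $i_s\in\mathcal P_s$ be selected. Assume: (A1) for every $s\in\{1,\dots,m\}$ and all $i,j\in\mathcal P_s$, $w_i=w_j$; (A2) for all $s,r\in\{1,\dots,m\}$ with $s\neq r$ there is a constant $c_{sr}\in\mathbb N$ such that $\sum_{j\in\mathcal P_r}a_{ij}=c_{sr}$ for every $i\in\mathcal P_s$; (A3) with $c_{max}:=\max_{s}\sum_{r\ne s}c_{sr}$, $w_{min}:=\min_i|w_i|$, $w_{max}:=\max_i|w_i|$, and $c_{out}$ the number of edges $(i,j)\in\mathcal E$ whose endpoints lie in different clusters, $$w_{min}-\mu\gamma^{-1}\delta c_{max}>0\quad\text{and}\quad 4\frac{\mu}{\gamma^2}\,\delta\,\sqrt{c_{out}}\,\Big(\sum_{\substack{s,r=1,\dots,m\\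 s\neq r}}c_{sr}\Big)\,\frac{w_{max}+\mu\gamma^{-1}\delta c_{max}}{w_{min}-\mu\gamma^{-1}\delta c_{max}}<1;$$ (A4) for every $s\in\{1,\dots,m\}$, every eigenvalue $\lambda$ of the matrix $\tilde A_s-D_s^-$ (defined in the context) satisfies $\operatorname{sign}(\Gamma(0))\,\operatorname{Re}\lambda<0$. Then there exists $\mu_0$ with $0<\mu_0\le\mu$ such that for all $\nu$ with $0<\nu<\mu_0$ the invariant toroidal manifold corresponding to the $m$-cluster behavior of $\Sigma(\tilde\mu,\nu)$ defined by the partition $\mathcal P$ (i.e. the invariant manifold $e\equiv0$, $k=u(\varphi)$, $\varphi\in\mathcal T_m$, $u\in C(\mathcal T_m)$, of the error system associated with $\Sigma(\tilde\mu,\nu)$, as described in the context) is locally asymptotically stable.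
   Context: Notation: $\mathcal T_m$ is the $m$-dimensional torus ($\mathcal T_1$ is the circle, functions on it being identified with $2\pi$-periodic functions), and $C(\mathcal T_m)$ is the space of continuous functions on $\mathcal T_m$ ($2\pi$-periodic in each variable) with values in a Euclidean space. The network. For $\tilde\mu,\mu>0$, $\Sigma(\tilde\mu,\mu)$ denotes the system $$\dot\theta_i=w_i+\sum_{j=1}^N a_{ij}k_{ij}\sin(\theta_j-\theta_i),\qquad \dot k_{ij}=-\gamma k_{ij}+\mu_{ij}\Gamma(\theta_j-\theta_i),$$ with phases $\theta_i(t)\in\mathcal T_1$ and coupling strengths $k_{ij}(t)\in\mathbb R$, where $\mu_{ij}=\tilde\mu$ if $i,j$ belong to the same cluster of $\mathcal P$ and $\mu_{ij}=\mu$ otherwise. The system $\Sigma(\tilde\mu,\nu)$ is the same with $\mu$ replaced by $\nu$. The coupling strengths are those along the edges $(i,j)\in\mathcal E$. The error system. For the selected node $i_s\in\mathcal P_s$ put $\varphi_s:=\theta_{i_s}$, $\bar w_s:=w_{i_s}$, and for $i\in\mathcal P_s$ put $e_i:=\theta_i-\varphi_s$ (so $e_{i_s}=0$). Then $\Sigma(\tilde\mu,\mu)$ is rewritten as $$\dot\varphi_s=\bar w_s+\sum_{j\in\mathcal P_s}a_{i_sj}k_{i_sj}\sin e_j+\sum_{r\ne s}\sum_{j\in\mathcal P_r}a_{i_sj}k_{i_sj}\sin(e_j+\varphi_r-\varphi_s),\quad s=1,\dots,m,$$ $$\dot e_i=w_i-\bar w_s+\sum_{j\in\mathcal P_s}\big[a_{ij}k_{ij}\sin(e_j-e_i)-a_{i_sj}k_{i_sj}\sin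 e_j\big]+\sum_{r\neq s}\sum_{j\in\mathcal P_r}\big[a_{ij}k_{ij}\sin(e_j-e_i+\varphi_r-\varphi_s)-a_{i_sj}k_{i_sj}\sin(e_j+\varphi_r-\varphi_s)\big],\quad i\in\mathcal P_s\setminus\{i_s\},$$ $$\dot k_{ij}=-\gamma k_{ij}+\mu\,\Gamma(e_j-e_i+\varphi_r-\varphi_s)\quad (i\in\mathcal P_s,\ j\in\mathcal P_r,\ s\ne r),$$ $$\dot k_{ij}=-\gamma k_{ij}+\tilde\mu\,\Gamma(e_j-e_i)\quad (i,j\in\mathcal P_s,\ i\neq j).$$ Here $\varphi=(\varphi_1,\dots,\varphi_m)\in\mathcal T_m$, $e\in\mathbb R^{N-m}$ collects all $e_i$ with $i\in\mathcal P_s\setminus\{i_s\}$, $s=1,\dots,m$, and $k=(k^{inter},k^{intra})\in\mathbb R^{c_{out}}\times\mathbb R^{c_{in}}$ collects the inter-cluster and intra-cluster coupling strengths along edges, where $c_{out}$ and $c_{in}$ are the numbers of edges of $\mathcal G$ joining different clusters and lying within clusters, respectively. The state space is $\mathbb R^{N-m}\times\mathbb R^{c_{out}+c_{in}}\times\mathcal T_m$. The invariant toroidal manifold. The invariant toroidal manifold corresponding to the $m$-cluster behavior defined by $\mathcal P$ is an invariant set of the error system of the form $\{(e,k,\varphi): e=0,\ k=u(\varphi),\ \varphi\in\mathcal T_m\}$ with $u\in C(\mathcal T_m)$. It is a previously known result that (A1), (A2), (A3) guarantee the existence of this manifold for $\Sigma(\tilde\mu,\mu)$ (and if (A3) holds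 for $\mu$, it also holds with $\mu$ replaced by any $\nu\in(0,\mu]$). This known manifold has the form $e\equiv 0$, $k^{intra}=\left(\frac{\tilde\mu\Gamma(0)}{\gamma},\dots,\frac{\tilde\mu\Gamma(0)}{\gamma}\right)^\top$, $k^{inter}=u^{inter}(\varphi)$ with $\max_{\varphi}\|u^{inter}(\varphi)\|\le\frac{\mu}{\gamma}\delta\sqrt{c_{out}}$ (Euclidean norm). Local asymptotic stability of this compact invariant set is meant in the standard sense: it is Lyapunov stable (for each neighbourhood $U$ of the set there is a neighbourhood $V$ of it such that solutions starting in $V$ stay in $U$ for all $t\ge0$), and there is a neighbourhood of it such that all solutions starting there have distance to the set tending to $0$ as $t\to\infty$. The matrices. Let $n_s$ be the number of elements of $\mathcal P_s$. The matrices $\tilde A_s$ and $D_s^-$ are $(n_s-1)\times(n_s-1)$, with rows and columns indexed by $\mathcal P_s\setminus\{i_s\}$: $$(\tilde A_s)_{iz}=a_{iz}-a_{i_sz},\qquad i,z\in\mathcal P_s\setminus\{i_s\},$$ i.e. $\tilde A_s$ is the adjacency matrix of the subgraph induced on $\mathcal P_s$ with the row and column of $i_s$ removed, minus the matrix all of whose rows equal $(a_{i_sz})_{z\in\mathcal P_s\setminus\{i_s\}}$; and $D_s^-$ is the diagonal matrix with entries $(D_s^-)_{ii}=\sum_{j\in\mathcal P_s}a_{ij}$ (the sum includes $j=i_s$). If $n_s=1$ the condition on $\tilde A_s-D_s^-$ is vacuous. *)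

theory Defs
  imports "HOL-Analysis.Analysis"
begin

text \<open>
  Nodes are the elements of a finite type \<open>'n\<close>, the clusters \<open>P s\<close> are indexed by a finite
  type \<open>'m\<close>, and \<open>sel s\<close> is the node selected in \<open>P s\<close>. Phases are given by real lifts, and functions
  on a torus are functions of real variables that are \<open>2\<pi>\<close>-periodic in each variable.
\<close>

section \<open>Graph, partition and cluster matrices\<close>

definition adj :: "('n \<times> 'n) set \<Rightarrow> 'n \<Rightarrow> 'n \<Rightarrow> real" where
  "adj E i j = (if (i, j) \<in> E then 1 else 0)"

definition is_partition :: "('m \<Rightarrow> 'n set) \<Rightarrow> bool" where
  "is_partition P \<longleftrightarrow> (\<forall>s. P s \<noteq> {}) \<and> disjoint_family P \<and> (\<Union>s. P s) = UNIV"

definition same_cluster :: "('m \<Rightarrow> 'n set) \<Rightarrow> 'n \<Rightarrow> 'n \<Rightarrow> bool" where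
  "same_cluster P i j \<longleftrightarrow> (\<exists>s. i \<in> P s \<and> j \<in> P s)"

definition num_inter_edges :: "('n \<times> 'n) set \<Rightarrow> ('m \<Rightarrow> 'n set) \<Rightarrow> nat" where
  "num_inter_edges E P = card {(i, j). (i, j) \<in> E \<and> \<not> same_cluster P i j}"

text \<open>The adjacency matrix of \<open>P s\<close> minus the row of \<open>sel s\<close>, minus the diagonal matrix of the
  in-cluster degrees. Only the entries with both indices in \<open>P s - {sel s}\<close> are meaningful.\<close>

definition cluster_matrix ::
    "('n \<times> 'n) set \<Rightarrow> ('m \<Rightarrow> 'n set) \<Rightarrow> ('m \<Rightarrow> 'n) \<Rightarrow> 'm \<Rightarrow> 'n \<Rightarrow> 'n \<Rightarrow> real" where
  "cluster_matrix E P sel s i z =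
     (adj E i z - adj E (sel s) z) - (if i = z then \<Sum>j\<in>P s. adj E i j else 0)"

text \<open>Complex eigenvalues of a real square matrix whose rows and columns are indexed by \<open>I\<close>.
  There are none if \<open>I\<close> is empty.\<close>

definition eigenvalue_on :: "'n set \<Rightarrow> ('n \<Rightarrow> 'n \<Rightarrow> real) \<Rightarrow> complex \<Rightarrow> bool" where
  "eigenvalue_on I A l \<longleftrightarrow>
     (\<exists>v. (\<exists>i\<in>I. v i \<noteq> 0) \<and> (\<forall>i\<in>I. (\<Sum>z\<in>I. complex_of_real (A i z) * v z) = l * v i))"

section \<open>The network and its error system\<close>

definition C1_norm :: "(real \<Rightarrow> real) \<Rightarrow> real" where
  "C1_norm f = max (SUP x. \<bar>f x\<bar>) (SUP x. \<bar>deriv f x\<bar>)"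

text \<open>The coupling strengths form a vector of \<open>\<real>\<^sup>E\<close>, represented by the matrices that vanish off
  the edge set.\<close>

definition network_solution ::
    "('n::finite \<times> 'n) set \<Rightarrow> ('m::finite \<Rightarrow> 'n set) \<Rightarrow> ('n \<Rightarrow> real) \<Rightarrow>
     real \<Rightarrow> real \<Rightarrow> real \<Rightarrow> (real \<Rightarrow> real) \<Rightarrow> real set \<Rightarrow>
     (real \<Rightarrow> real^'n) \<Rightarrow> (real \<Rightarrow> real^'n^'n) \<Rightarrow> bool" where
  "network_solution E P w \<gamma> \<mu>t \<mu> \<Gamma> J \<theta> k \<longleftrightarrow> (\<forall>t\<in>J.
     (\<forall>i j. (i, j) \<notin> E \<longrightarrow> k t $ i $ j = 0) \<and>
     (\<forall>i. ((\<lambda>\<tau>. \<theta> \<tau> $ i) has_real_derivative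
        w i + (\<Sum>j\<in>UNIV. adj E i j * k t $ i $ j * sin (\<theta> t $ j - \<theta> t $ i))) (at t within J)) \<and>
     (\<forall>(i, j)\<in>E. ((\<lambda>\<tau>. k \<tau> $ i $ j) has_real_derivative
        - \<gamma> * k t $ i $ j + (if same_cluster P i j then \<mu>t else \<mu>) * \<Gamma> (\<theta> t $ j - \<theta> t $ i))
          (at t within J)))"

text \<open>The error \<open>e\<close> is a vector of \<open>\<real>\<^sup>N\<close> with \<open>e $ sel s = 0\<close> for all \<open>s\<close>, that is, an
  element of \<open>\<real>\<^sup>N\<^sup>-\<^sup>m\<close>.\<close>

definition error_solution ::
    "('n::finite \<times> 'n) set \<Rightarrow> ('m::finite \<Rightarrow> 'n set) \<Rightarrow> ('m \<Rightarrow> 'n) \<Rightarrow> ('n \<Rightarrow> real) \<Rightarrow>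
     real \<Rightarrow> real \<Rightarrow> real \<Rightarrow> (real \<Rightarrow> real) \<Rightarrow> real set \<Rightarrow>
     (real \<Rightarrow> real^'n) \<Rightarrow> (real \<Rightarrow> real^'n^'n) \<Rightarrow> (real \<Rightarrow> real^'m) \<Rightarrow> bool" where
  "error_solution E P sel w \<gamma> \<mu>t \<mu> \<Gamma> J e k \<phi> \<longleftrightarrow> (\<forall>t\<in>J.
     (\<forall>s. e t $ sel s = 0) \<and>
     (\<forall>i j. (i, j) \<notin> E \<longrightarrow> k t $ i $ j = 0) \<and>
     (\<forall>s. ((\<lambda>\<tau>. \<phi> \<tau> $ s) has_real_derivative
        w (sel s)
        + (\<Sum>j\<in>P s. adj E (sel s) j * k t $ sel s $ j * sin (e t $ j))
        + (\<Sum>r\<in>UNIV - {s}. \<Sum>j\<in>P r.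
             adj E (sel s) j * k t $ sel s $ j * sin (e t $ j + \<phi> t $ r - \<phi> t $ s)))
          (at t within J)) \<and>
     (\<forall>s. \<forall>i\<in>P s - {sel s}. ((\<lambda>\<tau>. e \<tau> $ i) has_real_derivative
        w i - w (sel s)
        + (\<Sum>j\<in>P s. adj E i j * k t $ i $ j * sin (e t $ j - e t $ i)
             - adj E (sel s) j * k t $ sel s $ j * sin (e t $ j))
        + (\<Sum>r\<in>UNIV - {s}. \<Sum>j\<in>P r.
             adj E i j * k t $ i $ j * sin (e t $ j - e t $ i + \<phi> t $ r - \<phi> t $ s)
             - adj E (sel s) j * k t $ sel s $ j * sin (e t $ j + \<phi> t $ r - \<phi> t $ s)))
          (at t within J)) \<and>
     (\<forall>s r. s \<noteq> r \<longrightarrow> (\<forall>i\<in>P s. \<forall>j\<in>P r. (i, j) \<in> E \<longrightarrow>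
        ((\<lambda>\<tau>. k \<tau> $ i $ j) has_real_derivative
          - \<gamma> * k t $ i $ j + \<mu> * \<Gamma> (e t $ j - e t $ i + \<phi> t $ r - \<phi> t $ s)) (at t within J))) \<and>
     (\<forall>s. \<forall>i\<in>P s. \<forall>j\<in>P s. (i, j) \<in> E \<longrightarrow>
        ((\<lambda>\<tau>. k \<tau> $ i $ j) has_real_derivative
          - \<gamma> * k t $ i $ j + \<mu>t * \<Gamma> (e t $ j - e t $ i)) (at t within J)))"

lemma sum_clusters:
  fixes P :: "'m::finite \<Rightarrow> 'n::finite set" and f :: "'n \<Rightarrow> real"
  assumes "is_partition P"
  shows "(\<Sum>j\<in>UNIV. f j) = (\<Sum>j\<in>P s. f j) + (\<Sum>r\<in>UNIV - {s}. \<Sum>j\<in>P r. f j)"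
proof -
  have U: "(\<Union>r. P r) = UNIV" and d: "\<forall>r\<in>UNIV. \<forall>q\<in>UNIV. r \<noteq> q \<longrightarrow> P r \<inter> P q = {}"
    using assms by (auto simp: is_partition_def disjoint_family_on_def)
  have "(\<Sum>j\<in>UNIV. f j) = (\<Sum>r\<in>UNIV. \<Sum>j\<in>P r. f j)"
    unfolding U[symmetric] by (rule sum.UNION_disjoint) (use d in auto)
  then show ?thesis by (simp add: sum.remove[of UNIV s])
qed

text \<open>The error system is the network in the coordinates \<open>\<phi>\<^sub>s = \<theta>\<^bsub>sel s\<^esub>\<close>, \<open>e\<^sub>i = \<theta>\<^sub>i - \<phi>\<^sub>s\<close>.\<close>

lemma network_solution_iff_error_solution:
  fixes P :: "'m::finite \<Rightarrow> 'n::finite set"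
  assumes P: "is_partition P" and sel_in: "\<And>s. sel s \<in> P s"
    and \<phi>: "\<And>t s. \<phi> t $ s = \<theta> t $ sel s"
    and e: "\<And>t s i. i \<in> P s \<Longrightarrow> e t $ i = \<theta> t $ i - \<phi> t $ s"
  shows "network_solution E P w \<gamma> \<mu>t \<mu> \<Gamma> J \<theta> k \<longleftrightarrow> error_solution E P sel w \<gamma> \<mu>t \<mu> \<Gamma> J e k \<phi>"
proof -
  have disj: "s = r" if "i \<in> P s" "i \<in> P r" for i s r
    using P that by (auto simp: is_partition_def disjoint_family_on_def)
  have cover: "\<exists>s. i \<in> P s" for i
    using P by (auto simp: is_partition_def)
  have same: "same_cluster P i j \<longleftrightarrow> s = r" if "i \<in> P s" "j \<in> P r" for i j s r
    unfolding same_cluster_def using that by (metis disj)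
  have e0: "e t $ sel s = 0" for t s
    using e[OF sel_in] \<phi> by simp
  define G where "G t i = w i + (\<Sum>j\<in>UNIV. adj E i j * k t $ i $ j * sin (\<theta> t $ j - \<theta> t $ i))" for t i
  have G: "G t i = w i + (\<Sum>j\<in>P s. adj E i j * k t $ i $ j * sin (e t $ j - e t $ i))
      + (\<Sum>r\<in>UNIV - {s}. \<Sum>j\<in>P r.
          adj E i j * k t $ i $ j * sin (e t $ j - e t $ i + \<phi> t $ r - \<phi> t $ s))"
    if "i \<in> P s" for t i s
  proof -
    have "\<theta> t $ j - \<theta> t $ i = e t $ j - e t $ i + \<phi> t $ r - \<phi> t $ s" if "j \<in> P r" for j r
      using e[OF that, of t] e[OF \<open>i \<in> P s\<close>, of t] by simp
    then show ?thesis
      unfolding G_def sum_clusters[OF P, of _ s] by simp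
  qed
  have phase: "(\<forall>i. ((\<lambda>\<tau>. \<theta> \<tau> $ i) has_real_derivative G t i) (at t within J)) \<longleftrightarrow>
      (\<forall>s. ((\<lambda>\<tau>. \<phi> \<tau> $ s) has_real_derivative G t (sel s)) (at t within J)) \<and>
      (\<forall>s. \<forall>i\<in>P s - {sel s}.
         ((\<lambda>\<tau>. e \<tau> $ i) has_real_derivative G t i - G t (sel s)) (at t within J))"
    (is "?L \<longleftrightarrow> ?R1 \<and> ?R2") for t
  proof
    assume L: ?L
    then have ?R1 by (simp add: \<phi>)
    moreover have ?R2
    proof (intro allI ballI)
      fix s i assume "i \<in> P s - {sel s}"
      then have "e \<tau> $ i = \<theta> \<tau> $ i - \<phi> \<tau> $ s" for \<tau> by (simp add: e)
      then show "((\<lambda>\<tau>. e \<tau> $ i) has_real_derivative G t i - G t (sel s)) (at t within J)"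
        using DERIV_diff[OF spec[OF L, of i] spec[OF \<open>?R1\<close>, of s]] by simp
    qed
    ultimately show "?R1 \<and> ?R2" ..
  next
    assume R: "?R1 \<and> ?R2"
    show ?L
    proof
      fix i
      obtain s where s: "i \<in> P s" using cover by blast
      show "((\<lambda>\<tau>. \<theta> \<tau> $ i) has_real_derivative G t i) (at t within J)"
      proof (cases "i = sel s")
        case True
        then show ?thesis using R by (simp add: \<phi>)
      next
        case False
        then have "((\<lambda>\<tau>. e \<tau> $ i + \<phi> \<tau> $ s) has_real_derivative
            (G t i - G t (sel s)) + G t (sel s)) (at t within J)"
          using R s by (intro DERIV_add) auto
        moreover have "e \<tau> $ i + \<phi> \<tau> $ s = \<theta> \<tau> $ i" for \<tau> using e[OF s] by simp
        ultimately show ?thesis by simp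
      qed
    qed
  qed
  have arg: "\<theta> t $ j - \<theta> t $ i = e t $ j - e t $ i + \<phi> t $ r - \<phi> t $ s"
    if "i \<in> P s" "j \<in> P r" for t i j s r
    using e[OF that(1), of t] e[OF that(2), of t] by simp
  have arg': "\<theta> t $ j - \<theta> t $ i = e t $ j - e t $ i" if "i \<in> P s" "j \<in> P s" for t i j s
    using arg[OF that] by simp
  have coupling: "(\<forall>(i, j)\<in>E. ((\<lambda>\<tau>. k \<tau> $ i $ j) has_real_derivative
        - \<gamma> * k t $ i $ j + (if same_cluster P i j then \<mu>t else \<mu>) * \<Gamma> (\<theta> t $ j - \<theta> t $ i))
          (at t within J)) \<longleftrightarrow>
     (\<forall>s r. s \<noteq> r \<longrightarrow> (\<forall>i\<in>P s. \<forall>j\<in>P r. (i, j) \<in> E \<longrightarrow>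
        ((\<lambda>\<tau>. k \<tau> $ i $ j) has_real_derivative
          - \<gamma> * k t $ i $ j + \<mu> * \<Gamma> (e t $ j - e t $ i + \<phi> t $ r - \<phi> t $ s)) (at t within J))) \<and>
     (\<forall>s. \<forall>i\<in>P s. \<forall>j\<in>P s. (i, j) \<in> E \<longrightarrow>
        ((\<lambda>\<tau>. k \<tau> $ i $ j) has_real_derivative
          - \<gamma> * k t $ i $ j + \<mu>t * \<Gamma> (e t $ j - e t $ i)) (at t within J))"
    (is "?L \<longleftrightarrow> ?R1 \<and> ?R2") for t
  proof
    assume L: ?L
    have ?R1
    proof (intro allI impI ballI)
      fix s r i j assume *: "s \<noteq> r" "i \<in> P s" "j \<in> P r" "(i, j) \<in> E"
      show "((\<lambda>\<tau>. k \<tau> $ i $ j) has_real_derivative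
          - \<gamma> * k t $ i $ j + \<mu> * \<Gamma> (e t $ j - e t $ i + \<phi> t $ r - \<phi> t $ s)) (at t within J)"
        using bspec[OF L *(4)] *(1) same[OF *(2,3)] arg[OF *(2,3)] by simp
    qed
    moreover have ?R2
    proof (intro allI impI ballI)
      fix s i j assume *: "i \<in> P s" "j \<in> P s" "(i, j) \<in> E"
      show "((\<lambda>\<tau>. k \<tau> $ i $ j) has_real_derivative
          - \<gamma> * k t $ i $ j + \<mu>t * \<Gamma> (e t $ j - e t $ i)) (at t within J)"
        using bspec[OF L *(3)] same[OF *(1,2)] arg'[OF *(1,2)] by simp
    qed
    ultimately show "?R1 \<and> ?R2" ..
  next
    assume R: "?R1 \<and> ?R2"
    show ?L
    proof clarify
      fix i j assume E: "(i, j) \<in> E"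
      obtain s r where sr: "i \<in> P s" "j \<in> P r" using cover by meson
      show "((\<lambda>\<tau>. k \<tau> $ i $ j) has_real_derivative
        - \<gamma> * k t $ i $ j + (if same_cluster P i j then \<mu>t else \<mu>) * \<Gamma> (\<theta> t $ j - \<theta> t $ i))
          (at t within J)"
      proof (cases "s = r")
        case True
        then show ?thesis
          using conjunct2[OF R] E sr same[OF sr] arg'[of i s j] by auto
      next
        case False
        then show ?thesis
          using conjunct1[OF R] E sr same[OF sr] arg[OF sr] by auto
      qed
    qed
  qed
  have G1: "G t (sel s) = w (sel s)
        + (\<Sum>j\<in>P s. adj E (sel s) j * k t $ sel s $ j * sin (e t $ j))
        + (\<Sum>r\<in>UNIV - {s}. \<Sum>j\<in>P r.
             adj E (sel s) j * k t $ sel s $ j * sin (e t $ j + \<phi> t $ r - \<phi> t $ s))" for t s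
    using G[OF sel_in, of t s] by (simp add: e0)
  have G2: "G t i - G t (sel s) = w i - w (sel s)
        + (\<Sum>j\<in>P s. adj E i j * k t $ i $ j * sin (e t $ j - e t $ i)
             - adj E (sel s) j * k t $ sel s $ j * sin (e t $ j))
        + (\<Sum>r\<in>UNIV - {s}. \<Sum>j\<in>P r.
             adj E i j * k t $ i $ j * sin (e t $ j - e t $ i + \<phi> t $ r - \<phi> t $ s)
             - adj E (sel s) j * k t $ sel s $ j * sin (e t $ j + \<phi> t $ r - \<phi> t $ s))"
    if "i \<in> P s - {sel s}" for t i s
    using that unfolding G1 by (simp add: G[of i s] sum_subtractf)
  have phase': "(\<forall>i. ((\<lambda>\<tau>. \<theta> \<tau> $ i) has_real_derivative
        w i + (\<Sum>j\<in>UNIV. adj E i j * k t $ i $ j * sin (\<theta> t $ j - \<theta> t $ i))) (at t within J)) \<longleftrightarrow>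
     (\<forall>s. ((\<lambda>\<tau>. \<phi> \<tau> $ s) has_real_derivative
        w (sel s)
        + (\<Sum>j\<in>P s. adj E (sel s) j * k t $ sel s $ j * sin (e t $ j))
        + (\<Sum>r\<in>UNIV - {s}. \<Sum>j\<in>P r.
             adj E (sel s) j * k t $ sel s $ j * sin (e t $ j + \<phi> t $ r - \<phi> t $ s)))
          (at t within J)) \<and>
     (\<forall>s. \<forall>i\<in>P s - {sel s}. ((\<lambda>\<tau>. e \<tau> $ i) has_real_derivative
        w i - w (sel s)
        + (\<Sum>j\<in>P s. adj E i j * k t $ i $ j * sin (e t $ j - e t $ i)
             - adj E (sel s) j * k t $ sel s $ j * sin (e t $ j))
        + (\<Sum>r\<in>UNIV - {s}. \<Sum>j\<in>P r.
             adj E i j * k t $ i $ j * sin (e t $ j - e t $ i + \<phi> t $ r - \<phi> t $ s)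
             - adj E (sel s) j * k t $ sel s $ j * sin (e t $ j + \<phi> t $ r - \<phi> t $ s)))
          (at t within J))" for t
    using phase[of t] unfolding G1[symmetric] by (simp add: G2[symmetric] flip: G_def)
  show ?thesis
    unfolding network_solution_def error_solution_def phase' coupling by (simp add: e0)
qed

section \<open>Phase space, invariance and stability\<close>

text \<open>The torus is embedded in \<open>\<complex>\<^sup>m\<close> as a product of unit circles.\<close>

definition torus_point :: "real^'m \<Rightarrow> complex^'m" where
  "torus_point \<phi> = (\<chi> s. cis (\<phi> $ s))"

definition state_space ::
    "('n::finite \<times> 'n) set \<Rightarrow> ('m::finite \<Rightarrow> 'n) \<Rightarrow> ((real^'n) \<times> (real^'n^'n) \<times> (complex^'m)) set" where
  "state_space E sel = {(e, k, z).
     (\<forall>s. e $ sel s = 0) \<and> (\<forall>i j. (i, j) \<notin> E \<longrightarrow> k $ i $ j = 0) \<and> z \<in> range torus_point}"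

definition error_trajectories ::
    "('n::finite \<times> 'n) set \<Rightarrow> ('m::finite \<Rightarrow> 'n set) \<Rightarrow> ('m \<Rightarrow> 'n) \<Rightarrow> ('n \<Rightarrow> real) \<Rightarrow>
     real \<Rightarrow> real \<Rightarrow> real \<Rightarrow> (real \<Rightarrow> real) \<Rightarrow> real set \<Rightarrow>
     (real \<Rightarrow> (real^'n) \<times> (real^'n^'n) \<times> (complex^'m)) set" where
  "error_trajectories E P sel w \<gamma> \<mu>t \<mu> \<Gamma> J =
     {x. \<exists>e k \<phi>. error_solution E P sel w \<gamma> \<mu>t \<mu> \<Gamma> J e k \<phi> \<and>
                 (\<forall>t\<in>J. x t = (e t, k t, torus_point (\<phi> t)))}"

text \<open>In the next definition \<open>T\<close> is the set of trajectories defined on the whole real line, in the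
  one after it \<open>T\<close> is the set of trajectories defined on \<open>{0..}\<close>. For continuously differentiable
  \<open>\<Gamma>\<close> the right-hand side of the error system is locally Lipschitz and of at most linear growth, so
  through every state there is exactly one trajectory of either kind, and nothing is lost by not
  considering smaller intervals.\<close>

definition invariant_set :: "(real \<Rightarrow> 'a) set \<Rightarrow> 'a set \<Rightarrow> bool" where
  "invariant_set T M \<longleftrightarrow>
     (\<forall>p\<in>M. \<exists>x\<in>T. x 0 = p) \<and> (\<forall>x\<in>T. x 0 \<in> M \<longrightarrow> (\<forall>t. x t \<in> M))"

definition locally_asymptotically_stable ::
    "'a::metric_space set \<Rightarrow> (real \<Rightarrow> 'a) set \<Rightarrow> 'a set \<Rightarrow> bool" where
  "locally_asymptotically_stable S T M \<longleftrightarrow>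
     (\<forall>U. openin (top_of_set S) U \<and> M \<subseteq> U \<longrightarrow>
        (\<exists>V. openin (top_of_set S) V \<and> M \<subseteq> V \<and> (\<forall>x\<in>T. x 0 \<in> V \<longrightarrow> (\<forall>t\<ge>0. x t \<in> U)))) \<and>
     (\<exists>V. openin (top_of_set S) V \<and> M \<subseteq> V \<and>
        (\<forall>x\<in>T. x 0 \<in> V \<longrightarrow> ((\<lambda>t. infdist (x t) M) \<longlongrightarrow> 0) at_top))"

section \<open>The invariant toroidal manifold\<close>

definition torus_continuous :: "(real^'m::finite \<Rightarrow> 'b::topological_space) \<Rightarrow> bool" where
  "torus_continuous u \<longleftrightarrow> continuous_on UNIV u \<and> (\<forall>\<phi> s. u (\<phi> + axis s (2 * pi)) = u \<phi>)"

definition torus_graph ::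
    "(real^'m \<Rightarrow> real^'n^'n) \<Rightarrow> ((real^'n::finite) \<times> (real^'n^'n) \<times> (complex^'m::finite)) set" where
  "torus_graph u = range (\<lambda>\<phi>. (0, u \<phi>, torus_point \<phi>))"

definition invariant_toroidal_manifold ::
    "('n::finite \<times> 'n) set \<Rightarrow> ('m::finite \<Rightarrow> 'n set) \<Rightarrow> ('m \<Rightarrow> 'n) \<Rightarrow> ('n \<Rightarrow> real) \<Rightarrow>
     real \<Rightarrow> real \<Rightarrow> real \<Rightarrow> (real \<Rightarrow> real) \<Rightarrow>
     ((real^'n) \<times> (real^'n^'n) \<times> (complex^'m)) set \<Rightarrow> bool" where
  "invariant_toroidal_manifold E P sel w \<gamma> \<mu>t \<mu> \<Gamma> M \<longleftrightarrow>
     (\<exists>u. torus_continuous u \<and> M = torus_graph u) \<and> M \<subseteq> state_space E sel \<and>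
     invariant_set (error_trajectories E P sel w \<gamma> \<mu>t \<mu> \<Gamma> UNIV) M"

end

theory Submission
  imports Defs "Jordan_Normal_Form.Schur_Decomposition"
begin

text \<open>
  On the synchronous states the phases obey \<open>\<phi>\<^sub>s' = w\<^sub>s + \<Sum>\<^sub>r c\<^sub>s\<^sub>r \<kappa>\<^sub>s\<^sub>r sin (\<phi>\<^sub>r - \<phi>\<^sub>s)\<close>, where the
  couplings \<open>\<kappa>\<^sub>s\<^sub>r\<close> relax at the rate \<open>\<gamma>\<close> towards values of order \<open>\<nu>\<close>. For small \<open>\<nu>\<close> a contraction on
  curves with a \<open>cosh\<close> weight gives through every phase exactly one orbit on \<open>\<real>\<close> with bounded
  couplings, and these couplings are Lipschitz in the phase with constant \<open>O(\<nu>)\<close>. Their graph is the only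
  invariant toroidal manifold.

  For stability, a solution is compared with an orbit on the manifold. Take a Lyapunov form of the
  linearization for the errors, plus weighted squares of the coupling deviations, minus a small
  multiple of the squared distance of the phases. For small \<open>\<nu>\<close> this function decays exponentially as
  long as errors and intra-cluster couplings stay close to their synchronous values. Comparing with
  the orbit that has the same phase at the final time bounds the deviation from the manifold then
  by its initial value, which also closes the bootstrap.
\<close>

section \<open>A Lyapunov form for a stable matrix\<close>

text \<open>The slaved couplings are shown to be Lipschitz in the phase, not differentiable, so the
  distance of the couplings from their slaved values cannot be differentiated along an arbitrary
  solution. Along an orbit on the manifold it can, because there the slaved couplings solve the
  coupling equation; this forces the comparison with a second solution. The price is the phase
  difference, a neutral direction without decay of its own. Subtracting its square leaves a term of
  favourable sign in the decay estimate, and this term pays twice: for the growth of the phase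
  difference, and for replacing the phase of the orbit by that of the solution at the initial time.
  The second payment is possible because the Lipschitz constant of the slaved couplings is of order
  \<nu>. Uniqueness of the manifold belongs to the argument since the stability claim concerns every
  invariant torus of the given form, whereas the estimates concern one constructed graph.\<close>

lemma triangular_coordinates:
  fixes A :: "'n \<Rightarrow> 'n \<Rightarrow> real"
  assumes "finite I"
  obtains n :: nat and p q T where
    "\<And>a d. a < n \<Longrightarrow> d \<in> I \<Longrightarrow>
       (\<Sum>i\<in>I. q a i * complex_of_real (A i d)) = (\<Sum>b<n. T a b * q b d)"
    "\<And>i j. i \<in> I \<Longrightarrow> j \<in> I \<Longrightarrow> (\<Sum>a<n. p i a * q a j) = (if i = j then 1 else (0::complex))"
    "\<And>a b. a < n \<Longrightarrow> b < a \<Longrightarrow> T a b = 0"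
    "\<And>a. a < n \<Longrightarrow> eigenvalue_on I A (T a a)"
proof -
  \<comment> \<open>The Schur decomposition acts on matrices indexed by the numbers below
    \<open>n\<close>. The enumeration \<open>h\<close> of \<open>I\<close> and its inverse
    \<open>g\<close> carry the matrix there and the result back.\<close>
  define n where "n = card I"
  obtain h where h: "bij_betw h {..<n} I"
    using ex_bij_betw_nat_finite[OF assms] by (auto simp: n_def atLeast0LessThan)
  define g where "g = the_inv_into {..<n} h"
  have g: "g i < n" "h (g i) = i" if "i \<in> I" for i
    using that h unfolding g_def bij_betw_def
    by (metis f_the_inv_into_f the_inv_into_into lessThan_iff order_refl,
        metis f_the_inv_into_f)
  have gh: "g (h a) = a" if "a < n" for a
    using that h unfolding g_def bij_betw_def by (simp add: the_inv_into_f_f)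
  have hI: "h a \<in> I" if "a < n" for a
    using that h by (auto simp: bij_betw_def)
  have reindex: "(\<Sum>i\<in>I. f i) = (\<Sum>a<n. f (h a))" for f :: "'n \<Rightarrow> complex"
    using sum.reindex_bij_betw[OF h, of f] by simp
  define M where "M = mat n n (\<lambda>(a, b). complex_of_real (A (h a) (h b)))"
  have M: "M \<in> carrier_mat n n" by (simp add: M_def)
  obtain es where es: "char_poly M = (\<Prod>a\<leftarrow>es. [:- a, 1:])"
    using char_poly_factorized[OF M] by blast
  obtain B P Q where BPQ: "schur_decomposition M es = (B, P, Q)"
    by (cases "schur_decomposition M es") auto
  have sim: "similar_mat_wit M B P Q" and tri: "upper_triangular B" and diag: "diag_mat B = es"
    using schur_decomposition[OF M es BPQ] by auto
  have B: "B \<in> carrier_mat n n" and P: "P \<in> carrier_mat n n" and Q: "Q \<in> carrier_mat n n"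
    and PQ: "P * Q = 1\<^sub>m n" and QP: "Q * P = 1\<^sub>m n" and M_eq: "M = P * B * Q"
    using similar_mat_witD2[OF M sim] by auto
  \<comment> \<open>The rows of \<open>Q\<close> are linear functionals in which the matrix acts as
    the triangular matrix \<open>B\<close>.\<close>
  have QM: "Q * M = B * Q"
  proof -
    have "Q * M = Q * (P * (B * Q))" using assoc_mult_mat[OF P B Q] by (simp add: M_eq)
    also have "\<dots> = (Q * P) * (B * Q)"
      using assoc_mult_mat[OF Q P mult_carrier_mat[OF B Q]] by simp
    finally show ?thesis using left_mult_one_mat[OF mult_carrier_mat[OF B Q]] by (simp add: QP)
  qed
  have times: "(X * Y) $$ (a, b) = (\<Sum>c<n. X $$ (a, c) * Y $$ (c, b))"
    if "X \<in> carrier_mat n n" "Y \<in> carrier_mat n n" "a < n" "b < n" for X Y :: "complex mat" and a b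
    using that by (simp add: scalar_prod_def atLeast0LessThan)
  have eig: "eigenvalue_on I A (B $$ (a, a))" if a: "a < n" for a
  proof -
    have "B $$ (a, a) \<in> set es"
      using diag a B by (auto simp: diag_mat_def)
    then have "eigenvalue M (B $$ (a, a))"
      unfolding eigenvalue_root_char_poly[OF M] es poly_prod_list prod_list_zero_iff by force
    then obtain v where v: "v \<in> carrier_vec n" "v \<noteq> 0\<^sub>v n" "M *\<^sub>v v = B $$ (a, a) \<cdot>\<^sub>v v"
      using M by (auto simp: eigenvalue_def eigenvector_def)
    obtain b where b: "b < n" "v $ b \<noteq> 0"
      using v by (metis eq_vecI carrier_vecD index_zero_vec)
    show ?thesis
      unfolding eigenvalue_on_def
    proof (intro exI[of _ "\<lambda>i. v $ g i"] conjI ballI)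
      show "\<exists>i\<in>I. v $ g i \<noteq> 0" using b gh hI by force
      fix i assume i: "i \<in> I"
      have "(\<Sum>z\<in>I. complex_of_real (A i z) * v $ g z) = (M *\<^sub>v v) $ g i"
        using g[OF i] v(1) unfolding reindex
        by (simp add: M_def scalar_prod_def atLeast0LessThan gh)
      then show "(\<Sum>z\<in>I. complex_of_real (A i z) * v $ g z) = B $$ (a, a) * v $ g i"
        using v(1) g[OF i] by (simp add: v(3))
    qed
  qed
  \<comment> \<open>\<open>q\<close> gives the triangular coordinates of a vector, \<open>p\<close>
    recovers the vector from them, and \<open>T\<close> is the matrix in these coordinates.\<close>
  show thesis
  proof (rule that[of n "\<lambda>a i. Q $$ (a, g i)" "\<lambda>a b. B $$ (a, b)" "\<lambda>i a. P $$ (g i, a)"])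
    show "(\<Sum>i\<in>I. Q $$ (a, g i) * complex_of_real (A i d)) = (\<Sum>b<n. B $$ (a, b) * Q $$ (b, g d))"
      if "a < n" "d \<in> I" for a d
    proof -
      have "(\<Sum>i\<in>I. Q $$ (a, g i) * complex_of_real (A i d)) = (Q * M) $$ (a, g d)"
        unfolding reindex times[OF Q M that(1) g(1)[OF that(2)]]
        by (rule sum.cong) (use g[OF that(2)] in \<open>auto simp: M_def gh\<close>)
      then show ?thesis
        using times[OF B Q that(1) g(1)[OF that(2)]] by (simp add: QM)
    qed
    show "(\<Sum>a<n. P $$ (g i, a) * Q $$ (a, g j)) = (if i = j then 1 else 0)"
      if "i \<in> I" "j \<in> I" for i j
    proof -
      have "g i = g j \<longleftrightarrow> i = j" using g that by metis
      then show ?thesis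
        using times[OF P Q g(1)[OF that(1)] g(1)[OF that(2)]] g that by (simp add: PQ)
    qed
    show "B $$ (a, b) = 0" if "a < n" "b < a" for a b
      using tri that B by (simp add: upper_triangular_def)
    show "eigenvalue_on I A (B $$ (a, a))" if "a < n" for a
      using eig[OF that] .
  qed
qed

no_notation vec_index (infixl "$" 100)
hide_fact (open) Matrix.vec_eq_iff

lemma sum_mult_sum_le:
  fixes y :: "nat \<Rightarrow> real"
  shows "(\<Sum>a<n. \<Sum>b<n. y a * y b) \<le> n * (\<Sum>a<n. (y a)\<^sup>2)"
proof -
  have "(\<Sum>a<n. \<Sum>b<n. y a * y b) = (\<Sum>a<n. y a * 1)\<^sup>2"
    by (simp add: power2_eq_square sum_product)
  also have "\<dots> \<le> (\<Sum>a<n. (y a)\<^sup>2) * (\<Sum>a<n. 1\<^sup>2)"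
    by (rule Cauchy_Schwarz_ineq_sum)
  finally show ?thesis by (simp add: mult.commute)
qed

text \<open>In triangular coordinates the sum of the squared moduli with weights
  \<open>\<rho> ^ (2 * a)\<close> is a Lyapunov form once \<open>\<rho>\<close> is large: rescaling
  coordinate \<open>a\<close> by \<open>\<rho> ^ a\<close> divides every entry above the diagonal by
  at least \<open>\<rho>\<close>, and the diagonal consists of eigenvalues. The form dominates the
  Euclidean square because the coordinates determine the vector.\<close>

lemma lyapunov_form:
  fixes A :: "'n \<Rightarrow> 'n \<Rightarrow> real"
  assumes I: "finite I" and stable: "\<And>l. eigenvalue_on I A l \<Longrightarrow> Re l < 0"
  obtains S :: "'n \<Rightarrow> 'n \<Rightarrow> real" and b m where
    "\<And>i j. S i j = S j i" "b > 0" "m > 0"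
    "\<And>x. m * (\<Sum>i\<in>I. (x i)\<^sup>2) \<le> (\<Sum>i\<in>I. \<Sum>j\<in>I. S i j * x i * x j)"
    "\<And>x. (\<Sum>i\<in>I. \<Sum>j\<in>I. S i j * x i * (\<Sum>z\<in>I. A j z * x z)) \<le> - b * (\<Sum>i\<in>I. (x i)\<^sup>2)"
proof -
  obtain n :: nat and p q T where
    qA: "\<And>a d. a < n \<Longrightarrow> d \<in> I \<Longrightarrow>
       (\<Sum>i\<in>I. q a i * complex_of_real (A i d)) = (\<Sum>b<n. T a b * q b d)"
    and pq: "\<And>i j. i \<in> I \<Longrightarrow> j \<in> I \<Longrightarrow> (\<Sum>a<n. p i a * q a j) = (if i = j then 1 else (0::complex))"
    and tri: "\<And>a b. a < n \<Longrightarrow> b < a \<Longrightarrow> T a b = 0"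
    and eig: "\<And>a. a < n \<Longrightarrow> eigenvalue_on I A (T a a)"
    by (rule triangular_coordinates[OF I, of A]) (rule that, assumption+)
  have Re_cnj_mult: "Re (cnj z * z) = (cmod z)\<^sup>2" for z
    unfolding cmod_power2 by (simp add: power2_eq_square)
  have Re_complex_of_real_mult: "Re (complex_of_real r * z) = r * Re z" for r z by simp
  define \<zeta> where "\<zeta> x a = (\<Sum>i\<in>I. q a i * complex_of_real (x i))" for x a
  have \<zeta>A: "\<zeta> (\<lambda>j. \<Sum>z\<in>I. A j z * x z) a = (\<Sum>b<n. T a b * \<zeta> x b)" if "a < n" for x a
  proof -
    have "\<zeta> (\<lambda>j. \<Sum>z\<in>I. A j z * x z) a
        = (\<Sum>i\<in>I. \<Sum>z\<in>I. q a i * complex_of_real (A i z) * complex_of_real (x z))"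
      by (simp add: \<zeta>_def sum_distrib_left mult.assoc)
    also have "\<dots> = (\<Sum>z\<in>I. (\<Sum>i\<in>I. q a i * complex_of_real (A i z)) * complex_of_real (x z))"
      by (subst sum.swap) (simp add: sum_distrib_right)
    also have "\<dots> = (\<Sum>z\<in>I. \<Sum>b<n. T a b * q b z * complex_of_real (x z))"
      using qA[OF that] by (simp add: sum_distrib_right)
    also have "\<dots> = (\<Sum>b<n. T a b * \<zeta> x b)"
      by (subst sum.swap) (simp add: \<zeta>_def sum_distrib_left mult.assoc)
    finally show ?thesis .
  qed
  \<comment> \<open>Squared Frobenius norm of the inverse change of coordinates; by Cauchy-Schwarz
    it bounds a vector by its coordinates.\<close>
  define \<pi> where "\<pi> = (\<Sum>i\<in>I. \<Sum>a<n. (cmod (p i a))\<^sup>2)"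
  have x_le: "(\<Sum>i\<in>I. (x i)\<^sup>2) \<le> \<pi> * (\<Sum>a<n. (cmod (\<zeta> x a))\<^sup>2)" for x
  proof -
    have "(x i)\<^sup>2 \<le> (\<Sum>a<n. (cmod (p i a))\<^sup>2) * (\<Sum>a<n. (cmod (\<zeta> x a))\<^sup>2)" if i: "i \<in> I" for i
    proof -
      have "(\<Sum>a<n. p i a * \<zeta> x a) = (\<Sum>j\<in>I. \<Sum>a<n. p i a * q a j * complex_of_real (x j))"
        by (subst sum.swap) (simp add: \<zeta>_def sum_distrib_left mult.assoc)
      also have "\<dots> = (\<Sum>j\<in>I. (if i = j then 1 else 0) * complex_of_real (x j))"
        by (rule sum.cong) (auto simp: pq[OF i] simp flip: sum_distrib_right)
      also have "\<dots> = complex_of_real (x i)"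
        using I i by (simp add: if_distrib[of "\<lambda>c. c * _"] cong: if_cong)
      finally have "\<bar>x i\<bar> = cmod (\<Sum>a<n. p i a * \<zeta> x a)" by simp
      also have "\<dots> \<le> (\<Sum>a<n. cmod (p i a) * cmod (\<zeta> x a))"
        by (rule order_trans[OF norm_sum]) (simp add: norm_mult)
      finally have "\<bar>x i\<bar>\<^sup>2 \<le> (\<Sum>a<n. cmod (p i a) * cmod (\<zeta> x a))\<^sup>2"
        by (rule power_mono) simp
      also have "\<dots> \<le> (\<Sum>a<n. (cmod (p i a))\<^sup>2) * (\<Sum>a<n. (cmod (\<zeta> x a))\<^sup>2)"
        by (rule Cauchy_Schwarz_ineq_sum)
      finally show ?thesis by simp
    qed
    then have "(\<Sum>i\<in>I. (x i)\<^sup>2) \<le> (\<Sum>i\<in>I. (\<Sum>a<n. (cmod (p i a))\<^sup>2) * (\<Sum>a<n. (cmod (\<zeta> x a))\<^sup>2))"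
      by (rule sum_mono)
    then show ?thesis by (simp add: \<pi>_def sum_distrib_right)
  qed
  have \<pi>0: "\<pi> \<ge> 0" by (simp add: \<pi>_def sum_nonneg)
  \<comment> \<open>Half of the spectral gap \<open>d\<close> is kept, the other half pays for the
    entries above the diagonal. The inserted 1 gives the minimum a value when there are no
    coordinates.\<close>
  define d where "d = Min (insert 1 ((\<lambda>a. - Re (T a a)) ` {..<n}))"
  define \<beta> where "\<beta> = d / 2"
  have \<beta>0: "\<beta> > 0" using stable[OF eig] by (auto simp: \<beta>_def d_def)
  have \<beta>: "Re (T a a) \<le> - 2 * \<beta>" if "a < n" for a
  proof -
    have "d \<le> - Re (T a a)"
      unfolding d_def by (rule Min_le) (use that in auto)
    then show ?thesis by (simp add: \<beta>_def)
  qed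
  define \<tau> where "\<tau> = (\<Sum>a<n. \<Sum>b<n. cmod (T a b))"
  have \<tau>: "cmod (T a b) \<le> \<tau>" if "a < n" "b < n" for a b
  proof -
    have "cmod (T a b) \<le> (\<Sum>b<n. cmod (T a b))"
      by (rule member_le_sum) (use that in auto)
    also have "\<dots> \<le> \<tau>"
      unfolding \<tau>_def by (rule member_le_sum[of a]) (use that in \<open>auto intro: sum_nonneg\<close>)
    finally show ?thesis .
  qed
  have \<tau>0: "\<tau> \<ge> 0" by (simp add: \<tau>_def sum_nonneg)
  \<comment> \<open>\<open>\<tau>\<close> bounds the entries of \<open>T\<close>, and the factor
    \<open>n\<close> comes from Cauchy-Schwarz for the double sum; with this \<open>\<rho>\<close>
    the off-diagonal part costs at most \<open>\<beta>\<close>.\<close>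
  define \<rho> where "\<rho> = max 1 (\<tau> * n / \<beta>)"
  have \<rho>1: "\<rho> \<ge> 1" and \<rho>: "\<tau> * n / \<rho> \<le> \<beta>"
  proof -
    show 1: "\<rho> \<ge> 1" by (simp add: \<rho>_def)
    have "\<tau> * n / \<beta> \<le> \<rho>" by (simp add: \<rho>_def)
    then show "\<tau> * n / \<rho> \<le> \<beta>"
      using \<beta>0 1 by (simp add: field_simps)
  qed
  \<comment> \<open>Taking the real part of the Hermitian form makes \<open>S\<close> real and
    symmetric although \<open>q\<close> is complex.\<close>
  define S where "S i j = (\<Sum>a<n. \<rho> ^ (2 * a) * Re (cnj (q a i) * q a j))" for i j
  have S: "(\<Sum>i\<in>I. \<Sum>j\<in>I. S i j * x i * y j) = (\<Sum>a<n. \<rho> ^ (2 * a) * Re (cnj (\<zeta> x a) * \<zeta> y a))" for x y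
  proof -
    have "Re (cnj (\<zeta> x a) * \<zeta> y a) = (\<Sum>i\<in>I. \<Sum>j\<in>I. Re (cnj (q a i) * q a j) * x i * y j)" for a
    proof -
      have "cnj (\<zeta> x a) * \<zeta> y a = (\<Sum>i\<in>I. \<Sum>j\<in>I. complex_of_real (x i * y j) * (cnj (q a i) * q a j))"
        unfolding \<zeta>_def cnj_sum sum_product by (intro sum.cong refl) (simp add: mult_ac)
      then show ?thesis
        by (simp only: Re_sum Re_complex_of_real_mult) (simp add: algebra_simps)
    qed
    then have "(\<Sum>a<n. \<rho> ^ (2 * a) * Re (cnj (\<zeta> x a) * \<zeta> y a))
        = (\<Sum>a<n. \<Sum>i\<in>I. \<Sum>j\<in>I. \<rho> ^ (2 * a) * Re (cnj (q a i) * q a j) * x i * y j)"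
      by (simp add: sum_distrib_left mult.assoc)
    also have "\<dots> = (\<Sum>i\<in>I. \<Sum>j\<in>I. \<Sum>a<n. \<rho> ^ (2 * a) * Re (cnj (q a i) * q a j) * x i * y j)"
      by (subst sum.swap) (rule sum.cong[OF refl], subst sum.swap, rule refl)
    finally show ?thesis by (simp add: S_def sum_distrib_right)
  qed
  define Y where "Y x = (\<Sum>a<n. (\<rho> ^ a * cmod (\<zeta> x a))\<^sup>2)" for x
  have SY: "(\<Sum>i\<in>I. \<Sum>j\<in>I. S i j * x i * x j) = Y x" for x
    unfolding S Y_def Re_cnj_mult by (simp add: power_mult_distrib power_even_eq)
  \<comment> \<open>\<open>1 + \<pi>\<close> in place of \<open>\<pi>\<close> keeps the constant
    \<open>m\<close> positive also for empty \<open>I\<close>.\<close>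
  have x_le_Y: "(\<Sum>i\<in>I. (x i)\<^sup>2) \<le> (1 + \<pi>) * Y x" for x
  proof -
    have "(\<Sum>a<n. (cmod (\<zeta> x a))\<^sup>2) \<le> Y x" unfolding Y_def
    proof (intro sum_mono power_mono)
      show "cmod (\<zeta> x a) \<le> \<rho> ^ a * cmod (\<zeta> x a)" for a
        using mult_right_mono[OF one_le_power[OF \<rho>1, of a], of "cmod (\<zeta> x a)"] by simp
    qed simp
    then have "\<pi> * (\<Sum>a<n. (cmod (\<zeta> x a))\<^sup>2) \<le> (1 + \<pi>) * Y x"
      using \<pi>0 by (intro mult_mono) (auto simp: Y_def intro: sum_nonneg)
    then show ?thesis using x_le[of x] by linarith
  qed
  have SA: "(\<Sum>i\<in>I. \<Sum>j\<in>I. S i j * x i * (\<Sum>z\<in>I. A j z * x z)) \<le> - \<beta> * Y x" for x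
  proof -
    define y where "y a = \<rho> ^ a * cmod (\<zeta> x a)" for a
    have y0: "y a \<ge> 0" for a using \<rho>1 by (simp add: y_def)
    have entry: "\<rho> ^ (2 * a) * Re (cnj (\<zeta> x a) * (T a b * \<zeta> x b))
        \<le> (if a = b then - 2 * \<beta> * (y a)\<^sup>2 else 0) + \<tau> / \<rho> * (y a * y b)"
      if ab: "a < n" "b < n" for a b
    proof -
      consider "b < a" | "a = b" | "a < b" by linarith
      then show ?thesis
      proof cases
        case 1
        then show ?thesis using tri[OF ab(1)] y0 \<tau>0 \<rho>1 by simp
      next
        case 2
        have "Re (cnj (\<zeta> x a) * (T a a * \<zeta> x a)) = Re (T a a) * (cmod (\<zeta> x a))\<^sup>2"
          unfolding cmod_power2 by (simp add: power2_eq_square algebra_simps)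
        then have "\<rho> ^ (2 * a) * Re (cnj (\<zeta> x a) * (T a b * \<zeta> x b)) = Re (T a a) * (y a)\<^sup>2"
          using 2 by (simp add: y_def power_mult_distrib power_even_eq)
        moreover have "\<dots> \<le> - 2 * \<beta> * (y a)\<^sup>2"
          using \<beta>[OF ab(1)] by (intro mult_right_mono) auto
        moreover have "\<tau> / \<rho> * (y a * y b) \<ge> 0" using y0 \<tau>0 \<rho>1 by simp
        ultimately show ?thesis using 2 by simp
      next
        case 3
        \<comment> \<open>Here a < b gives \<open>2 * a \<le> a + b - 1\<close>, which gains the
          factor \<open>1 / \<rho>\<close>.\<close>
        have "\<rho> ^ (2 * a) \<le> \<rho> ^ (a + b - 1)"
          using 3 \<rho>1 by (intro power_increasing) auto
        also have "\<rho> ^ (a + b - 1) = \<rho> ^ a * \<rho> ^ b / \<rho>"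
          using 3 \<rho>1 by (simp add: power_diff power_add)
        finally have pw: "\<rho> ^ (2 * a) \<le> \<rho> ^ a * \<rho> ^ b / \<rho>" .
        have "Re (cnj (\<zeta> x a) * (T a b * \<zeta> x b)) \<le> cmod (cnj (\<zeta> x a) * (T a b * \<zeta> x b))"
          by (rule complex_Re_le_cmod)
        also have "\<dots> \<le> cmod (\<zeta> x a) * (\<tau> * cmod (\<zeta> x b))"
          unfolding norm_mult complex_mod_cnj using \<tau>[OF ab] \<tau>0 by (intro mult_mono) auto
        finally have "\<rho> ^ (2 * a) * Re (cnj (\<zeta> x a) * (T a b * \<zeta> x b))
            \<le> \<rho> ^ (2 * a) * (cmod (\<zeta> x a) * (\<tau> * cmod (\<zeta> x b)))"
          using \<rho>1 by (intro mult_left_mono) auto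
        also have "\<dots> \<le> (\<rho> ^ a * \<rho> ^ b / \<rho>) * (cmod (\<zeta> x a) * (\<tau> * cmod (\<zeta> x b)))"
          using pw \<tau>0 by (intro mult_right_mono) auto
        finally have "\<rho> ^ (2 * a) * Re (cnj (\<zeta> x a) * (T a b * \<zeta> x b))
            \<le> (\<rho> ^ a * \<rho> ^ b / \<rho>) * (cmod (\<zeta> x a) * (\<tau> * cmod (\<zeta> x b)))" .
        then show ?thesis using 3 by (simp add: y_def algebra_simps)
      qed
    qed
    have "(\<Sum>i\<in>I. \<Sum>j\<in>I. S i j * x i * (\<Sum>z\<in>I. A j z * x z))
        = (\<Sum>a<n. \<Sum>b<n. \<rho> ^ (2 * a) * Re (cnj (\<zeta> x a) * (T a b * \<zeta> x b)))"
      unfolding S by (intro sum.cong refl) (simp only: lessThan_iff \<zeta>A sum_distrib_left Re_sum)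
    also have "\<dots> \<le> (\<Sum>a<n. \<Sum>b<n. (if a = b then - 2 * \<beta> * (y a)\<^sup>2 else 0) + \<tau> / \<rho> * (y a * y b))"
      using entry by (intro sum_mono) auto
    also have "\<dots> = - 2 * \<beta> * Y x + \<tau> / \<rho> * (\<Sum>a<n. \<Sum>b<n. y a * y b)"
      by (simp add: sum.distrib sum_distrib_left sum_subtractf sum_negf Y_def y_def)
    also have "\<dots> \<le> - 2 * \<beta> * Y x + \<tau> / \<rho> * (n * Y x)"
      using mult_left_mono[OF sum_mult_sum_le[of y n], of "\<tau> / \<rho>"] \<tau>0 \<rho>1
      by (simp add: Y_def y_def)
    also have "\<dots> \<le> - 2 * \<beta> * Y x + \<beta> * Y x"
      using mult_right_mono[OF \<rho>, of "Y x"] by (simp add: Y_def sum_nonneg)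
    finally show ?thesis by simp
  qed
  define m where "m = 1 / (1 + \<pi>)"
  have m: "m > 0" "m * (\<Sum>i\<in>I. (x i)\<^sup>2) \<le> Y x" for x
    using x_le_Y[of x] \<pi>0 by (auto simp: m_def field_simps)
  show thesis
  proof (rule that[of S "\<beta> * m" m])
    show "S i j = S j i" for i j
      unfolding S_def by (rule sum.cong) (auto simp: algebra_simps)
    show "m * (\<Sum>i\<in>I. (x i)\<^sup>2) \<le> (\<Sum>i\<in>I. \<Sum>j\<in>I. S i j * x i * x j)" for x
      unfolding SY by (rule m)
    show "(\<Sum>i\<in>I. \<Sum>j\<in>I. S i j * x i * (\<Sum>z\<in>I. A j z * x z)) \<le> - (\<beta> * m) * (\<Sum>i\<in>I. (x i)\<^sup>2)" for x
    proof -
      have "\<beta> * (m * (\<Sum>i\<in>I. (x i)\<^sup>2)) \<le> \<beta> * Y x"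
        using m(2)[of x] \<beta>0 by (intro mult_left_mono) auto
      then show ?thesis using SA[of x] by (simp add: mult.assoc)
    qed
  qed (use \<beta>0 m in auto)
qed

section \<open>Differential inequalities\<close>

text \<open>\<open>exp (\<beta> * t) * D t\<close> is nonincreasing. The inequality is asked for
  only inside the interval: solutions on \<open>{0..}\<close> have a one-sided derivative at 0, and
  confinement will be known only strictly before the final time. Neither \<open>D\<close> nor
  \<open>\<beta>\<close> has a sign: \<open>D\<close> will be an energy minus a phase defect, and a
  negative \<open>\<beta>\<close> gives Gronwall's inequality.\<close>

lemma exp_decay:
  fixes D :: "real \<Rightarrow> real"
  assumes ab: "a \<le> b"
    and cont: "continuous_on {a..b} D"
    and deriv: "\<And>t. a < t \<Longrightarrow> t < b \<Longrightarrow> \<exists>D'. (D has_real_derivative D') (at t) \<and> D' \<le> - \<beta> * D t"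
  shows "D b \<le> exp (- \<beta> * (b - a)) * D a"
proof -
  have "exp (\<beta> * b) * D b \<le> exp (\<beta> * a) * D a"
  proof (rule DERIV_nonpos_imp_decreasing_open[OF ab])
    fix t assume t: "a < t" "t < b"
    obtain D' where D': "(D has_real_derivative D') (at t)" "D' \<le> - \<beta> * D t"
      using deriv[OF t] by blast
    have "((\<lambda>t. exp (\<beta> * t) * D t) has_real_derivative exp (\<beta> * t) * (\<beta> * D t + D')) (at t)"
      by (auto intro!: derivative_eq_intros D'(1) simp: algebra_simps)
    moreover have "exp (\<beta> * t) * (\<beta> * D t + D') \<le> 0"
      using D'(2) by (intro mult_nonneg_nonpos) auto
    ultimately show "\<exists>y. ((\<lambda>t. exp (\<beta> * t) * D t) has_real_derivative y) (at t) \<and> y \<le> 0" by blast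
  qed (intro continuous_intros cont)
  then have "exp (- \<beta> * b) * (exp (\<beta> * b) * D b) \<le> exp (- \<beta> * b) * (exp (\<beta> * a) * D a)"
    by (rule mult_left_mono) simp
  moreover have "exp (- \<beta> * b) * exp (\<beta> * b) = 1" by (simp flip: exp_add)
  moreover have "exp (- \<beta> * b) * exp (\<beta> * a) = exp (- \<beta> * (b - a))"
    by (simp flip: exp_add add: algebra_simps)
  ultimately show ?thesis by (simp only: mult.assoc[symmetric] mult_1_left)
qed

lemma sinh_ge_minus_cosh: "- cosh x \<le> sinh (x::real)"
  using exp_gt_zero[of x] cosh_plus_sinh[of x] by linarith

lemma sinh_le_cosh: "sinh x \<le> cosh (x::real)"
  using exp_gt_zero[of "- x"] cosh_minus_sinh[of x] by linarith

text \<open>\<open>C * cosh (\<eta> * t)\<close> is a supersolution, because its derivative is at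
  least \<open>- \<eta>\<close> times itself. Hence the excess of \<open>D\<close> over it,
  multiplied by \<open>exp (\<gamma> * t)\<close>, is nonincreasing. Boundedness of \<open>D\<close>
  makes this product at most 0 in the limit at minus infinity, which replaces an initial
  condition.\<close>

lemma bounded_solution_upper_bound:
  fixes D g :: "real \<Rightarrow> real"
  assumes \<eta>: "0 \<le> \<eta>" "\<eta> < \<gamma>" and A: "0 \<le> A"
    and deriv: "\<And>t. (D has_real_derivative - \<gamma> * D t + g t) (at t)"
    and g: "\<And>t. g t \<le> A * cosh (\<eta> * t)"
    and bdd: "\<And>t. D t \<le> B"
  shows "D t \<le> A / (\<gamma> - \<eta>) * cosh (\<eta> * t)"
proof -
  define C where "C = A / (\<gamma> - \<eta>)"
  have C: "C \<ge> 0" "C * (\<gamma> - \<eta>) = A" using \<eta> A by (auto simp: C_def)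
  define h where "h t = exp (\<gamma> * t) * (D t - C * cosh (\<eta> * t))" for t
  have mono: "h t \<le> h s" if "s \<le> t" for s t
  proof (rule DERIV_nonpos_imp_nonincreasing[OF that], intro exI conjI)
    fix x
    show "(h has_real_derivative exp (\<gamma> * x) * (g x - C * (\<gamma> * cosh (\<eta> * x) + \<eta> * sinh (\<eta> * x)))) (at x)"
      unfolding h_def by (auto intro!: derivative_eq_intros deriv simp: algebra_simps)
    have "\<eta> * - cosh (\<eta> * x) \<le> \<eta> * sinh (\<eta> * x)"
      by (intro mult_left_mono sinh_ge_minus_cosh \<eta>)
    then have "C * ((\<gamma> - \<eta>) * cosh (\<eta> * x)) \<le> C * (\<gamma> * cosh (\<eta> * x) + \<eta> * sinh (\<eta> * x))"
      by (intro mult_left_mono C) (simp add: algebra_simps)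
    then have "g x \<le> C * (\<gamma> * cosh (\<eta> * x) + \<eta> * sinh (\<eta> * x))"
      using g[of x] C(2) by (simp add: mult.assoc[symmetric])
    then show "exp (\<gamma> * x) * (g x - C * (\<gamma> * cosh (\<eta> * x) + \<eta> * sinh (\<eta> * x))) \<le> 0"
      by (intro mult_nonneg_nonpos) auto
  qed
  have "((\<lambda>s. exp (\<gamma> * s) * \<bar>B\<bar>) \<longlongrightarrow> 0) at_bot"
  proof -
    have "filterlim (\<lambda>s. \<gamma> * s) at_bot at_bot"
      using \<eta> by (intro filterlim_tendsto_pos_mult_at_bot[OF tendsto_const]) (auto simp: filterlim_ident)
    then have "((\<lambda>s. exp (\<gamma> * s)) \<longlongrightarrow> 0) at_bot"
      by (rule filterlim_compose[OF exp_at_bot])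
    then show ?thesis by (auto intro: tendsto_mult_left_zero)
  qed
  moreover have "\<forall>\<^sub>F s in at_bot. h t \<le> exp (\<gamma> * s) * \<bar>B\<bar>"
    unfolding eventually_at_bot_linorder
  proof (intro exI[of _ t] allI impI)
    fix s assume "s \<le> t"
    then have "h t \<le> h s" by (rule mono)
    also have "\<dots> \<le> exp (\<gamma> * s) * \<bar>B\<bar>"
      unfolding h_def
    proof (rule mult_left_mono)
      have "0 \<le> C * cosh (\<eta> * s)" using C by (intro mult_nonneg_nonneg) auto
      then show "D s - C * cosh (\<eta> * s) \<le> \<bar>B\<bar>" using bdd[of s] by linarith
    qed simp
    finally show "h t \<le> exp (\<gamma> * s) * \<bar>B\<bar>" .
  qed
  ultimately have "h t \<le> 0"
    by (rule tendsto_lowerbound) simp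
  then show ?thesis
    unfolding h_def C_def by (simp add: mult_le_0_iff)
qed

lemma bounded_solution_bound:
  fixes D g :: "real \<Rightarrow> real"
  assumes \<eta>: "0 \<le> \<eta>" "\<eta> < \<gamma>" and A: "0 \<le> A"
    and deriv: "\<And>t. (D has_real_derivative - \<gamma> * D t + g t) (at t)"
    and g: "\<And>t. \<bar>g t\<bar> \<le> A * cosh (\<eta> * t)"
    and bdd: "\<And>t. \<bar>D t\<bar> \<le> B"
  shows "\<bar>D t\<bar> \<le> A / (\<gamma> - \<eta>) * cosh (\<eta> * t)"
proof -
  have "D t \<le> A / (\<gamma> - \<eta>) * cosh (\<eta> * t)"
    by (rule bounded_solution_upper_bound[OF \<eta> A deriv])
      (use g bdd in \<open>auto simp: abs_le_iff\<close>)
  moreover have "- D t \<le> A / (\<gamma> - \<eta>) * cosh (\<eta> * t)"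
  proof (rule bounded_solution_upper_bound[OF \<eta> A, of "\<lambda>t. - D t" "\<lambda>t. - g t"])
    show "((\<lambda>t. - D t) has_real_derivative - \<gamma> * - D t + - g t) (at t)" for t
      using DERIV_minus[OF deriv[of t]] by simp
  qed (use g bdd in \<open>auto simp: abs_le_iff\<close>)
  ultimately show ?thesis by linarith
qed

lemma bounded_solution_unique:
  fixes K L f :: "real \<Rightarrow> real"
  assumes "\<gamma> > 0"
    and "\<And>t. (K has_real_derivative - \<gamma> * K t + f t) (at t)" "\<And>t. \<bar>K t\<bar> \<le> B"
    and "\<And>t. (L has_real_derivative - \<gamma> * L t + f t) (at t)" "\<And>t. \<bar>L t\<bar> \<le> B'"
  shows "K t = L t"
proof -
  have "\<bar>K t - L t\<bar> \<le> 0 / (\<gamma> - 0) * cosh (0 * t)"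
  proof (rule bounded_solution_bound[where g = "\<lambda>t. 0"])
    show "((\<lambda>t. K t - L t) has_real_derivative - \<gamma> * (K t - L t) + 0) (at t)" for t
      using DERIV_diff[OF assms(2)[of t] assms(4)[of t]] by (simp add: algebra_simps)
    show "\<bar>K t - L t\<bar> \<le> B + B'" for t using assms(3)[of t] assms(5)[of t] by linarith
  qed (use assms(1) in auto)
  then show ?thesis by simp
qed

text \<open>The primitive \<open>sinh (\<eta> * t) / \<eta>\<close> of the weight is again dominated
  by the weight. Integration from 0 in both directions thus costs only the factor
  \<open>1 / \<eta>\<close>, uniformly in time.\<close>

lemma integrated_cosh_bound:
  fixes D g :: "real \<Rightarrow> real"
  assumes \<eta>: "0 < \<eta>" and A: "0 \<le> A"
    and deriv: "\<And>t. (D has_real_derivative g t) (at t)"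
    and g: "\<And>t. \<bar>g t\<bar> \<le> A * cosh (\<eta> * t)"
  shows "\<bar>D t\<bar> \<le> \<bar>D 0\<bar> + A / \<eta> * cosh (\<eta> * t)"
proof -
  have up: "D t - A / \<eta> * sinh (\<eta> * t) \<le> D s - A / \<eta> * sinh (\<eta> * s)"
    and lo: "D s + A / \<eta> * sinh (\<eta> * s) \<le> D t + A / \<eta> * sinh (\<eta> * t)" if "s \<le> t" for s t
  proof -
    have sinh: "((\<lambda>t. A / \<eta> * sinh (\<eta> * t)) has_real_derivative A * cosh (\<eta> * x)) (at x)" for x
      using \<eta> by (auto intro!: derivative_eq_intros)
    show "D t - A / \<eta> * sinh (\<eta> * t) \<le> D s - A / \<eta> * sinh (\<eta> * s)"
      by (rule DERIV_nonpos_imp_nonincreasing[OF that], intro exI conjI, rule DERIV_diff[OF deriv sinh])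
        (use g in \<open>simp add: abs_le_iff\<close>)
    show "D s + A / \<eta> * sinh (\<eta> * s) \<le> D t + A / \<eta> * sinh (\<eta> * t)"
      by (rule DERIV_nonneg_imp_nondecreasing[OF that], intro exI conjI, rule DERIV_add[OF deriv sinh])
        (use g in \<open>smt (verit)\<close>)
  qed
  have "A / \<eta> * sinh (\<eta> * t) \<le> A / \<eta> * cosh (\<eta> * t)" "A / \<eta> * - cosh (\<eta> * t) \<le> A / \<eta> * sinh (\<eta> * t)"
    using \<eta> A by (intro mult_left_mono sinh_le_cosh sinh_ge_minus_cosh; simp)+
  then show ?thesis
    using up[of 0 t] up[of t 0] lo[of 0 t] lo[of t 0] by (cases "t \<ge> 0") auto
qed

lemma antiderivative_exists:
  fixes f :: "real \<Rightarrow> real"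
  assumes "continuous_on UNIV f"
  obtains F where "\<And>t. (F has_real_derivative f t) (at t)" "F 0 = 0"
proof
  fix t
  \<comment> \<open>The fundamental theorem is applied on a window that contains 0 and has
    \<open>t\<close> in its interior.\<close>
  have "((\<lambda>u. LBINT y=ereal 0..u. f y) has_vector_derivative f t) (at t within {-\<bar>t\<bar>-1..\<bar>t\<bar>+1})"
    by (rule interval_integral_FTC2) (auto intro: continuous_on_subset[OF assms])
  moreover have "at t within {-\<bar>t\<bar>-1..\<bar>t\<bar>+1} = at t"
    by (rule at_within_interior) (auto simp: interior_atLeastAtMost_real)
  ultimately show "((\<lambda>u. LBINT y=ereal 0..u. f y) has_real_derivative f t) (at t)"
    by (simp add: has_real_derivative_iff_has_vector_derivative)
qed simp

text \<open>Variation of constants from minus infinity: the solution is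
  \<open>exp (- \<gamma> * t)\<close> times the integral of \<open>exp (\<gamma> * s) * f s\<close>
  over all s below t. The improper integral appears as an antiderivative minus its limit, which
  exists because its increments are dominated by those of \<open>G\<close>, and \<open>G\<close>
  vanishes at minus infinity.\<close>

lemma bounded_solution_exists:
  fixes f :: "real \<Rightarrow> real"
  assumes \<gamma>: "\<gamma> > 0" and cont: "continuous_on UNIV f" and f: "\<And>t. \<bar>f t\<bar> \<le> B"
  obtains K where "\<And>t. (K has_real_derivative - \<gamma> * K t + f t) (at t)" "\<And>t. \<bar>K t\<bar> \<le> B / \<gamma>"
proof -
  obtain F where F: "\<And>t. (F has_real_derivative exp (\<gamma> * t) * f t) (at t)"
    by (rule antiderivative_exists[of "\<lambda>t. exp (\<gamma> * t) * f t"]) (intro continuous_intros cont, blast)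
  define G where "G t = B / \<gamma> * exp (\<gamma> * t)" for t
  have G: "(G has_real_derivative B * exp (\<gamma> * t)) (at t)" for t
    unfolding G_def using \<gamma> by (auto intro!: derivative_eq_intros)
  have F_le: "\<bar>F t - F s\<bar> \<le> G t - G s" if "s \<le> t" for s t
  proof -
    have *: "\<bar>exp (\<gamma> * x) * f x\<bar> \<le> B * exp (\<gamma> * x)" for x
      using mult_left_mono[OF f[of x], of "exp (\<gamma> * x)"] by (simp add: abs_mult mult.commute)
    have "F t - G t \<le> F s - G s"
      by (rule DERIV_nonpos_imp_nonincreasing[OF that], intro exI conjI, rule DERIV_diff[OF F G])
        (use * in \<open>simp add: abs_le_iff\<close>)
    moreover have "F s + G s \<le> F t + G t"
      by (rule DERIV_nonneg_imp_nondecreasing[OF that], intro exI conjI, rule DERIV_add[OF F G])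
        (use * in \<open>smt (verit)\<close>)
    ultimately show ?thesis by linarith
  qed
  have B: "B \<ge> 0" using f[of 0] by linarith
  have G0: "G t \<ge> 0" for t using B \<gamma> by (simp add: G_def)
  have bdd: "bdd_below (range (\<lambda>t. F t + G t))"
  proof (rule bdd_belowI)
    fix x assume "x \<in> range (\<lambda>t. F t + G t)"
    then obtain t where x: "x = F t + G t" by blast
    show "F 0 - G 0 \<le> x"
      using F_le[of 0 t] F_le[of t 0] G0[of t] G0[of 0] unfolding x by (cases "0 \<le> t") linarith+
  qed
  \<comment> \<open>\<open>F + G\<close> is increasing and \<open>F - G\<close> decreasing, so \<open>l\<close> is the limit of \<open>F\<close> at \<open>-\<infinity>\<close>.\<close>
  define l where "l = (INF t. F t + G t)"
  have l1: "l \<le> F t + G t" for t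
    unfolding l_def by (rule cINF_lower[OF bdd]) simp
  have l2: "F t - G t \<le> l" for t
    unfolding l_def
  proof (rule cINF_greatest)
    fix s show "F t - G t \<le> F s + G s"
      using F_le[of s t] F_le[of t s] G0[of t] G0[of s] by (cases "s \<le> t") linarith+
  qed simp
  show thesis
  proof
    fix t
    show "((\<lambda>t. exp (- \<gamma> * t) * (F t - l)) has_real_derivative
        - \<gamma> * (exp (- \<gamma> * t) * (F t - l)) + f t) (at t)"
      by (auto intro!: derivative_eq_intros F simp: algebra_simps mult_exp_exp)
    have "\<bar>F t - l\<bar> \<le> G t" using l1[of t] l2[of t] by linarith
    then have "exp (- \<gamma> * t) * \<bar>F t - l\<bar> \<le> exp (- \<gamma> * t) * G t"
      by (rule mult_left_mono) simp
    also have "\<dots> = B / \<gamma>" by (simp add: G_def mult_exp_exp)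
    finally show "\<bar>exp (- \<gamma> * t) * (F t - l)\<bar> \<le> B / \<gamma>" by (simp add: abs_mult)
  qed
qed

section \<open>The reduced system and its bounded orbits\<close>

lemma sin_lipschitz: "\<bar>sin x - sin y\<bar> \<le> \<bar>x - y\<bar>" for x y :: real
proof -
  have "\<bar>sin x - sin y\<bar> = 2 * \<bar>sin ((x - y) / 2)\<bar> * \<bar>cos ((x + y) / 2)\<bar>"
    by (simp add: sin_diff_sin abs_mult)
  also have "\<dots> \<le> 2 * \<bar>(x - y) / 2\<bar> * 1"
    by (intro mult_mono mult_left_mono abs_sin_x_le_abs_x) auto
  finally show ?thesis by simp
qed

text \<open>One coupling per ordered pair of clusters, one phase per cluster. The last assumption
  makes the Picard operator a contraction; the cardinality occurs in it because norms of vectors are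
  estimated by sums over coordinates.\<close>

locale reduced_system =
  fixes \<omega> :: "'m::finite \<Rightarrow> real" and c :: "'m \<Rightarrow> 'm \<Rightarrow> real"
    and \<gamma> \<delta> \<nu> :: real and \<Gamma> :: "real \<Rightarrow> real"
  assumes c_nonneg: "0 \<le> c s r"
    and \<gamma>_pos: "\<gamma> > 0" and \<delta>_nonneg: "\<delta> \<ge> 0" and \<nu>_pos: "\<nu> > 0"
    and \<Gamma>_bound: "\<bar>\<Gamma> x\<bar> \<le> \<delta>" and \<Gamma>_lipschitz: "\<bar>\<Gamma> x - \<Gamma> y\<bar> \<le> \<delta> * \<bar>x - y\<bar>"
    and \<Gamma>_periodic: "\<Gamma> (x + 2 * pi) = \<Gamma> x"
    and \<nu>_small: "CARD('m) * (12 * (\<Sum>s\<in>UNIV. \<Sum>r\<in>UNIV. c s r) * \<delta> * \<nu> / \<gamma>\<^sup>2) \<le> 1 / 2"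
begin

text \<open>The exponent \<open>\<gamma> / 2\<close> is positive, so integration costs only
  \<open>2 / \<gamma>\<close>, and smaller than the relaxation rate, so a weighted phase difference
  causes a coupling difference with the same weight.\<close>

abbreviation weight :: "real \<Rightarrow> real" where
  "weight t \<equiv> cosh (\<gamma> / 2 * t)"

definition total_weight :: real where
  "total_weight = (\<Sum>s\<in>UNIV. \<Sum>r\<in>UNIV. c s r)"

definition rate :: "real^'m \<Rightarrow> ('m \<Rightarrow> 'm \<Rightarrow> real) \<Rightarrow> 'm \<Rightarrow> real" where
  "rate x \<kappa> s = \<omega> s + (\<Sum>r\<in>UNIV - {s}. c s r * \<kappa> s r * sin (x $ r - x $ s))"

text \<open>Boundedness on the whole line stands in for an initial value: it selects exactly one
  coupling curve for each continuous phase curve, a functional of the past of the phases.\<close>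

definition driven :: "(real \<Rightarrow> real^'m) \<Rightarrow> (real \<Rightarrow> 'm \<Rightarrow> 'm \<Rightarrow> real) \<Rightarrow> bool" where
  "driven \<phi> \<kappa> \<longleftrightarrow>
     (\<forall>t s r. ((\<lambda>\<tau>. \<kappa> \<tau> s r) has_real_derivative
        - \<gamma> * \<kappa> t s r + \<nu> * \<Gamma> (\<phi> t $ r - \<phi> t $ s)) (at t)) \<and>
     (\<exists>B. \<forall>t s r. \<bar>\<kappa> t s r\<bar> \<le> B)"

definition full_orbit :: "(real \<Rightarrow> real^'m) \<Rightarrow> (real \<Rightarrow> 'm \<Rightarrow> 'm \<Rightarrow> real) \<Rightarrow> bool" where
  "full_orbit \<phi> \<kappa> \<longleftrightarrow> driven \<phi> \<kappa> \<and>
     (\<forall>t s. ((\<lambda>\<tau>. \<phi> \<tau> $ s) has_real_derivative rate (\<phi> t) (\<kappa> t) s) (at t))"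

lemma total_weight_nonneg: "0 \<le> total_weight"
  unfolding total_weight_def by (intro sum_nonneg c_nonneg)

lemma weight_le: "(\<Sum>r\<in>UNIV - {s}. c s r) \<le> total_weight"
proof -
  have "(\<Sum>r\<in>UNIV - {s}. c s r) \<le> (\<Sum>r\<in>UNIV. c s r)"
    by (rule sum_mono2) (auto simp: c_nonneg)
  also have "\<dots> \<le> total_weight"
    unfolding total_weight_def by (rule member_le_sum[of s]) (auto intro: sum_nonneg c_nonneg)
  finally show ?thesis .
qed

lemma \<Gamma>_continuous: "continuous_on UNIV \<Gamma>"
  by (rule lipschitz_on_continuous_on[of \<delta>])
    (auto simp: lipschitz_on_def dist_real_def \<Gamma>_lipschitz \<delta>_nonneg)

lemma driven_exists:
  assumes "continuous_on UNIV \<phi>"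
  shows "\<exists>\<kappa>. driven \<phi> \<kappa>"
proof -
  define Q where "Q s r K \<longleftrightarrow>
      (\<forall>t. (K has_real_derivative - \<gamma> * K t + \<nu> * \<Gamma> (\<phi> t $ r - \<phi> t $ s)) (at t)) \<and>
      (\<forall>t. \<bar>K t\<bar> \<le> \<nu> * \<delta> / \<gamma>)" for s r K
  have "\<exists>K. Q s r K" for s r
  proof -
    have "continuous_on UNIV (\<lambda>t. \<Gamma> (\<phi> t $ r - \<phi> t $ s))"
      by (intro continuous_on_compose2[OF \<Gamma>_continuous] continuous_intros assms) auto
    then have cont: "continuous_on UNIV (\<lambda>t. \<nu> * \<Gamma> (\<phi> t $ r - \<phi> t $ s))"
      by (intro continuous_intros)
    have bound: "\<bar>\<nu> * \<Gamma> (\<phi> t $ r - \<phi> t $ s)\<bar> \<le> \<nu> * \<delta>" for t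
      using \<nu>_pos by (auto simp: abs_mult \<Gamma>_bound)
    show ?thesis
    proof (rule bounded_solution_exists[OF \<gamma>_pos cont bound])
      fix K
      assume "\<And>t. (K has_real_derivative - \<gamma> * K t + \<nu> * \<Gamma> (\<phi> t $ r - \<phi> t $ s)) (at t)"
        and "\<And>t. \<bar>K t\<bar> \<le> \<nu> * \<delta> / \<gamma>"
      then show ?thesis unfolding Q_def by (intro exI[of _ K]) simp
    qed
  qed
  then obtain K where "\<And>s r. Q s r (K s r)" by metis
  then show ?thesis
    unfolding driven_def Q_def
    by (intro exI[of _ "\<lambda>t s r. K s r t"] conjI[OF _ exI[of _ "\<nu> * \<delta> / \<gamma>"]]) auto
qed

lemma driven_bound:
  assumes "driven \<phi> \<kappa>"
  shows "\<bar>\<kappa> t s r\<bar> \<le> \<nu> * \<delta> / \<gamma>"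
proof -
  obtain B where B: "\<And>t. \<bar>\<kappa> t s r\<bar> \<le> B" using assms unfolding driven_def by blast
  have "\<bar>\<kappa> t s r\<bar> \<le> \<nu> * \<delta> / (\<gamma> - 0) * cosh (0 * t)"
    by (rule bounded_solution_bound[where g = "\<lambda>t. \<nu> * \<Gamma> (\<phi> t $ r - \<phi> t $ s)" and B = B])
      (use assms \<gamma>_pos \<delta>_nonneg \<nu>_pos B in \<open>auto simp: driven_def abs_mult \<Gamma>_bound\<close>)
  then show ?thesis by simp
qed

lemma driven_continuous:
  assumes "driven \<phi> \<kappa>"
  shows "continuous_on UNIV (\<lambda>t. \<kappa> t s r)"
  using assms unfolding driven_def by (intro DERIV_continuous_on) auto

text \<open>The difference is a bounded solution whose forcing is at most
  \<open>2 * \<nu> * \<delta> * A\<close> times the weight, the 2 coming from the two phases in the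
  argument of \<Gamma>. Division by \<open>\<gamma> - \<gamma> / 2\<close> doubles the
  constant.\<close>

lemma driven_difference:
  assumes "driven \<phi> \<kappa>" "driven \<psi> \<kappa>'" and A: "A \<ge> 0"
    and diff: "\<And>t s. \<bar>\<phi> t $ s - \<psi> t $ s\<bar> \<le> A * weight t"
  shows "\<bar>\<kappa> t s r - \<kappa>' t s r\<bar> \<le> 4 * \<nu> * \<delta> / \<gamma> * A * weight t"
proof -
  define g where "g t = \<nu> * (\<Gamma> (\<phi> t $ r - \<phi> t $ s) - \<Gamma> (\<psi> t $ r - \<psi> t $ s))" for t
  have "\<bar>\<kappa> t s r - \<kappa>' t s r\<bar> \<le> (2 * \<nu> * \<delta> * A) / (\<gamma> - \<gamma> / 2) * weight t"
  proof (rule bounded_solution_bound[where g = g])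
    show "((\<lambda>t. \<kappa> t s r - \<kappa>' t s r) has_real_derivative - \<gamma> * (\<kappa> t s r - \<kappa>' t s r) + g t) (at t)" for t
    proof -
      have "((\<lambda>t. \<kappa> t s r - \<kappa>' t s r) has_real_derivative
          (- \<gamma> * \<kappa> t s r + \<nu> * \<Gamma> (\<phi> t $ r - \<phi> t $ s))
          - (- \<gamma> * \<kappa>' t s r + \<nu> * \<Gamma> (\<psi> t $ r - \<psi> t $ s))) (at t)"
        using assms(1,2) unfolding driven_def by (intro DERIV_diff) auto
      then show ?thesis by (simp add: g_def algebra_simps)
    qed
    show "\<bar>g t\<bar> \<le> 2 * \<nu> * \<delta> * A * weight t" for t
    proof -
      have "\<bar>\<Gamma> (\<phi> t $ r - \<phi> t $ s) - \<Gamma> (\<psi> t $ r - \<psi> t $ s)\<bar>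
          \<le> \<delta> * \<bar>(\<phi> t $ r - \<phi> t $ s) - (\<psi> t $ r - \<psi> t $ s)\<bar>"
        by (rule \<Gamma>_lipschitz)
      also have "\<dots> \<le> \<delta> * (2 * (A * weight t))"
        using diff[of t r] diff[of t s] by (intro mult_left_mono \<delta>_nonneg) linarith
      finally show ?thesis
        using \<nu>_pos mult_left_mono[of _ _ \<nu>] by (fastforce simp: g_def abs_mult mult_ac)
    qed
    show "\<bar>\<kappa> t s r - \<kappa>' t s r\<bar> \<le> \<nu> * \<delta> / \<gamma> + \<nu> * \<delta> / \<gamma>" for t
      by (rule order_trans[OF abs_triangle_ineq4]) (intro add_mono driven_bound[OF assms(1)] driven_bound[OF assms(2)])
  qed (use \<gamma>_pos \<nu>_pos \<delta>_nonneg A in auto)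
  then show ?thesis by (simp add: field_simps)
qed

text \<open>In the difference of the products, the couplings contribute 4, and the sines, multiplied
  by the bound \<open>\<nu> * \<delta> / \<gamma>\<close> of the couplings, contribute 2.\<close>

lemma rate_difference:
  assumes "driven \<phi> \<kappa>" "driven \<psi> \<kappa>'" and A: "A \<ge> 0"
    and diff: "\<And>t s. \<bar>\<phi> t $ s - \<psi> t $ s\<bar> \<le> A * weight t"
  shows "\<bar>rate (\<phi> t) (\<kappa> t) s - rate (\<psi> t) (\<kappa>' t) s\<bar>
    \<le> 6 * total_weight * \<delta> * \<nu> / \<gamma> * A * weight t"
proof -
  define h where "h = weight t"
  have h: "h \<ge> 0" by (simp add: h_def)
  have "\<bar>c s r * \<kappa> t s r * sin (\<phi> t $ r - \<phi> t $ s) - c s r * \<kappa>' t s r * sin (\<psi> t $ r - \<psi> t $ s)\<bar>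
      \<le> c s r * (6 * \<delta> * \<nu> / \<gamma> * A * h)" for r
  proof -
    let ?x = "\<phi> t $ r - \<phi> t $ s" and ?y = "\<psi> t $ r - \<psi> t $ s"
    have "\<bar>\<kappa> t s r * sin ?x - \<kappa>' t s r * sin ?y\<bar>
        = \<bar>(\<kappa> t s r - \<kappa>' t s r) * sin ?x + \<kappa>' t s r * (sin ?x - sin ?y)\<bar>"
      by (simp add: algebra_simps)
    also have "\<dots> \<le> \<bar>\<kappa> t s r - \<kappa>' t s r\<bar> * \<bar>sin ?x\<bar> + \<bar>\<kappa>' t s r\<bar> * \<bar>sin ?x - sin ?y\<bar>"
      using abs_triangle_ineq by (simp add: abs_mult[symmetric])
    also have "\<dots> \<le> (4 * \<nu> * \<delta> / \<gamma> * A * h) * 1 + (\<nu> * \<delta> / \<gamma>) * (2 * (A * h))"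
    proof (intro add_mono mult_mono)
      show "\<bar>\<kappa> t s r - \<kappa>' t s r\<bar> \<le> 4 * \<nu> * \<delta> / \<gamma> * A * h"
        unfolding h_def by (rule driven_difference[OF assms])
      show "\<bar>\<kappa>' t s r\<bar> \<le> \<nu> * \<delta> / \<gamma>" by (rule driven_bound[OF assms(2)])
      have "\<bar>sin ?x - sin ?y\<bar> \<le> \<bar>?x - ?y\<bar>" by (rule sin_lipschitz)
      also have "\<dots> \<le> 2 * (A * h)" using diff[of t r] diff[of t s] by (simp add: h_def)
      finally show "\<bar>sin ?x - sin ?y\<bar> \<le> 2 * (A * h)" .
    qed (use \<gamma>_pos \<nu>_pos \<delta>_nonneg A h in auto)
    also have "\<dots> = 6 * \<delta> * \<nu> / \<gamma> * A * h" by (simp add: field_simps)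
    finally have "\<bar>c s r\<bar> * \<bar>\<kappa> t s r * sin ?x - \<kappa>' t s r * sin ?y\<bar> \<le> c s r * (6 * \<delta> * \<nu> / \<gamma> * A * h)"
      using c_nonneg by (intro mult_mono) auto
    then show ?thesis by (simp add: abs_mult[symmetric] algebra_simps)
  qed
  then have "\<bar>rate (\<phi> t) (\<kappa> t) s - rate (\<psi> t) (\<kappa>' t) s\<bar>
      \<le> (\<Sum>r\<in>UNIV - {s}. c s r * (6 * \<delta> * \<nu> / \<gamma> * A * h))"
    unfolding rate_def add_diff_cancel_left sum_subtractf[symmetric]
    by (intro order_trans[OF sum_abs] sum_mono) auto
  also have "\<dots> = (\<Sum>r\<in>UNIV - {s}. c s r) * (6 * \<delta> * \<nu> / \<gamma> * A * h)"
    by (simp only: sum_distrib_right)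
  also have "\<dots> \<le> total_weight * (6 * \<delta> * \<nu> / \<gamma> * A * h)"
    using \<gamma>_pos \<nu>_pos \<delta>_nonneg A h by (intro mult_right_mono weight_le) auto
  finally show ?thesis by (simp add: h_def mult_ac)
qed

text \<open>The constant of \<open>rate_difference\<close> divided by \<open>\<gamma> / 2\<close>,
  the cost of integrating the weight.\<close>

definition contraction_factor :: real where
  "contraction_factor = 12 * total_weight * \<delta> * \<nu> / \<gamma>\<^sup>2"

lemma contraction_factor: "0 \<le> contraction_factor" "CARD('m) * contraction_factor \<le> 1 / 2"
    "contraction_factor \<le> 1 / 2"
proof -
  show 0: "0 \<le> contraction_factor"
    unfolding contraction_factor_def using total_weight_nonneg \<delta>_nonneg \<nu>_pos by simp
  show 1: "CARD('m) * contraction_factor \<le> 1 / 2"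
    using \<nu>_small by (simp add: contraction_factor_def total_weight_def)
  have "1 * contraction_factor \<le> CARD('m) * contraction_factor"
    using 0 by (intro mult_right_mono) (auto simp: Suc_leI)
  then show "contraction_factor \<le> 1 / 2" using 1 by linarith
qed

lemma picard_difference:
  assumes "driven \<phi> \<kappa>" "driven \<psi> \<kappa>'" and A: "A \<ge> 0"
    and diff: "\<And>t s. \<bar>\<phi> t $ s - \<psi> t $ s\<bar> \<le> A * weight t"
    and \<Phi>: "\<And>t s. ((\<lambda>\<tau>. \<Phi> \<tau> $ s) has_real_derivative rate (\<phi> t) (\<kappa> t) s) (at t)"
    and \<Psi>: "\<And>t s. ((\<lambda>\<tau>. \<Psi> \<tau> $ s) has_real_derivative rate (\<psi> t) (\<kappa>' t) s) (at t)"
  shows "\<bar>\<Phi> t $ s - \<Psi> t $ s\<bar> \<le> \<bar>\<Phi> 0 $ s - \<Psi> 0 $ s\<bar> + contraction_factor * A * weight t"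
proof -
  have "\<bar>\<Phi> t $ s - \<Psi> t $ s\<bar>
      \<le> \<bar>\<Phi> 0 $ s - \<Psi> 0 $ s\<bar> + (6 * total_weight * \<delta> * \<nu> / \<gamma> * A) / (\<gamma> / 2) * weight t"
  proof (rule integrated_cosh_bound[where g = "\<lambda>t. rate (\<phi> t) (\<kappa> t) s - rate (\<psi> t) (\<kappa>' t) s"])
    show "\<bar>rate (\<phi> t) (\<kappa> t) s - rate (\<psi> t) (\<kappa>' t) s\<bar>
        \<le> 6 * total_weight * \<delta> * \<nu> / \<gamma> * A * weight t" for t
      by (rule rate_difference[OF assms(1-4)])
  qed (use \<gamma>_pos \<nu>_pos \<delta>_nonneg A total_weight_nonneg \<Phi> \<Psi> in \<open>auto intro: DERIV_diff\<close>)
  also have "(6 * total_weight * \<delta> * \<nu> / \<gamma> * A) / (\<gamma> / 2) = contraction_factor * A"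
    by (simp add: contraction_factor_def power2_eq_square)
  finally show ?thesis .
qed

section \<open>Comparison of two orbits on the whole line\<close>

definition max_rate :: real where
  "max_rate = (\<Sum>s\<in>UNIV. \<bar>\<omega> s\<bar>) + total_weight * (\<nu> * \<delta> / \<gamma>)"

lemma max_rate_nonneg: "0 \<le> max_rate"
  unfolding max_rate_def using total_weight_nonneg \<delta>_nonneg \<nu>_pos \<gamma>_pos
  by (intro add_nonneg_nonneg sum_nonneg) auto

lemma rate_bound:
  assumes "driven \<phi> \<kappa>"
  shows "\<bar>rate x (\<kappa> t) s\<bar> \<le> max_rate"
proof -
  have "\<bar>c s r * \<kappa> t s r * sin (x $ r - x $ s)\<bar> \<le> c s r * (\<nu> * \<delta> / \<gamma>)" for r
  proof -
    have "\<bar>\<kappa> t s r\<bar> * \<bar>sin (x $ r - x $ s)\<bar> \<le> (\<nu> * \<delta> / \<gamma>) * 1"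
      using driven_bound[OF assms, of t s r] \<gamma>_pos \<nu>_pos \<delta>_nonneg by (intro mult_mono) auto
    then show ?thesis
      using mult_left_mono[OF _ c_nonneg[of s r]] c_nonneg[of s r] by (fastforce simp: abs_mult mult_ac)
  qed
  then have "\<bar>\<Sum>r\<in>UNIV - {s}. c s r * \<kappa> t s r * sin (x $ r - x $ s)\<bar>
      \<le> (\<Sum>r\<in>UNIV - {s}. c s r * (\<nu> * \<delta> / \<gamma>))"
    by (intro order_trans[OF sum_abs] sum_mono) auto
  also have "\<dots> = (\<Sum>r\<in>UNIV - {s}. c s r) * (\<nu> * \<delta> / \<gamma>)" by (simp only: sum_distrib_right)
  also have "\<dots> \<le> total_weight * (\<nu> * \<delta> / \<gamma>)"
    using \<gamma>_pos \<nu>_pos \<delta>_nonneg by (intro mult_right_mono weight_le) auto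
  finally have 1: "\<bar>\<Sum>r\<in>UNIV - {s}. c s r * \<kappa> t s r * sin (x $ r - x $ s)\<bar>
      \<le> total_weight * (\<nu> * \<delta> / \<gamma>)" .
  have "\<bar>\<omega> s\<bar> \<le> (\<Sum>s\<in>UNIV. \<bar>\<omega> s\<bar>)" by (rule member_le_sum) auto
  with 1 show ?thesis unfolding rate_def max_rate_def by linarith
qed

text \<open>Bounded rates give a first crude estimate by a multiple of the weight. One pass through
  the integral equation turns the coefficient \<open>2 * a + B / 2 ^ n\<close> into at most
  \<open>a + (2 * a + B / 2 ^ n) / 2\<close>, the same expression for the next \<open>n\<close>, and
  in the limit \<open>2 * a\<close> remains.\<close>

lemma full_orbit_difference:
  assumes \<phi>: "full_orbit \<phi> \<kappa>" and \<psi>: "full_orbit \<psi> \<kappa>'"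
    and a: "\<And>s. \<bar>\<phi> 0 $ s - \<psi> 0 $ s\<bar> \<le> a"
  shows "\<bar>\<phi> t $ s - \<psi> t $ s\<bar> \<le> 2 * a * weight t"
proof -
  have d: "driven \<phi> \<kappa>" "driven \<psi> \<kappa>'"
    and \<phi>': "\<And>t s. ((\<lambda>\<tau>. \<phi> \<tau> $ s) has_real_derivative rate (\<phi> t) (\<kappa> t) s) (at t)"
    and \<psi>': "\<And>t s. ((\<lambda>\<tau>. \<psi> \<tau> $ s) has_real_derivative rate (\<psi> t) (\<kappa>' t) s) (at t)"
    using \<phi> \<psi> by (auto simp: full_orbit_def)
  have a0: "a \<ge> 0" using a[of undefined] by linarith
  have cosh1: "a \<le> a * weight t" for t
    using mult_left_mono[OF cosh_real_ge_1 a0] by simp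
  define B where "B = 2 * max_rate / (\<gamma> / 2)"
  have B: "B \<ge> 0" using max_rate_nonneg \<gamma>_pos by (simp add: B_def)
  have iter: "\<bar>\<phi> t $ s - \<psi> t $ s\<bar> \<le> (2 * a + B / 2 ^ n) * weight t" for n t s
  proof (induction n arbitrary: t s)
    case 0
    have "\<bar>\<phi> t $ s - \<psi> t $ s\<bar> \<le> \<bar>\<phi> 0 $ s - \<psi> 0 $ s\<bar> + B * weight t"
      unfolding B_def
    proof (rule integrated_cosh_bound[where g = "\<lambda>t. rate (\<phi> t) (\<kappa> t) s - rate (\<psi> t) (\<kappa>' t) s"])
      fix t
      have "\<bar>rate (\<phi> t) (\<kappa> t) s - rate (\<psi> t) (\<kappa>' t) s\<bar> \<le> 2 * max_rate"
        using rate_bound[OF d(1), of "\<phi> t" t s] rate_bound[OF d(2), of "\<psi> t" t s] by linarith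
      also have "\<dots> \<le> 2 * max_rate * weight t"
        using mult_left_mono[OF cosh_real_ge_1, of "2 * max_rate"] max_rate_nonneg by simp
      finally show "\<bar>rate (\<phi> t) (\<kappa> t) s - rate (\<psi> t) (\<kappa>' t) s\<bar> \<le> 2 * max_rate * weight t" .
    qed (use \<gamma>_pos max_rate_nonneg \<phi>' \<psi>' in \<open>auto intro: DERIV_diff\<close>)
    then show ?case
      using a[of s] cosh1[of t] a0 by (simp add: algebra_simps)
  next
    case (Suc n)
    define A where "A = 2 * a + B / 2 ^ n"
    have A: "A \<ge> 0" using a0 B by (simp add: A_def)
    have "\<bar>\<phi> t $ s - \<psi> t $ s\<bar> \<le> \<bar>\<phi> 0 $ s - \<psi> 0 $ s\<bar> + contraction_factor * A * weight t"
      by (rule picard_difference[OF d A _ \<phi>' \<psi>']) (use Suc in \<open>simp add: A_def\<close>)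
    also have "\<dots> \<le> a * weight t + 1 / 2 * A * weight t"
      using contraction_factor A a[of s] cosh1[of t]
      by (intro add_mono mult_right_mono) auto
    also have "\<dots> = (2 * a + B / 2 ^ Suc n) * weight t"
      by (simp add: A_def algebra_simps)
    finally show ?case .
  qed
  have "(\<lambda>n. (2 * a + B / 2 ^ n) * weight t) \<longlonglongrightarrow> (2 * a + 0) * weight t"
    by (intro tendsto_intros LIMSEQ_divide_realpow_zero) auto
  then show ?thesis
    using LIMSEQ_le_const[of _ _ "\<bar>\<phi> t $ s - \<psi> t $ s\<bar>"] iter by fastforce
qed

text \<open>At time 0 the weight is 1. The 8 is the 4 of the coupling estimate times the 2 of the
  phase estimate; it becomes the Lipschitz constant of the slaved couplings.\<close>

lemma full_orbit_coupling_difference: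
  assumes "full_orbit \<phi> \<kappa>" "full_orbit \<psi> \<kappa>'" and a: "\<And>s. \<bar>\<phi> 0 $ s - \<psi> 0 $ s\<bar> \<le> a"
  shows "\<bar>\<kappa> 0 s r - \<kappa>' 0 s r\<bar> \<le> 8 * \<nu> * \<delta> / \<gamma> * a"
proof -
  have "a \<ge> 0" using a[of undefined] by linarith
  then have "\<bar>\<kappa> 0 s r - \<kappa>' 0 s r\<bar> \<le> 4 * \<nu> * \<delta> / \<gamma> * (2 * a) * cosh (\<gamma> / 2 * 0)"
    by (intro driven_difference[of \<phi> _ \<psi>] full_orbit_difference[OF assms])
      (use assms in \<open>auto simp: full_orbit_def\<close>)
  then show ?thesis by simp
qed

lemma full_orbit_unique:
  assumes "full_orbit \<phi> \<kappa>" "full_orbit \<psi> \<kappa>'" "\<phi> 0 = \<psi> 0"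
  shows "\<phi> = \<psi>" "\<kappa> = \<kappa>'"
proof -
  have 0: "\<bar>\<phi> t $ s - \<psi> t $ s\<bar> \<le> 2 * 0 * weight t" for t s
    by (rule full_orbit_difference[OF assms(1,2)]) (simp add: assms(3))
  then show "\<phi> = \<psi>" by (intro ext) (simp add: vec_eq_iff)
  have "\<bar>\<kappa> t s r - \<kappa>' t s r\<bar> \<le> 4 * \<nu> * \<delta> / \<gamma> * 0 * weight t" for t s r
    by (rule driven_difference[of \<phi> _ \<psi>]) (use assms 0 in \<open>auto simp: full_orbit_def\<close>)
  then show "\<kappa> = \<kappa>'" by (intro ext) simp
qed

lemma full_orbit_shift:
  assumes "full_orbit \<phi> \<kappa>"
  shows "full_orbit (\<lambda>t. \<phi> (t + T)) (\<lambda>t. \<kappa> (t + T))"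
  using assms
  unfolding full_orbit_def driven_def
  by (auto simp: DERIV_shift[symmetric, of "\<lambda>\<tau>. \<phi> \<tau> $ s" for s]
      DERIV_shift[symmetric, of "\<lambda>\<tau>. \<kappa> \<tau> s r" for s r]) blast

text \<open>The orbit through \<open>x\<close> is a fixed point of the Picard operator on the curves
  \<open>t \<mapsto> x + cosh (\<gamma> t / 2) g t\<close> with \<open>g\<close> bounded. The weight absorbs the loss in the integration
  over \<open>\<real>\<close>, and grows more slowly than the couplings relax.\<close>

lemma picard_step_exists:
  assumes "continuous_on UNIV \<phi>"
  shows "\<exists>\<kappa> \<psi>. driven \<phi> \<kappa> \<and>
    (\<forall>t s. ((\<lambda>\<tau>. \<psi> \<tau> $ s) has_real_derivative rate (\<phi> t) (\<kappa> t) s) (at t)) \<and> \<psi> 0 = x"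
proof -
  obtain \<kappa> where \<kappa>: "driven \<phi> \<kappa>" using driven_exists[OF assms] ..
  have "\<exists>F. (\<forall>t. (F has_real_derivative rate (\<phi> t) (\<kappa> t) s) (at t)) \<and> F 0 = 0" for s
  proof -
    have "continuous_on UNIV (\<lambda>t. rate (\<phi> t) (\<kappa> t) s)"
      unfolding rate_def by (intro continuous_intros driven_continuous[OF \<kappa>] assms)
    then show ?thesis by (rule antiderivative_exists) blast
  qed
  then obtain F where F: "\<And>s t. (F s has_real_derivative rate (\<phi> t) (\<kappa> t) s) (at t)" "\<And>s. F s 0 = 0"
    by metis
  have "((\<lambda>\<tau>. (\<chi> s. x $ s + F s \<tau>) $ s) has_real_derivative rate (\<phi> t) (\<kappa> t) s) (at t)" for t s
    using DERIV_add[OF DERIV_const[of "x $ s"] F(1)[of s t]] by simp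
  with \<kappa> show ?thesis
    by (intro exI[of _ \<kappa>] exI[of _ "\<lambda>\<tau>. \<chi> s. x $ s + F s \<tau>"]) (auto simp: F(2) vec_eq_iff)
qed

lemma full_orbit_exists: "\<exists>\<phi> \<kappa>. full_orbit \<phi> \<kappa> \<and> \<phi> 0 = x"
proof -
  define curve where "curve g t = x + weight t *\<^sub>R apply_bcontfun g t" for g t
  have curve: "continuous_on UNIV (curve g)" for g
    unfolding curve_def by (intro continuous_intros continuous_on_apply_bcontfun)
  obtain K \<Psi> where K: "\<And>g. driven (curve g) (K g)"
    and \<Psi>: "\<And>g t s. ((\<lambda>\<tau>. \<Psi> g \<tau> $ s) has_real_derivative rate (curve g t) (K g t) s) (at t)"
    and \<Psi>0: "\<And>g. \<Psi> g 0 = x"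
    using picard_step_exists[OF curve, of _ x] by metis
  \<comment> \<open>\<open>G g\<close> is the parameter of the integrated curve; at a fixed point a
    curve equals its own integral.\<close>
  define G where "G g t = (1 / weight t) *\<^sub>R (\<Psi> g t - x)" for g t
  have cosh0: "weight t > 0" for t by simp
  have "G g \<in> bcontfun" for g
  proof (rule bcontfun_normI)
    have "continuous_on UNIV (\<lambda>t. \<Psi> g t $ s)" for s
      using \<Psi> by (intro DERIV_continuous_on) auto
    then have "continuous_on UNIV (\<lambda>t. \<chi> s. \<Psi> g t $ s)"
      by (rule continuous_on_vec_lambda)
    then have "continuous_on UNIV (\<Psi> g)" by simp
    then show "continuous_on UNIV (G g)"
      unfolding G_def using cosh0 by (intro continuous_intros) (metis less_irrefl)
    fix t
    have "\<bar>(\<Psi> g t - x) $ s\<bar> \<le> \<bar>(\<Psi> g 0 - x) $ s\<bar> + max_rate / (\<gamma> / 2) * weight t" for s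
    proof (rule integrated_cosh_bound[where g = "\<lambda>t. rate (curve g t) (K g t) s"])
      fix t
      show "((\<lambda>t. (\<Psi> g t - x) $ s) has_real_derivative rate (curve g t) (K g t) s) (at t)"
        using DERIV_diff[OF \<Psi>[of g s t] DERIV_const[of "x $ s"]] by simp
      show "\<bar>rate (curve g t) (K g t) s\<bar> \<le> max_rate * weight t"
        using rate_bound[OF K, of "curve g t" g t s]
          mult_left_mono[OF cosh_real_ge_1[of "\<gamma> / 2 * t"] max_rate_nonneg] by linarith
    qed (use \<gamma>_pos max_rate_nonneg in auto)
    then have "\<bar>(\<Psi> g t - x) $ s\<bar> \<le> max_rate / (\<gamma> / 2) * weight t" for s
      by (simp add: \<Psi>0)
    then have "norm (\<Psi> g t - x) \<le> (\<Sum>s\<in>(UNIV::'m set). max_rate / (\<gamma> / 2) * weight t)"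
      by (intro order_trans[OF norm_le_l1_cart] sum_mono) auto
    then have "norm (\<Psi> g t - x) \<le> CARD('m) * (max_rate / (\<gamma> / 2)) * weight t"
      by simp
    moreover have "norm (G g t) = norm (\<Psi> g t - x) / weight t"
      by (simp add: G_def)
    ultimately show "norm (G g t) \<le> CARD('m) * (max_rate / (\<gamma> / 2))"
      using cosh0[of t] by (simp only: pos_divide_le_eq)
  qed
  then have G: "apply_bcontfun (Bcontfun (G g)) = G g" for g
    by (rule Bcontfun_inverse)
  have "dist (Bcontfun (G g)) (Bcontfun (G h)) \<le> 1 / 2 * dist g h" for g h
  proof (rule dist_bound)
    fix t
    have "\<bar>\<Psi> g t $ s - \<Psi> h t $ s\<bar> \<le> \<bar>\<Psi> g 0 $ s - \<Psi> h 0 $ s\<bar> + contraction_factor * dist g h * weight t" for s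
    proof (rule picard_difference[OF K K _ _ \<Psi> \<Psi>])
      fix t s
      have "\<bar>curve g t $ s - curve h t $ s\<bar> = weight t * \<bar>(apply_bcontfun g t - apply_bcontfun h t) $ s\<bar>"
        by (simp add: curve_def abs_mult flip: right_diff_distrib)
      also have "\<bar>(apply_bcontfun g t - apply_bcontfun h t) $ s\<bar> \<le> dist g h"
        using component_le_norm_cart[of "apply_bcontfun g t - apply_bcontfun h t" s] dist_bounded[of g t h]
        by (simp add: dist_norm)
      finally show "\<bar>curve g t $ s - curve h t $ s\<bar> \<le> dist g h * weight t"
        by (simp add: mult.commute)
    qed simp
    then have "norm (\<Psi> g t - \<Psi> h t) \<le> (\<Sum>s\<in>(UNIV::'m set). contraction_factor * dist g h * weight t)"
      by (intro order_trans[OF norm_le_l1_cart] sum_mono) (auto simp: \<Psi>0)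
    \<comment> \<open>The sum over the coordinates produces the cardinality that the smallness
      assumption contains.\<close>
    also have "\<dots> = (CARD('m) * contraction_factor) * (dist g h * weight t)" by simp
    also have "\<dots> \<le> 1 / 2 * (dist g h * weight t)"
      by (intro mult_right_mono contraction_factor) auto
    finally have "norm (\<Psi> g t - \<Psi> h t) \<le> 1 / 2 * dist g h * weight t" by simp
    moreover have "dist (G g t) (G h t) = norm (\<Psi> g t - \<Psi> h t) / weight t"
      by (simp add: G_def dist_norm flip: scaleR_diff_right)
    ultimately show "dist (apply_bcontfun (Bcontfun (G g)) t) (apply_bcontfun (Bcontfun (G h)) t) \<le> 1 / 2 * dist g h"
      unfolding G using cosh0[of t] by (simp only: pos_divide_le_eq)
  qed
  then obtain g where g: "Bcontfun (G g) = g"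
    using banach_fix_type[of "1 / 2" "\<lambda>g. Bcontfun (G g)"] by auto
  have "curve g t = \<Psi> g t" for t
  proof -
    have "apply_bcontfun g t = G g t" using G[of g] by (simp add: g)
    then show ?thesis using cosh0[of t] by (simp add: curve_def G_def)
  qed
  then have "curve g = \<Psi> g" ..
  then have "full_orbit (curve g) (K g)" "curve g 0 = x"
    using K[of g] \<Psi>[of g] \<Psi>0[of g] by (auto simp: full_orbit_def)
  then show ?thesis by blast
qed

text \<open>Full orbits through a phase exist and are unique, so exactly one value qualifies and the
  choice operator merely extracts it.\<close>

definition slaved_coupling :: "real^'m \<Rightarrow> 'm \<Rightarrow> 'm \<Rightarrow> real" where
  "slaved_coupling x = (SOME \<kappa>0. \<exists>\<phi> \<kappa>. full_orbit \<phi> \<kappa> \<and> \<phi> 0 = x \<and> \<kappa> 0 = \<kappa>0)"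

abbreviation slaved_orbit :: "(real \<Rightarrow> real^'m) \<Rightarrow> bool" where
  "slaved_orbit \<phi> \<equiv> full_orbit \<phi> (\<lambda>t. slaved_coupling (\<phi> t))"

text \<open>Shifting time so that the orbit starts at \<open>t\<close>, uniqueness shows that its
  couplings depend on the current phase alone. This is what makes the graph invariant.\<close>

lemma slaved_coupling_eq:
  assumes "full_orbit \<phi> \<kappa>"
  shows "slaved_coupling (\<phi> t) = \<kappa> t"
proof -
  have orb: "full_orbit (\<lambda>s. \<phi> (s + t)) (\<lambda>s. \<kappa> (s + t))" by (rule full_orbit_shift[OF assms])
  have "\<exists>\<psi> \<kappa>'. full_orbit \<psi> \<kappa>' \<and> \<psi> 0 = \<phi> t \<and> \<kappa>' 0 = slaved_coupling (\<phi> t)"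
    unfolding slaved_coupling_def
    by (rule someI[of _ "\<kappa> t"], intro exI[of _ "\<lambda>s. \<phi> (s + t)"] exI[of _ "\<lambda>s. \<kappa> (s + t)"]) (use orb in auto)
  then obtain \<psi> \<kappa>' where \<psi>: "full_orbit \<psi> \<kappa>'" "\<psi> 0 = \<phi> t" "\<kappa>' 0 = slaved_coupling (\<phi> t)" by blast
  show ?thesis
    using full_orbit_unique(2)[OF \<psi>(1) orb] \<psi> by auto
qed

text \<open>The system is autonomous, so the phase can be prescribed at any time \<open>T\<close>.
  The stability argument prescribes it at the end of an interval.\<close>

lemma slaved_orbit_exists:
  obtains \<phi> where "slaved_orbit \<phi>" "\<phi> T = x"
proof -
  obtain \<phi> \<kappa> where o: "full_orbit \<phi> \<kappa>" "\<phi> 0 = x" using full_orbit_exists by blast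
  have "full_orbit (\<lambda>t. \<phi> (t + - T)) (\<lambda>t. slaved_coupling (\<phi> (t + - T)))"
    using full_orbit_shift[OF o(1), of "- T"] slaved_coupling_eq[OF o(1)] by simp
  then show thesis by (rule that) (simp add: o(2))
qed

lemma slaved_coupling_lipschitz:
  assumes "\<And>s. \<bar>x $ s - y $ s\<bar> \<le> a"
  shows "\<bar>slaved_coupling x s r - slaved_coupling y s r\<bar> \<le> 8 * \<nu> * \<delta> / \<gamma> * a"
proof -
  obtain \<phi> where \<phi>: "slaved_orbit \<phi>" "\<phi> 0 = x" by (rule slaved_orbit_exists)
  obtain \<psi> where \<psi>: "slaved_orbit \<psi>" "\<psi> 0 = y" by (rule slaved_orbit_exists)
  show ?thesis
    using full_orbit_coupling_difference[OF \<phi>(1) \<psi>(1), of a s r] assms by (simp add: \<phi>(2) \<psi>(2))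
qed

lemma slaved_coupling_bound: "\<bar>slaved_coupling x s r\<bar> \<le> \<nu> * \<delta> / \<gamma>"
proof -
  obtain \<phi> where "slaved_orbit \<phi>" "\<phi> 0 = x" by (rule slaved_orbit_exists)
  then show ?thesis using driven_bound[of \<phi> _ 0 s r] by (auto simp: full_orbit_def)
qed

lemma slaved_coupling_continuous: "continuous_on UNIV (\<lambda>x. slaved_coupling x s r)"
proof (rule lipschitz_on_continuous_on)
  show "(8 * \<nu> * \<delta> / \<gamma>)-lipschitz_on UNIV (\<lambda>x. slaved_coupling x s r)"
  proof (rule lipschitz_onI)
    fix x y :: "real^'m"
    have "\<bar>x $ s - y $ s\<bar> \<le> dist x y" for s
      using component_le_norm_cart[of "x - y" s] by (simp add: dist_norm)
    then show "dist (slaved_coupling x s r) (slaved_coupling y s r) \<le> 8 * \<nu> * \<delta> / \<gamma> * dist x y"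
      unfolding dist_real_def by (rule slaved_coupling_lipschitz)
  qed (use \<nu>_pos \<delta>_nonneg \<gamma>_pos in auto)
qed

section \<open>Periodicity of the slaved couplings\<close>

lemma \<Gamma>_periodic_int: "\<Gamma> (x + 2 * pi * of_int n) = \<Gamma> x"
proof (induction n arbitrary: x rule: int_induct[where k = 0])
  case base
  then show ?case by simp
next
  case (step1 i)
  then show ?case using \<Gamma>_periodic[of "x + 2 * pi * of_int i"] by (simp add: algebra_simps)
next
  case (step2 i)
  then show ?case using \<Gamma>_periodic[of "x + 2 * pi * of_int (i - 1)"] by (simp add: algebra_simps)
qed

lemma sin_periodic_int: "sin (x + 2 * pi * of_int n) = sin x" for x :: real
  by (simp add: sin_add sin_int_2pin cos_int_2pin)

text \<open>Phases enter only through differences inside \<Gamma> and the sine, both unchanged by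
  multiples of 2 pi. A translated orbit therefore carries the same couplings, so the slaved coupling
  descends to the torus.\<close>

lemma full_orbit_translate:
  assumes "full_orbit \<phi> \<kappa>" and y: "\<And>s. \<exists>n. y $ s = 2 * pi * of_int n"
  shows "full_orbit (\<lambda>t. \<phi> t + y) \<kappa>"
proof -
  have "\<exists>n. (x + y) $ r - (x + y) $ s = x $ r - x $ s + 2 * pi * of_int n" for x :: "real^'m" and s r
  proof -
    obtain n n' where "y $ r = 2 * pi * of_int n" "y $ s = 2 * pi * of_int n'" using y by meson
    then show ?thesis by (intro exI[of _ "n - n'"]) (simp add: algebra_simps)
  qed
  then have \<Gamma>: "\<Gamma> ((x + y) $ r - (x + y) $ s) = \<Gamma> (x $ r - x $ s)"
    and sin: "sin ((x + y) $ r - (x + y) $ s) = sin (x $ r - x $ s)" for x s r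
    by (metis \<Gamma>_periodic_int, metis sin_periodic_int)
  have rate: "rate (x + y) k s = rate x k s" for x k s
    unfolding rate_def sin ..
  have "((\<lambda>\<tau>. (\<phi> \<tau> + y) $ s) has_real_derivative rate (\<phi> t) (\<kappa> t) s) (at t)" for t s
    using DERIV_add[OF _ DERIV_const[of "y $ s"]] assms(1) by (fastforce simp: full_orbit_def)
  then show ?thesis
    using assms(1) unfolding full_orbit_def driven_def \<Gamma> rate by blast
qed

lemma slaved_coupling_periodic:
  assumes "\<And>s. \<exists>n. y $ s = 2 * pi * of_int n"
  shows "slaved_coupling (x + y) = slaved_coupling x"
proof -
  obtain \<phi> where \<phi>: "slaved_orbit \<phi>" "\<phi> 0 = x" by (rule slaved_orbit_exists)
  show ?thesis
    using slaved_coupling_eq[OF full_orbit_translate[OF \<phi>(1) assms], of 0] by (simp add: \<phi>(2))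
qed

end

section \<open>The invariant toroidal manifold\<close>

text \<open>Gronwall for the sum of squares: its derivative is at most
  \<open>2 * \<bar>L\<bar> * N\<close> times itself, and it starts at 0. \<open>exp_decay\<close> is
  applied with the negative of this rate.\<close>

lemma linear_ode_zero_forward:
  fixes y g :: "'a::finite \<Rightarrow> real \<Rightarrow> real"
  assumes deriv: "\<And>a t. (y a has_real_derivative g a t) (at t)"
    and bound: "\<And>a t. \<bar>g a t\<bar> \<le> L * (\<Sum>b\<in>UNIV. \<bar>y b t\<bar>)"
    and init: "\<And>a. y a 0 = 0" and t: "0 \<le> t"
  shows "y a t = 0"
proof -
  define D where "D t = (\<Sum>a\<in>UNIV. (y a t)\<^sup>2)" for t
  define N where "N = real CARD('a)"
  have deriv_D: "(D has_real_derivative (\<Sum>a\<in>UNIV. 2 * (y a t * g a t))) (at t)" for t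
    unfolding D_def by (auto intro!: derivative_eq_intros deriv sum.cong)
  have "D t \<le> exp (- (- (2 * \<bar>L\<bar> * N)) * (t - 0)) * D 0"
  proof (rule exp_decay[OF t])
    show "continuous_on {0..t} D"
      using deriv_D by (intro DERIV_continuous_on) (auto intro: DERIV_subset)
    fix s
    have "(\<Sum>a\<in>UNIV. 2 * (y a s * g a s)) \<le> (\<Sum>a\<in>UNIV. 2 * (\<bar>y a s\<bar> * (\<bar>L\<bar> * (\<Sum>b\<in>UNIV. \<bar>y b s\<bar>))))"
    proof (intro sum_mono mult_left_mono)
      fix a
      have "\<bar>g a s\<bar> \<le> \<bar>L\<bar> * (\<Sum>b\<in>UNIV. \<bar>y b s\<bar>)"
        by (rule order_trans[OF bound mult_right_mono]) (auto intro: sum_nonneg)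
      then have "\<bar>y a s\<bar> * \<bar>g a s\<bar> \<le> \<bar>y a s\<bar> * (\<bar>L\<bar> * (\<Sum>b\<in>UNIV. \<bar>y b s\<bar>))"
        by (rule mult_left_mono) simp
      then show "y a s * g a s \<le> \<bar>y a s\<bar> * (\<bar>L\<bar> * (\<Sum>b\<in>UNIV. \<bar>y b s\<bar>))"
        by (rule order_trans[rotated]) (metis abs_ge_self abs_mult)
    qed simp
    also have "\<dots> = 2 * \<bar>L\<bar> * (\<Sum>b\<in>UNIV. \<bar>y b s\<bar> * 1)\<^sup>2"
      by (simp add: power2_eq_square sum_distrib_right sum_distrib_left mult_ac)
    also have "\<dots> \<le> 2 * \<bar>L\<bar> * ((\<Sum>b\<in>UNIV. \<bar>y b s\<bar>\<^sup>2) * (\<Sum>b\<in>(UNIV :: 'a set). 1\<^sup>2))"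
      by (intro mult_left_mono Cauchy_Schwarz_ineq_sum) simp
    also have "\<dots> = - (- (2 * \<bar>L\<bar> * N)) * D s" by (simp add: D_def N_def)
    finally show "\<exists>D'. (D has_real_derivative D') (at s) \<and> D' \<le> - (- (2 * \<bar>L\<bar> * N)) * D s"
      using deriv_D by blast
  qed
  also have "D 0 = 0" by (simp add: D_def init)
  finally have "D t \<le> 0" by simp
  then have "D t = 0" using sum_nonneg[of UNIV "\<lambda>a. (y a t)\<^sup>2"] by (simp add: D_def)
  then have "\<forall>a\<in>UNIV. (y a t)\<^sup>2 = 0"
    unfolding D_def by (subst (asm) sum_nonneg_eq_0_iff) auto
  then show ?thesis by simp
qed

lemma linear_ode_zero:
  fixes y g :: "'a::finite \<Rightarrow> real \<Rightarrow> real"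
  assumes deriv: "\<And>a t. (y a has_real_derivative g a t) (at t)"
    and bound: "\<And>a t. \<bar>g a t\<bar> \<le> L * (\<Sum>b\<in>UNIV. \<bar>y b t\<bar>)"
    and init: "\<And>a. y a 0 = 0"
  shows "y a t = 0"
proof (cases "0 \<le> t")
  case True
  then show ?thesis by (rule linear_ode_zero_forward[OF assms])
next
  case False
  have "y a (- (- t)) = 0"
  proof (rule linear_ode_zero_forward[where y = "\<lambda>a t. y a (- t)" and g = "\<lambda>a t. - g a (- t)"])
    show "((\<lambda>t. y a (- t)) has_real_derivative - g a (- t)) (at t)" for a t
      using deriv[of a "- t"] by (simp add: DERIV_mirror)
    show "\<bar>- g a (- t)\<bar> \<le> L * (\<Sum>b\<in>UNIV. \<bar>y b (- t)\<bar>)" for a t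
      using bound[of a "- t"] by simp
  qed (use False init in auto)
  then show ?thesis by simp
qed

section \<open>The lattice of periods and functions on the torus\<close>

definition torus_period :: "real^'m \<Rightarrow> bool" where
  "torus_period z \<longleftrightarrow> (\<forall>s. \<exists>n. z $ s = 2 * pi * of_int n)"

lemma torus_point_eq_iff: "torus_point x = torus_point y \<longleftrightarrow> torus_period (y - x)"
proof -
  have "cis (x $ s) = cis (y $ s) \<longleftrightarrow> (\<exists>n. y $ s - x $ s = 2 * pi * of_int n)" for s
  proof -
    have "cis (x $ s) = cis (y $ s) \<longleftrightarrow> sin (y $ s) = sin (x $ s) \<and> cos (y $ s) = cos (x $ s)"
      by (auto simp: complex_eq_iff)
    also have "\<dots> \<longleftrightarrow> (\<exists>n::int. y $ s = x $ s + 2 * pi * of_int n)"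
      by (rule sin_cos_eq_iff)
    finally show ?thesis by (auto simp: algebra_simps)
  qed
  then show ?thesis
    by (simp add: torus_point_def torus_period_def vec_eq_iff)
qed

text \<open>Periodicity is given for one coordinate and one period. A lattice vector is reached
  through natural multiples, then negative ones, then by adding up the coordinates.\<close>

lemma torus_continuous_translate:
  assumes f: "torus_continuous f" and z: "torus_period z"
  shows "f (x + z) = f x"
proof -
  have nat: "f (x + axis s (2 * pi * real n)) = f x" for x s n
  proof (induction n)
    case 0
    have "x + axis s (2 * pi * real 0) = x"
      by (simp add: axis_def vec_eq_iff)
    then show ?case by (rule arg_cong)
  next
    case (Suc n)
    have "x + axis s (2 * pi * real (Suc n)) = (x + axis s (2 * pi * real n)) + axis s (2 * pi)"
      by (simp add: axis_def vec_eq_iff algebra_simps)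
    then have "f (x + axis s (2 * pi * real (Suc n))) = f ((x + axis s (2 * pi * real n)) + axis s (2 * pi))"
      by (rule arg_cong)
    also have "\<dots> = f (x + axis s (2 * pi * real n))"
      using f unfolding torus_continuous_def by blast
    also have "\<dots> = f x" by (rule Suc)
    finally show ?case .
  qed
  have int: "f (x + axis s (2 * pi * of_int n)) = f x" for x s n
  proof (cases "0 \<le> n")
    case True
    then show ?thesis using nat[of x s "nat n"] by simp
  next
    case False
    have "(x + axis s (2 * pi * of_int n)) + axis s (2 * pi * real (nat (- n))) = x"
      using False by (simp add: axis_def vec_eq_iff)
    then have "f ((x + axis s (2 * pi * of_int n)) + axis s (2 * pi * real (nat (- n)))) = f x"
      by (rule arg_cong)
    then show ?thesis unfolding nat .
  qed
  have "f (x + (\<Sum>s\<in>A. axis s (z $ s))) = f x" if "finite A" for A x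
    using that
  proof (induction A arbitrary: x rule: finite_induct)
    case empty
    then show ?case by simp
  next
    case (insert s A)
    obtain n where n: "z $ s = 2 * pi * of_int n" using z by (auto simp: torus_period_def)
    have "f (x + (\<Sum>s\<in>insert s A. axis s (z $ s)))
        = f ((x + axis s (z $ s)) + (\<Sum>s\<in>A. axis s (z $ s)))"
      using insert.hyps by (simp add: add.assoc)
    also have "\<dots> = f (x + axis s (z $ s))" by (rule insert.IH)
    also have "\<dots> = f x" unfolding n by (rule int)
    finally show ?case .
  qed
  moreover have "(\<Sum>s\<in>UNIV. axis s (z $ s)) = z"
    unfolding vec_eq_iff by (simp add: axis_def)
  ultimately show ?thesis by (metis finite)
qed

lemma torus_period_axis: "torus_period (axis s (2 * pi))"
  unfolding torus_period_def
proof
  fix r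
  have "axis s (2 * pi) $ r = 2 * pi * of_int (if r = s then 1 else 0)" by (simp add: axis_def)
  then show "\<exists>n. axis s (2 * pi) $ r = 2 * pi * of_int n" by blast
qed

lemma torus_continuous_compact_range:
  fixes f :: "real^'m::finite \<Rightarrow> 'b::topological_space"
  assumes "torus_continuous f"
  shows "compact (range f)"
proof -
  have "range f \<subseteq> f ` cbox 0 (\<chi> s. 2 * pi)"
  proof (rule image_subsetI)
    fix x
    \<comment> \<open>Subtracting whole periods moves \<open>x\<close> into the fundamental box;
      each coordinate becomes \<open>2 * pi\<close> times a fractional part.\<close>
    define z :: "real^'m" where "z = (\<chi> s. 2 * pi * of_int (- \<lfloor>x $ s / (2 * pi)\<rfloor>))"
    have "x + z \<in> cbox 0 (\<chi> s. 2 * pi)"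
    proof -
      have "0 \<le> x $ s + z $ s \<and> x $ s + z $ s \<le> 2 * pi" for s
      proof -
        have "x $ s + z $ s = 2 * pi * frac (x $ s / (2 * pi))"
          by (simp add: z_def frac_def field_simps)
        then show ?thesis
          using frac_ge_0[of "x $ s / (2 * pi)"] frac_lt_1[of "x $ s / (2 * pi)"] by simp
      qed
      then show ?thesis by (simp add: mem_box_cart)
    qed
    moreover have "f (x + z) = f x"
      by (rule torus_continuous_translate[OF assms])
        (unfold torus_period_def z_def vec_lambda_beta, blast)
    ultimately show "f x \<in> f ` cbox 0 (\<chi> s. 2 * pi)" by (metis imageI)
  qed
  then have "range f = f ` cbox 0 (\<chi> s. 2 * pi)" by blast
  moreover have "compact (f ` cbox 0 (\<chi> s. 2 * pi))"
    using assms by (intro compact_continuous_image) (auto simp: torus_continuous_def intro: continuous_on_subset)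
  ultimately show ?thesis by simp
qed

section \<open>Network solutions and their uniqueness\<close>

lemma network_solutionD:
  assumes "network_solution E P w \<gamma> \<mu>t \<nu> \<Gamma> J \<theta> k" "t \<in> J"
  shows "((\<lambda>\<tau>. \<theta> \<tau> $ i) has_real_derivative
      w i + (\<Sum>j\<in>UNIV. adj E i j * k t $ i $ j * sin (\<theta> t $ j - \<theta> t $ i))) (at t within J)"
    and "(i, j) \<in> E \<Longrightarrow> ((\<lambda>\<tau>. k \<tau> $ i $ j) has_real_derivative
      - \<gamma> * k t $ i $ j + (if same_cluster P i j then \<mu>t else \<nu>) * \<Gamma> (\<theta> t $ j - \<theta> t $ i)) (at t within J)"
    and "(i, j) \<notin> E \<Longrightarrow> k t $ i $ j = 0"
  using assms unfolding network_solution_def by blast+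

locale adaptive_network =
  fixes E :: "('n::finite \<times> 'n) set" and P :: "'m::finite \<Rightarrow> 'n set" and sel :: "'m \<Rightarrow> 'n"
    and w :: "'n \<Rightarrow> real" and c :: "'m \<Rightarrow> 'm \<Rightarrow> nat"
    and \<gamma> \<mu>t \<delta> :: real and \<Gamma> :: "real \<Rightarrow> real"
  assumes partition: "is_partition P" and sel_in: "sel s \<in> P s"
    and \<gamma>_pos: "\<gamma> > 0" and \<delta>_nonneg: "\<delta> \<ge> 0"
    and \<Gamma>_bound: "\<bar>\<Gamma> x\<bar> \<le> \<delta>" and \<Gamma>_lipschitz: "\<bar>\<Gamma> x - \<Gamma> y\<bar> \<le> \<delta> * \<bar>x - y\<bar>"
    and \<Gamma>_periodic: "\<Gamma> (x + 2 * pi) = \<Gamma> x"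
    and w_eq: "i \<in> P s \<Longrightarrow> j \<in> P s \<Longrightarrow> w i = w j"
    and degree: "s \<noteq> r \<Longrightarrow> i \<in> P s \<Longrightarrow> (\<Sum>j\<in>P r. adj E i j) = real (c s r)"
begin

definition cl :: "'n \<Rightarrow> 'm" where
  "cl i = (THE s. i \<in> P s)"

lemma mem_cluster_iff: "i \<in> P s \<longleftrightarrow> cl i = s"
proof -
  obtain s where s: "i \<in> P s" using partition by (force simp: is_partition_def)
  moreover have "r = s" if "i \<in> P r" for r
    using partition that s by (auto simp: is_partition_def disjoint_family_on_def)
  ultimately have "\<exists>!s. i \<in> P s" by blast
  then have "i \<in> P (cl i)" unfolding cl_def by (rule theI')
  then show ?thesis using \<open>\<exists>!s. i \<in> P s\<close> by blast
qed

lemma cl_sel [simp]: "cl (sel s) = s"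
  using sel_in mem_cluster_iff by blast

lemma same_cluster_iff: "same_cluster P i j \<longleftrightarrow> cl i = cl j"
  by (auto simp: same_cluster_def mem_cluster_iff)

definition \<kappa>0 :: real where "\<kappa>0 = \<mu>t * \<Gamma> 0 / \<gamma>"

text \<open>The change of coordinates asks for its relations at all times, whereas an error solution
  has \<open>e $ sel s = 0\<close> only on \<open>J\<close>. Setting these components to 0
  everywhere leaves the solution on \<open>J\<close> unchanged.\<close>

lemma error_solution_network_solution:
  assumes "error_solution E P sel w \<gamma> \<mu>t \<nu> \<Gamma> J e k \<phi>"
  shows "network_solution E P w \<gamma> \<mu>t \<nu> \<Gamma> J
    (\<lambda>t. \<chi> i. (if i = sel (cl i) then 0 else e t $ i) + \<phi> t $ cl i) k"
proof -
  define e' :: "real \<Rightarrow> real^'n" where "e' t = (\<chi> i. if i = sel (cl i) then 0 else e t $ i)" for t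
  have e'_nth: "(\<lambda>t. e' t $ i) = (\<lambda>t. e t $ i)" if "i \<in> P s - {sel s}" for i s
    using that by (auto simp: e'_def mem_cluster_iff)
  have e': "e' t = e t" if "t \<in> J" for t
    using assms that
    by (auto simp: e'_def error_solution_def vec_eq_iff) metis
  have "error_solution E P sel w \<gamma> \<mu>t \<nu> \<Gamma> J e' k \<phi>"
    using assms unfolding error_solution_def by (simp add: e'_nth e' del: Diff_iff)
  then show ?thesis
    by (subst network_solution_iff_error_solution[where \<phi> = \<phi> and e = e' and sel = sel])
      (auto simp: partition sel_in mem_cluster_iff e'_def)
qed

text \<open>Products of couplings and sines prevent a global Lipschitz estimate, but with the
  couplings of one solution bounded the difference still satisfies a linear one. Phases and
  couplings are stacked over the sum type \<open>'n + 'n \<times> 'n\<close> to form one family of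
  unknowns. The bounded solution will be the one on the manifold.\<close>

lemma network_solution_unique:
  assumes 1: "network_solution E P w \<gamma> \<mu>t \<nu> \<Gamma> UNIV \<theta> k"
    and 2: "network_solution E P w \<gamma> \<mu>t \<nu> \<Gamma> UNIV \<theta>' k'"
    and B: "\<And>t i j. \<bar>k' t $ i $ j\<bar> \<le> B"
    and init: "\<theta> 0 = \<theta>' 0" "k 0 = k' 0"
  shows "\<theta> t = \<theta>' t" "k t = k' t"
proof -
  define y where "y a t = (case a of Inl i \<Rightarrow> \<theta> t $ i - \<theta>' t $ i
    | Inr (i, j) \<Rightarrow> k t $ i $ j - k' t $ i $ j)" for a :: "'n + 'n \<times> 'n" and t
  define \<sigma> where "\<sigma> t = (\<Sum>a\<in>UNIV. \<bar>y a t\<bar>)" for t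
  define \<mu>' where "\<mu>' i j = (if same_cluster P i j then \<mu>t else \<nu>)" for i j
  have y_le: "\<bar>y a t\<bar> \<le> \<sigma> t" for a t
    unfolding \<sigma>_def by (rule member_le_sum) auto
  have \<theta>_le: "\<bar>\<theta> t $ i - \<theta>' t $ i\<bar> \<le> \<sigma> t" and k_le: "\<bar>k t $ i $ j - k' t $ i $ j\<bar> \<le> \<sigma> t" for t i j
    using y_le[of "Inl i" t] y_le[of "Inr (i, j)" t] by (auto simp: y_def)
  have \<sigma>0: "\<sigma> t \<ge> 0" for t by (simp add: \<sigma>_def sum_nonneg)
  have B0: "B \<ge> 0" using B[of 0 undefined undefined] by linarith
  define g where "g a t = (case a of
      Inl i \<Rightarrow> (\<Sum>j\<in>UNIV. adj E i j * k t $ i $ j * sin (\<theta> t $ j - \<theta> t $ i))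
        - (\<Sum>j\<in>UNIV. adj E i j * k' t $ i $ j * sin (\<theta>' t $ j - \<theta>' t $ i))
    | Inr (i, j) \<Rightarrow> if (i, j) \<in> E then - \<gamma> * (k t $ i $ j - k' t $ i $ j)
        + \<mu>' i j * (\<Gamma> (\<theta> t $ j - \<theta> t $ i) - \<Gamma> (\<theta>' t $ j - \<theta>' t $ i)) else 0)" for a t
  define L where "L = CARD('n) * (1 + 2 * B) + \<gamma> + (\<bar>\<mu>t\<bar> + \<bar>\<nu>\<bar>) * (2 * \<delta>)"
  have deriv: "(y a has_real_derivative g a t) (at t)" for a t
  proof (cases a)
    case (Inl i)
    have "((\<lambda>\<tau>. \<theta> \<tau> $ i - \<theta>' \<tau> $ i) has_real_derivative
        (w i + (\<Sum>j\<in>UNIV. adj E i j * k t $ i $ j * sin (\<theta> t $ j - \<theta> t $ i)))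
        - (w i + (\<Sum>j\<in>UNIV. adj E i j * k' t $ i $ j * sin (\<theta>' t $ j - \<theta>' t $ i)))) (at t)"
      by (intro DERIV_diff network_solutionD(1)[OF 1] network_solutionD(1)[OF 2] UNIV_I)
    then show ?thesis by (simp add: y_def[abs_def] g_def Inl)
  next
    case (Inr ij)
    obtain i j where ij: "ij = (i, j)" by (cases ij)
    show ?thesis
    proof (cases "(i, j) \<in> E")
      case True
      then have "((\<lambda>\<tau>. k \<tau> $ i $ j - k' \<tau> $ i $ j) has_real_derivative
          (- \<gamma> * k t $ i $ j + \<mu>' i j * \<Gamma> (\<theta> t $ j - \<theta> t $ i))
          - (- \<gamma> * k' t $ i $ j + \<mu>' i j * \<Gamma> (\<theta>' t $ j - \<theta>' t $ i))) (at t)"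
        unfolding \<mu>'_def by (intro DERIV_diff network_solutionD(2)[OF 1] network_solutionD(2)[OF 2] UNIV_I)
      then show ?thesis
        using True by (simp add: y_def[abs_def] g_def Inr ij algebra_simps)
    next
      case False
      then have "k \<tau> $ i $ j - k' \<tau> $ i $ j = 0" for \<tau>
        using network_solutionD(3)[OF 1] network_solutionD(3)[OF 2] by simp
      then show ?thesis using False by (simp add: y_def[abs_def] g_def Inr ij)
    qed
  qed
  have bound: "\<bar>g a t\<bar> \<le> L * \<sigma> t" for a t
  proof (cases a)
    case (Inl i)
    have "\<bar>adj E i j * k t $ i $ j * sin (\<theta> t $ j - \<theta> t $ i)
        - adj E i j * k' t $ i $ j * sin (\<theta>' t $ j - \<theta>' t $ i)\<bar> \<le> (1 + 2 * B) * \<sigma> t" for j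
    proof -
      let ?x = "\<theta> t $ j - \<theta> t $ i" and ?x' = "\<theta>' t $ j - \<theta>' t $ i"
      have "\<bar>k t $ i $ j * sin ?x - k' t $ i $ j * sin ?x'\<bar>
          = \<bar>(k t $ i $ j - k' t $ i $ j) * sin ?x + k' t $ i $ j * (sin ?x - sin ?x')\<bar>"
        by (simp add: algebra_simps)
      also have "\<dots> \<le> \<bar>k t $ i $ j - k' t $ i $ j\<bar> * \<bar>sin ?x\<bar> + \<bar>k' t $ i $ j\<bar> * \<bar>sin ?x - sin ?x'\<bar>"
        by (rule order_trans[OF abs_triangle_ineq]) (simp add: abs_mult)
      also have "\<dots> \<le> \<sigma> t * 1 + B * (2 * \<sigma> t)"
      proof (intro add_mono mult_mono)
        show "\<bar>sin ?x - sin ?x'\<bar> \<le> 2 * \<sigma> t"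
          using sin_lipschitz[of ?x ?x'] \<theta>_le[of t i] \<theta>_le[of t j] by linarith
      qed (use k_le B \<sigma>0 B0 in auto)
      finally have "\<bar>k t $ i $ j * sin ?x - k' t $ i $ j * sin ?x'\<bar> \<le> (1 + 2 * B) * \<sigma> t"
        by (simp add: algebra_simps)
      then show ?thesis using \<sigma>0[of t] B0 by (auto simp: adj_def)
    qed
    then have "\<bar>g a t\<bar> \<le> (\<Sum>j\<in>(UNIV :: 'n set). (1 + 2 * B) * \<sigma> t)"
      unfolding g_def Inl sum.case sum_subtractf[symmetric]
      by (intro order_trans[OF sum_abs] sum_mono) auto
    also have "\<dots> = CARD('n) * (1 + 2 * B) * \<sigma> t" by simp
    also have "\<dots> \<le> L * \<sigma> t"
      unfolding L_def using \<gamma>_pos \<delta>_nonneg \<sigma>0 by (intro mult_right_mono) auto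
    finally show ?thesis .
  next
    case (Inr ij)
    obtain i j where ij: "ij = (i, j)" by (cases ij)
    let ?x = "\<theta> t $ j - \<theta> t $ i" and ?x' = "\<theta>' t $ j - \<theta>' t $ i"
    have "\<bar>\<Gamma> ?x - \<Gamma> ?x'\<bar> \<le> \<delta> * (2 * \<sigma> t)"
      using \<theta>_le[of t i] \<theta>_le[of t j]
      by (intro order_trans[OF \<Gamma>_lipschitz] mult_left_mono \<delta>_nonneg) linarith
    then have "\<bar>\<mu>' i j\<bar> * \<bar>\<Gamma> ?x - \<Gamma> ?x'\<bar> \<le> (\<bar>\<mu>t\<bar> + \<bar>\<nu>\<bar>) * (\<delta> * (2 * \<sigma> t))"
      by (intro mult_mono) (auto simp: \<mu>'_def)
    moreover have "\<gamma> * \<bar>k t $ i $ j - k' t $ i $ j\<bar> \<le> \<gamma> * \<sigma> t"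
      using k_le \<gamma>_pos by (intro mult_left_mono) auto
    moreover have "\<bar>g a t\<bar> \<le> \<gamma> * \<bar>k t $ i $ j - k' t $ i $ j\<bar> + \<bar>\<mu>' i j\<bar> * \<bar>\<Gamma> ?x - \<Gamma> ?x'\<bar>"
    proof (cases "(i, j) \<in> E")
      case True
      then have "g a t = - \<gamma> * (k t $ i $ j - k' t $ i $ j) + \<mu>' i j * (\<Gamma> ?x - \<Gamma> ?x')"
        by (simp add: g_def Inr ij)
      then show ?thesis
        using abs_triangle_ineq[of "- \<gamma> * (k t $ i $ j - k' t $ i $ j)" "\<mu>' i j * (\<Gamma> ?x - \<Gamma> ?x')"] \<gamma>_pos
        by (simp add: abs_mult)
    next
      case False
      then show ?thesis using \<gamma>_pos by (simp add: g_def Inr ij)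
    qed
    ultimately have "\<bar>g a t\<bar> \<le> (\<gamma> + (\<bar>\<mu>t\<bar> + \<bar>\<nu>\<bar>) * (2 * \<delta>)) * \<sigma> t"
      by (simp add: algebra_simps)
    also have "\<dots> \<le> L * \<sigma> t"
      unfolding L_def using B0 \<sigma>0 by (intro mult_right_mono) auto
    finally show ?thesis .
  qed
  have zero: "y a t = 0" for a t
    by (rule linear_ode_zero[OF deriv bound[unfolded \<sigma>_def]]) (auto simp: y_def init split: sum.split)
  show "\<theta> t = \<theta>' t" "k t = k' t"
    using zero[of "Inl i" t for i] zero[of "Inr (i, j)" t for i j]
    by (auto simp: y_def vec_eq_iff)
qed

end

section \<open>The manifold as a graph over the torus\<close>

locale slow_adaptive_network = adaptive_network E P sel w c \<gamma> \<mu>t \<delta> \<Gamma>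
  for E :: "('n::finite \<times> 'n) set" and P :: "'m::finite \<Rightarrow> 'n set" and sel w c \<gamma> \<mu>t \<delta> \<Gamma> +
  fixes \<nu> :: real
  assumes \<nu>_pos: "\<nu> > 0"
    and \<nu>_small: "CARD('m) * (12 * (\<Sum>s\<in>UNIV. \<Sum>r\<in>UNIV. real (c s r)) * \<delta> * \<nu> / \<gamma>\<^sup>2) \<le> 1 / 2"
begin

sublocale reduced: reduced_system "\<lambda>s. w (sel s)" "\<lambda>s r. real (c s r)" \<gamma> \<delta> \<nu> \<Gamma>
  by unfold_locales
    (use \<gamma>_pos \<delta>_nonneg \<nu>_pos \<nu>_small in \<open>auto intro: \<Gamma>_bound \<Gamma>_lipschitz \<Gamma>_periodic\<close>)

abbreviation "solution \<equiv> network_solution E P w \<gamma> \<mu>t \<nu> \<Gamma>"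
abbreviation "err_solution \<equiv> error_solution E P sel w \<gamma> \<mu>t \<nu> \<Gamma>"
abbreviation "trajectories \<equiv> error_trajectories E P sel w \<gamma> \<mu>t \<nu> \<Gamma>"
abbreviation "toroidal_manifold \<equiv> invariant_toroidal_manifold E P sel w \<gamma> \<mu>t \<nu> \<Gamma>"

definition coupling :: "real^'m \<Rightarrow> real^'n^'n" where
  "coupling x = (\<chi> i j. if (i, j) \<in> E then
     if cl i = cl j then \<kappa>0 else reduced.slaved_coupling x (cl i) (cl j) else 0)"

lemma coupling_nth:
  "coupling x $ i $ j = (if (i, j) \<in> E then
     if cl i = cl j then \<kappa>0 else reduced.slaved_coupling x (cl i) (cl j) else 0)"
  by (simp add: coupling_def)

lemma coupling_bound: "\<bar>coupling x $ i $ j\<bar> \<le> \<bar>\<kappa>0\<bar> + \<nu> * \<delta> / \<gamma>"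
  using reduced.slaved_coupling_bound[of x "cl i" "cl j"] \<nu>_pos \<delta>_nonneg \<gamma>_pos
  by (auto simp: coupling_nth intro: add_increasing)

lemma coupling_periodic:
  assumes "torus_period z"
  shows "coupling (x + z) = coupling x"
  using reduced.slaved_coupling_periodic[of z x] assms
  by (simp add: coupling_def torus_period_def cong: if_cong)

lemma torus_continuous_coupling: "torus_continuous coupling"
  unfolding torus_continuous_def
proof (intro conjI allI)
  have "continuous_on UNIV (\<lambda>x. if (i, j) \<in> E then
      if cl i = cl j then \<kappa>0 else reduced.slaved_coupling x (cl i) (cl j) else 0)" for i j
    by (cases "(i, j) \<in> E"; cases "cl i = cl j") (auto intro: reduced.slaved_coupling_continuous)
  then show "continuous_on UNIV coupling"
    unfolding coupling_def by (intro continuous_on_vec_lambda)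
  fix x :: "real^'m" and s
  show "coupling (x + axis s (2 * pi)) = coupling x"
    by (rule coupling_periodic[OF torus_period_axis])
qed

text \<open>The range of a continuous function on the torus. Compactness will turn neighbourhoods of
  the manifold into tubes of uniform width.\<close>

lemma compact_torus_graph_coupling: "compact (torus_graph coupling)"
  unfolding torus_graph_def
proof (rule torus_continuous_compact_range)
  have "continuous_on UNIV coupling" using torus_continuous_coupling by (simp add: torus_continuous_def)
  moreover have "continuous_on UNIV (torus_point :: real^'m \<Rightarrow> _)"
    unfolding torus_point_def cis.code by (intro continuous_intros continuous_on_vec_lambda)
  moreover have "torus_point (x + axis s (2 * pi)) = torus_point x" for x :: "real^'m" and s
    by (rule sym) (simp add: torus_point_eq_iff torus_period_axis)
  ultimately show "torus_continuous (\<lambda>\<phi>. (0 :: real^'n, coupling \<phi>, torus_point \<phi>))"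
    unfolding torus_continuous_def
    using coupling_periodic[OF torus_period_axis] by (auto intro!: continuous_intros)
qed

text \<open>All edges from one cluster to another carry the same coupling, so the sum only counts
  edges, and every node of a cluster has the same number of them.\<close>

lemma coupling_sum:
  assumes "i \<in> P s" "s \<noteq> r"
  shows "(\<Sum>j\<in>P r. adj E i j * coupling x $ i $ j * h)
    = real (c s r) * reduced.slaved_coupling x s r * h"
proof -
  have "(\<Sum>j\<in>P r. adj E i j * coupling x $ i $ j * h)
      = (\<Sum>j\<in>P r. adj E i j * (reduced.slaved_coupling x s r * h))"
    by (rule sum.cong) (use assms in \<open>auto simp: adj_def coupling_nth mem_cluster_iff\<close>)
  then show ?thesis by (simp add: degree[OF assms(2,1)] flip: sum_distrib_right)
qed

text \<open>By \<open>coupling_sum\<close> the inter-cluster input is the same at all nodes of a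
  cluster and cancels in the error equations, while intra-cluster terms contain the sine of 0. So
  zero error persists, and the rest follows the reduced system.\<close>

lemma synchronous_solution:
  assumes "reduced.slaved_orbit \<phi>"
  shows "err_solution UNIV (\<lambda>t. 0) (\<lambda>t. coupling (\<phi> t)) \<phi>"
proof -
  have \<phi>: "((\<lambda>\<tau>. \<phi> \<tau> $ s) has_real_derivative
      reduced.rate (\<phi> t) (reduced.slaved_coupling (\<phi> t)) s) (at t)" for t s
    using assms by (auto simp: reduced.full_orbit_def)
  have \<kappa>: "((\<lambda>\<tau>. reduced.slaved_coupling (\<phi> \<tau>) s r) has_real_derivative
      - \<gamma> * reduced.slaved_coupling (\<phi> t) s r + \<nu> * \<Gamma> (\<phi> t $ r - \<phi> t $ s)) (at t)" for t s r
    using assms unfolding reduced.full_orbit_def reduced.driven_def by blast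
  have inter: "(\<Sum>j\<in>P r. adj E i j * coupling x $ i $ j * sin (0 - 0 + x $ r - x $ s))
      = real (c s r) * reduced.slaved_coupling x s r * sin (x $ r - x $ s)"
    if "i \<in> P s" "r \<in> UNIV - {s}" for i s r x
    using coupling_sum[OF that(1), of r x] that(2) by simp
  show ?thesis
    unfolding error_solution_def
  proof (intro ballI conjI allI impI)
    fix t s
    have "w (sel s) + (\<Sum>j\<in>P s. adj E (sel s) j * coupling (\<phi> t) $ sel s $ j * sin 0)
        + (\<Sum>r\<in>UNIV - {s}. \<Sum>j\<in>P r. adj E (sel s) j * coupling (\<phi> t) $ sel s $ j * sin (0 + \<phi> t $ r - \<phi> t $ s))
      = reduced.rate (\<phi> t) (reduced.slaved_coupling (\<phi> t)) s"
      unfolding reduced.rate_def sin_zero mult_zero_right sum.neutral_const add_0_right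
      by (intro arg_cong2[where f = plus] refl sum.cong) (use inter[OF sel_in, of _ s "\<phi> t"] in simp)
    then show "((\<lambda>\<tau>. \<phi> \<tau> $ s) has_real_derivative
        w (sel s) + (\<Sum>j\<in>P s. adj E (sel s) j * coupling (\<phi> t) $ sel s $ j * sin (0 $ j))
        + (\<Sum>r\<in>UNIV - {s}. \<Sum>j\<in>P r. adj E (sel s) j * coupling (\<phi> t) $ sel s $ j * sin (0 $ j + \<phi> t $ r - \<phi> t $ s)))
          (at t)"
      using \<phi>[of s t] by simp
  next
    fix t s i assume i: "i \<in> P s - {sel s}"
    have "(\<Sum>r\<in>UNIV - {s}. \<Sum>j\<in>P r.
          adj E i j * coupling (\<phi> t) $ i $ j * sin (0 - 0 + \<phi> t $ r - \<phi> t $ s)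
          - adj E (sel s) j * coupling (\<phi> t) $ sel s $ j * sin (0 - 0 + \<phi> t $ r - \<phi> t $ s)) = 0"
      unfolding sum_subtractf using i inter sel_in by (simp del: diff_self)
    then show "((\<lambda>\<tau>. 0 $ i) has_real_derivative
        w i - w (sel s)
        + (\<Sum>j\<in>P s. adj E i j * coupling (\<phi> t) $ i $ j * sin (0 $ j - 0 $ i)
             - adj E (sel s) j * coupling (\<phi> t) $ sel s $ j * sin (0 $ j))
        + (\<Sum>r\<in>UNIV - {s}. \<Sum>j\<in>P r.
             adj E i j * coupling (\<phi> t) $ i $ j * sin (0 $ j - 0 $ i + \<phi> t $ r - \<phi> t $ s)
             - adj E (sel s) j * coupling (\<phi> t) $ sel s $ j * sin (0 $ j + \<phi> t $ r - \<phi> t $ s)))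
          (at t)"
      using i w_eq[of i s "sel s"] sel_in[of s] by simp
  next
    fix t s r i j assume "s \<noteq> r" "i \<in> P s" "j \<in> P r" "(i, j) \<in> E"
    then show "((\<lambda>\<tau>. coupling (\<phi> \<tau>) $ i $ j) has_real_derivative
        - \<gamma> * coupling (\<phi> t) $ i $ j + \<nu> * \<Gamma> (0 $ j - 0 $ i + \<phi> t $ r - \<phi> t $ s)) (at t)"
      using \<kappa>[of s r t] by (auto simp: coupling_nth mem_cluster_iff)
  next
    fix t s i j assume "i \<in> P s" "j \<in> P s" "(i, j) \<in> E"
    then show "((\<lambda>\<tau>. coupling (\<phi> \<tau>) $ i $ j) has_real_derivative
        - \<gamma> * coupling (\<phi> t) $ i $ j + \<mu>t * \<Gamma> (0 $ j - 0 $ i)) (at t)"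
      using \<gamma>_pos by (auto simp: coupling_nth mem_cluster_iff \<kappa>0_def)
  qed (auto simp: coupling_nth)
qed

text \<open>Each coupling solves a linear equation whose forcing depends only on the clusters of its
  end points, and bounded solutions on \<real> are unique. Hence all edges from one cluster to
  another share the coupling driven by the phases, and the phases form a full orbit.\<close>

lemma synchronous_bounded_solution:
  assumes sol: "err_solution UNIV e k \<phi>"
    and e: "\<And>t. e t = 0" and B: "\<And>t i j. \<bar>k t $ i $ j\<bar> \<le> B"
  shows "k t = coupling (\<phi> t)"
proof -
  have \<phi>: "((\<lambda>\<tau>. \<phi> \<tau> $ s) has_real_derivative
        w (sel s)
        + (\<Sum>r\<in>UNIV - {s}. \<Sum>j\<in>P r. adj E (sel s) j * k t $ sel s $ j * sin (\<phi> t $ r - \<phi> t $ s)))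
          (at t)" for t s
    using sol by (simp add: error_solution_def e)
  have nonedge: "k t $ i $ j = 0" if "(i, j) \<notin> E" for i j t
    using sol that by (simp add: error_solution_def)
  have inter: "((\<lambda>\<tau>. k \<tau> $ i $ j) has_real_derivative
      - \<gamma> * k t $ i $ j + \<nu> * \<Gamma> (\<phi> t $ cl j - \<phi> t $ cl i)) (at t)" if "cl i \<noteq> cl j" "(i, j) \<in> E" for i j t
    using sol that by (simp add: error_solution_def e mem_cluster_iff)
  have intra: "((\<lambda>\<tau>. k \<tau> $ i $ j) has_real_derivative - \<gamma> * k t $ i $ j + \<mu>t * \<Gamma> 0) (at t)"
    if "cl i = cl j" "(i, j) \<in> E" for i j t
    using sol that by (simp add: error_solution_def e mem_cluster_iff)
  have "continuous_on UNIV (\<lambda>t. \<phi> t $ s)" for s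
    using \<phi> by (intro DERIV_continuous_on) auto
  then have "continuous_on UNIV (\<lambda>t. \<chi> s. \<phi> t $ s)"
    by (rule continuous_on_vec_lambda)
  then have "continuous_on UNIV \<phi>" by simp
  then obtain \<kappa> where \<kappa>: "reduced.driven \<phi> \<kappa>"
    using reduced.driven_exists by blast
  have k_inter: "k t $ i $ j = \<kappa> t (cl i) (cl j)" if "cl i \<noteq> cl j" "(i, j) \<in> E" for i j t
  proof (rule bounded_solution_unique[OF \<gamma>_pos, where K = "\<lambda>t. k t $ i $ j"
        and L = "\<lambda>t. \<kappa> t (cl i) (cl j)" and f = "\<lambda>t. \<nu> * \<Gamma> (\<phi> t $ cl j - \<phi> t $ cl i)"])
    show "((\<lambda>\<tau>. k \<tau> $ i $ j) has_real_derivative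
      - \<gamma> * k t $ i $ j + \<nu> * \<Gamma> (\<phi> t $ cl j - \<phi> t $ cl i)) (at t)" for t
      by (rule inter[OF that])
    show "((\<lambda>t. \<kappa> t (cl i) (cl j)) has_real_derivative
      - \<gamma> * \<kappa> t (cl i) (cl j) + \<nu> * \<Gamma> (\<phi> t $ cl j - \<phi> t $ cl i)) (at t)" for t
      using \<kappa> unfolding reduced.driven_def by blast
  qed (rule B, rule reduced.driven_bound[OF \<kappa>])
  have k_intra: "k t $ i $ j = \<kappa>0" if "cl i = cl j" "(i, j) \<in> E" for i j t
  proof (rule bounded_solution_unique[OF \<gamma>_pos, where K = "\<lambda>t. k t $ i $ j"
        and L = "\<lambda>t. \<kappa>0" and f = "\<lambda>t. \<mu>t * \<Gamma> 0"])
    show "((\<lambda>\<tau>. k \<tau> $ i $ j) has_real_derivative - \<gamma> * k t $ i $ j + \<mu>t * \<Gamma> 0) (at t)" for t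
      by (rule intra[OF that])
    show "((\<lambda>t. \<kappa>0) has_real_derivative - \<gamma> * \<kappa>0 + \<mu>t * \<Gamma> 0) (at t)" for t
      using \<gamma>_pos by (simp add: \<kappa>0_def)
  qed (rule B, rule order_refl)
  have "reduced.full_orbit \<phi> \<kappa>"
    unfolding reduced.full_orbit_def
  proof (intro conjI allI \<kappa>)
    fix t s
    have "(\<Sum>j\<in>P r. adj E (sel s) j * k t $ sel s $ j * sin (\<phi> t $ r - \<phi> t $ s))
        = real (c s r) * \<kappa> t s r * sin (\<phi> t $ r - \<phi> t $ s)" if "r \<in> UNIV - {s}" for r
    proof -
      have "(\<Sum>j\<in>P r. adj E (sel s) j * k t $ sel s $ j * sin (\<phi> t $ r - \<phi> t $ s))
          = (\<Sum>j\<in>P r. adj E (sel s) j * (\<kappa> t s r * sin (\<phi> t $ r - \<phi> t $ s)))"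
        by (rule sum.cong) (use that k_inter in \<open>auto simp: adj_def mem_cluster_iff\<close>)
      then show ?thesis
        using degree[of s r "sel s"] that sel_in by (simp flip: sum_distrib_right)
    qed
    then have "reduced.rate (\<phi> t) (\<kappa> t) s = w (sel s)
        + (\<Sum>r\<in>UNIV - {s}. \<Sum>j\<in>P r. adj E (sel s) j * k t $ sel s $ j * sin (\<phi> t $ r - \<phi> t $ s))"
      unfolding reduced.rate_def by simp
    then show "((\<lambda>\<tau>. \<phi> \<tau> $ s) has_real_derivative reduced.rate (\<phi> t) (\<kappa> t) s) (at t)"
      using \<phi>[of s t] by simp
  qed
  then have "reduced.slaved_coupling (\<phi> t) = \<kappa> t"
    by (rule reduced.slaved_coupling_eq)
  then show ?thesis
    by (simp add: vec_eq_iff coupling_nth nonedge k_inter k_intra)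
qed

lemma invariant_toroidal_manifold_coupling:
  "toroidal_manifold (torus_graph coupling)"
  unfolding invariant_toroidal_manifold_def invariant_set_def
proof (intro conjI ballI allI impI)
  show "\<exists>u. torus_continuous u \<and> torus_graph coupling = torus_graph u"
    using torus_continuous_coupling by blast
  show "torus_graph coupling \<subseteq> state_space E sel"
    by (auto simp: torus_graph_def state_space_def coupling_nth)
next
  fix p assume "p \<in> torus_graph coupling"
  then obtain x where p: "p = (0, coupling x, torus_point x)" by (auto simp: torus_graph_def)
  obtain \<phi> where \<phi>: "reduced.slaved_orbit \<phi>" "\<phi> 0 = x"
    by (rule reduced.slaved_orbit_exists)
  show "\<exists>X\<in>trajectories UNIV. X 0 = p"
  proof
    show "(\<lambda>t. (0, coupling (\<phi> t), torus_point (\<phi> t))) \<in> trajectories UNIV"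
      unfolding error_trajectories_def using synchronous_solution[OF \<phi>(1)] by blast
  qed (simp add: \<phi>(2) p)
next
  fix X t
  assume "X \<in> trajectories UNIV" and X0: "X 0 \<in> torus_graph coupling"
  then obtain e k \<phi> where sol: "err_solution UNIV e k \<phi>"
    and X: "\<And>t. X t = (e t, k t, torus_point (\<phi> t))"
    unfolding error_trajectories_def by auto
  obtain x where x: "e 0 = 0" "k 0 = coupling x" "torus_point (\<phi> 0) = torus_point x"
    using X0 by (auto simp: X torus_graph_def)
  have k0: "k 0 = coupling (\<phi> 0)"
    using coupling_periodic[of "x - \<phi> 0" "\<phi> 0"] x by (simp add: torus_point_eq_iff)
  \<comment> \<open>Comparison with the orbit on the manifold through the same point; its couplings
    are bounded, as the uniqueness of network solutions requires.\<close>
  obtain \<psi> where \<psi>: "reduced.slaved_orbit \<psi>" "\<psi> 0 = \<phi> 0"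
    by (rule reduced.slaved_orbit_exists)
  note net = error_solution_network_solution[OF sol]
    error_solution_network_solution[OF synchronous_solution[OF \<psi>(1)]]
  have init: "(\<chi> i. (if i = sel (cl i) then 0 else e 0 $ i) + \<phi> 0 $ cl i)
      = (\<chi> i. (if i = sel (cl i) then 0 else 0 $ i) + \<psi> 0 $ cl i)" "k 0 = coupling (\<psi> 0)"
    by (simp_all add: x(1) k0 \<psi>(2) cong: if_cong)
  note k = network_solution_unique(2)[OF net coupling_bound init, of t]
    and \<theta> = network_solution_unique(1)[OF net coupling_bound init, of t]
  have \<phi>: "\<phi> t = \<psi> t"
  proof -
    have "\<phi> t $ s = \<psi> t $ s" for s
      using arg_cong[OF \<theta>, of "\<lambda>v. v $ sel s"] by simp
    then show ?thesis by (simp add: vec_eq_iff)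
  qed
  have "e t $ i = 0" for i
  proof (cases "i = sel (cl i)")
    case True
    then show ?thesis using sol unfolding error_solution_def by (metis UNIV_I)
  next
    case False
    then show ?thesis using arg_cong[OF \<theta>, of "\<lambda>v. v $ i"] by (simp add: \<phi>)
  qed
  then have "e t = 0" by (simp add: vec_eq_iff)
  then show "X t \<in> torus_graph coupling"
    by (auto simp: X k \<phi> torus_graph_def)
qed

text \<open>Through each point of \<open>M\<close> runs a trajectory on \<real> inside
  \<open>M\<close>. Its error vanishes, and its couplings are bounded since \<open>u\<close> has
  compact range, so they are the slaved ones.\<close>

lemma invariant_toroidal_manifold_unique:
  assumes "toroidal_manifold M"
  shows "M = torus_graph coupling"
proof -
  obtain u where u: "torus_continuous u" and M: "M = torus_graph u"
    and inv: "invariant_set (trajectories UNIV) M"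
    using assms by (auto simp: invariant_toroidal_manifold_def)
  obtain B where B: "\<And>x. norm (u x) \<le> B"
    using compact_imp_bounded[OF torus_continuous_compact_range[OF u]] by (auto simp: bounded_iff)
  have "u x = coupling x" for x
  proof -
    have "(0, u x, torus_point x) \<in> M" by (auto simp: M torus_graph_def)
    then obtain X where X_in: "X \<in> trajectories UNIV"
      and X0: "X 0 = (0, u x, torus_point x)" and XM: "\<And>t. X t \<in> M"
      using inv unfolding invariant_set_def by metis
    obtain e k \<phi> where sol: "err_solution UNIV e k \<phi>"
      and X: "\<And>t. X t = (e t, k t, torus_point (\<phi> t))"
      using X_in unfolding error_trajectories_def by auto
    have e: "e t = 0" and k: "k t \<in> range u" for t
      using XM[of t] by (auto simp: X M torus_graph_def)
    have "\<bar>k t $ i $ j\<bar> \<le> B" for t i j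
    proof -
      have "\<bar>k t $ i $ j\<bar> \<le> norm (k t $ i)" by (rule component_le_norm_cart)
      also have "\<dots> \<le> norm (k t)" by (rule Finite_Cartesian_Product.norm_nth_le)
      also have "\<dots> \<le> B" using k[of t] B by auto
      finally show ?thesis .
    qed
    from synchronous_bounded_solution[OF sol e this, of 0]
    have "u x = coupling (\<phi> 0)" using X0 by (simp add: X)
    also have "\<dots> = coupling x"
      using X0 coupling_periodic[of "x - \<phi> 0" "\<phi> 0"] by (simp add: X torus_point_eq_iff)
    finally show ?thesis .
  qed
  then show ?thesis by (simp add: M torus_graph_def)
qed

end

section \<open>The Lyapunov function of a pair of solutions\<close>

lemma am_gm:
  fixes a d x y :: real
  assumes "d > 0"
  shows "a * x * y \<le> d * x\<^sup>2 + a\<^sup>2 / (4 * d) * y\<^sup>2"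
proof -
  have "0 \<le> d * (x - a * y / (2 * d))\<^sup>2" using assms by simp
  also have "\<dots> = d * x\<^sup>2 + a\<^sup>2 / (4 * d) * y\<^sup>2 - a * x * y"
    using assms by (simp add: power2_eq_square field_simps)
  finally show ?thesis by simp
qed

text \<open>\<open>X\<close>, \<open>Y\<close>, \<open>Z\<close>, \<open>Q\<close> stand for the
  norms of the errors, of the inter- and intra-cluster coupling deviations and of the phase defect;
  the left-hand side will bound the derivative of the energy minus \<open>l\<close> times the
  squared defect. The constants are found before \<nu> is known, as the smallness of \<nu> is
  expressed through \<open>\<epsilon>\<close>.\<close>

lemma decay_constants:
  fixes b C \<gamma> :: real
  assumes pos: "b > 0" "C > 0" "\<gamma> > 0"
  obtains \<beta> K p l \<epsilon> where "\<beta> > 0" "K > 0" "p > 0" "l > 0" "\<epsilon> > 0"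
    "\<And>X Y Z Q \<nu> \<sigma> V. X \<ge> 0 \<Longrightarrow> Y \<ge> 0 \<Longrightarrow> Z \<ge> 0 \<Longrightarrow> Q \<ge> 0 \<Longrightarrow> 0 \<le> \<nu> \<Longrightarrow> \<nu> \<le> \<epsilon> \<Longrightarrow> \<sigma> \<le> \<epsilon> \<Longrightarrow>
      V \<le> C * X\<^sup>2 \<Longrightarrow>
      - 2 * b * X\<^sup>2 + C * X * (\<sigma> * X + Y) + K * (- 2 * \<gamma> * Y\<^sup>2 + C * \<nu> * Y * (X + Q))
        + p * (- 2 * \<gamma> * Z\<^sup>2 + C * X * Z) + l * (C * Q * (X + Y + \<nu> * Q))
      \<le> - \<beta> * (V + K * Y\<^sup>2 + p * Z\<^sup>2 - l * Q\<^sup>2)"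
proof -
  \<comment> \<open>Each constant serves one mixed term: \<open>\<beta>\<close> spends only part of
    the available decay, a large \<open>K\<close> lets the decay of \<open>Y\<close> absorb
    \<open>C * X * Y\<close>, a small \<open>p\<close> makes the forcing of \<open>Z\<close> by
    \<open>X\<close> harmless, and a small \<open>l\<close> limits \<open>Q * X\<close> and
    \<open>Q * Y\<close>. The only room for squares of \<open>Q\<close> is
    \<open>\<beta> * l * Q\<^sup>2\<close> on the right, so \<open>\<epsilon>\<close> comes last and
    depends on \<open>\<beta> * l\<close>.\<close>
  define \<beta> where "\<beta> = min (b / (4 * C)) (\<gamma> / 4)"
  define K where "K = 8 * C\<^sup>2 / (b * \<gamma>)"
  define p where "p = b * \<gamma> / (2 * C\<^sup>2)"
  define l where "l = min (b * \<beta> / (16 * C\<^sup>2)) (K * \<gamma> * \<beta> / (16 * C\<^sup>2))"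
  define \<epsilon> where "\<epsilon> = Min {b / (8 * C), b / (8 * K * C), \<gamma> / (8 * C), \<beta> * l / (4 * K * C), \<beta> / (8 * C)}"
  have \<beta>: "\<beta> > 0" "\<beta> \<le> b / (4 * C)" "\<beta> \<le> \<gamma> / 4"
    using pos unfolding \<beta>_def by auto
  have K: "K > 0" and p: "p > 0" using pos by (auto simp: K_def p_def)
  have l: "l > 0" "l \<le> b * \<beta> / (16 * C\<^sup>2)" "l \<le> K * \<gamma> * \<beta> / (16 * C\<^sup>2)"
    using pos \<beta> K unfolding l_def by auto
  have \<epsilon>: "\<epsilon> > 0" "\<epsilon> \<le> b / (8 * C)" "\<epsilon> \<le> b / (8 * K * C)" "\<epsilon> \<le> \<gamma> / (8 * C)"
      "\<epsilon> \<le> \<beta> * l / (4 * K * C)" "\<epsilon> \<le> \<beta> / (8 * C)"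
    using pos \<beta> K l unfolding \<epsilon>_def by auto
  show thesis
  proof (rule that[OF \<beta>(1) K p l(1) \<epsilon>(1)])
    fix X Y Z Q \<nu> \<sigma> V :: real
    assume nonneg: "X \<ge> 0" "Y \<ge> 0" "Z \<ge> 0" "Q \<ge> 0" and \<nu>: "0 \<le> \<nu>" "\<nu> \<le> \<epsilon>" and \<sigma>: "\<sigma> \<le> \<epsilon>"
      and V: "V \<le> C * X\<^sup>2"
    have 1: "C * \<sigma> * X\<^sup>2 \<le> b / 8 * X\<^sup>2"
    proof (rule mult_right_mono)
      have "\<sigma> \<le> b / (8 * C)" using \<sigma> \<epsilon> by linarith
      then show "C * \<sigma> \<le> b / 8" using pos by (simp add: field_simps)
    qed simp
    have 2: "C * X * Y \<le> b / 8 * X\<^sup>2 + K * \<gamma> / 4 * Y\<^sup>2"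
    proof -
      have "C\<^sup>2 / (4 * (b / 8)) = K * \<gamma> / 4" using pos by (simp add: K_def field_simps)
      then show ?thesis using am_gm[of "b / 8" C X Y] pos by (simp only: divide_pos_pos zero_less_numeral)
    qed
    \<comment> \<open>The possibly large \<open>K\<close> meets \<open>X * Y\<close> and
      \<open>Y * Q\<close> only together with \<nu>, and this product is small.\<close>
    define t where "t = K * C * \<nu>"
    have t: "t \<ge> 0" "t \<le> b / 8" "t \<le> K * \<gamma> / 8" "t \<le> \<beta> * l / 4"
    proof -
      show "t \<ge> 0" using K pos \<nu> by (simp add: t_def)
      have "\<nu> \<le> b / (8 * K * C)" "\<nu> \<le> \<gamma> / (8 * C)" "\<nu> \<le> \<beta> * l / (4 * K * C)"
        using \<nu> \<epsilon> by linarith+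
      then show "t \<le> b / 8" "t \<le> K * \<gamma> / 8" "t \<le> \<beta> * l / 4"
        using K pos by (simp_all add: t_def field_simps)
    qed
    have 3: "t * (X * Y) \<le> b / 16 * X\<^sup>2 + K * \<gamma> / 16 * Y\<^sup>2"
    proof -
      have "t * (X * Y) \<le> t * ((X\<^sup>2 + Y\<^sup>2) / 2)"
        using t sum_squares_bound[of X Y] by (intro mult_left_mono) auto
      moreover have "t * X\<^sup>2 \<le> b / 8 * X\<^sup>2" "t * Y\<^sup>2 \<le> K * \<gamma> / 8 * Y\<^sup>2"
        using t by (intro mult_right_mono; simp)+
      ultimately show ?thesis by (simp add: algebra_simps)
    qed
    have 4: "t * (Y * Q) \<le> K * \<gamma> / 16 * Y\<^sup>2 + \<beta> * l / 8 * Q\<^sup>2"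
    proof -
      have "t * (Y * Q) \<le> t * ((Y\<^sup>2 + Q\<^sup>2) / 2)"
        using t sum_squares_bound[of Y Q] by (intro mult_left_mono) auto
      moreover have "t * Y\<^sup>2 \<le> K * \<gamma> / 8 * Y\<^sup>2" "t * Q\<^sup>2 \<le> \<beta> * l / 4 * Q\<^sup>2"
        using t by (intro mult_right_mono; simp)+
      ultimately show ?thesis by (simp add: algebra_simps)
    qed
    have 5: "p * C * X * Z \<le> b / 8 * X\<^sup>2 + p * \<gamma> * Z\<^sup>2"
    proof -
      have "(p * C)\<^sup>2 / (4 * (b / 8)) = p * \<gamma>"
        using pos by (simp add: p_def field_simps power2_eq_square)
      then show ?thesis using am_gm[of "b / 8" "p * C" X Z] pos by (simp only: divide_pos_pos zero_less_numeral)
    qed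
    have l': "(l * C)\<^sup>2 / (4 * (\<beta> * l / 8)) = 2 * l * C\<^sup>2 / \<beta>"
      using \<beta> l by (simp add: field_simps power2_eq_square)
    have 6: "l * C * Q * X \<le> \<beta> * l / 8 * Q\<^sup>2 + b / 8 * X\<^sup>2"
    proof -
      have "2 * l * C\<^sup>2 / \<beta> \<le> b / 8" using l(2) \<beta> pos by (simp add: field_simps)
      then have "2 * l * C\<^sup>2 / \<beta> * X\<^sup>2 \<le> b / 8 * X\<^sup>2" by (rule mult_right_mono) simp
      then show ?thesis using am_gm[of "\<beta> * l / 8" "l * C" Q X] \<beta> l unfolding l' by simp
    qed
    have 7: "l * C * Q * Y \<le> \<beta> * l / 8 * Q\<^sup>2 + K * \<gamma> / 8 * Y\<^sup>2"
    proof -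
      have "2 * l * C\<^sup>2 / \<beta> \<le> K * \<gamma> / 8" using l(3) \<beta> pos by (simp add: field_simps)
      then have "2 * l * C\<^sup>2 / \<beta> * Y\<^sup>2 \<le> K * \<gamma> / 8 * Y\<^sup>2" by (rule mult_right_mono) simp
      then show ?thesis using am_gm[of "\<beta> * l / 8" "l * C" Q Y] \<beta> l unfolding l' by simp
    qed
    have 8: "l * C * \<nu> * Q\<^sup>2 \<le> \<beta> * l / 8 * Q\<^sup>2"
    proof (rule mult_right_mono)
      have "\<nu> \<le> \<beta> / (8 * C)" using \<nu> \<epsilon> by linarith
      then have "C * \<nu> \<le> \<beta> / 8" using pos by (simp add: field_simps)
      then have "l * (C * \<nu>) \<le> l * (\<beta> / 8)" using l by (intro mult_left_mono) auto
      then show "l * C * \<nu> \<le> \<beta> * l / 8" by (simp add: algebra_simps)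
    qed simp
    have 9: "\<beta> * V \<le> b / 4 * X\<^sup>2"
    proof -
      have "\<beta> * V \<le> \<beta> * (C * X\<^sup>2)" using V \<beta> by (intro mult_left_mono) auto
      also have "\<dots> = (\<beta> * C) * X\<^sup>2" by simp
      also have "\<dots> \<le> b / 4 * X\<^sup>2"
        using \<beta>(2) pos by (intro mult_right_mono) (auto simp: field_simps)
      finally show ?thesis .
    qed
    have 10: "\<beta> * (K * Y\<^sup>2) \<le> \<gamma> / 4 * (K * Y\<^sup>2)" "\<beta> * (p * Z\<^sup>2) \<le> \<gamma> / 4 * (p * Z\<^sup>2)"
      using \<beta>(3) K p by (intro mult_right_mono; simp)+
    have sq: "0 \<le> b * X\<^sup>2" "0 \<le> K * \<gamma> * Y\<^sup>2" "0 \<le> p * \<gamma> * Z\<^sup>2" "0 \<le> \<beta> * l * Q\<^sup>2"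
      using pos K p \<beta> l by auto
    have lhs: "- 2 * b * X\<^sup>2 + C * X * (\<sigma> * X + Y) + K * (- 2 * \<gamma> * Y\<^sup>2 + C * \<nu> * Y * (X + Q))
        + p * (- 2 * \<gamma> * Z\<^sup>2 + C * X * Z) + l * (C * Q * (X + Y + \<nu> * Q))
      = - 2 * (b * X\<^sup>2) + C * \<sigma> * X\<^sup>2 + C * X * Y - 2 * (K * \<gamma> * Y\<^sup>2) + t * (X * Y) + t * (Y * Q)
        - 2 * (p * \<gamma> * Z\<^sup>2) + p * C * X * Z + l * C * Q * X + l * C * Q * Y + l * C * \<nu> * Q\<^sup>2"
      by (simp add: t_def algebra_simps power2_eq_square)
    have rhs: "- \<beta> * (V + K * Y\<^sup>2 + p * Z\<^sup>2 - l * Q\<^sup>2)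
      = - (\<beta> * V) - \<beta> * (K * Y\<^sup>2) - \<beta> * (p * Z\<^sup>2) + \<beta> * l * Q\<^sup>2"
      by (simp add: algebra_simps)
    show "- 2 * b * X\<^sup>2 + C * X * (\<sigma> * X + Y) + K * (- 2 * \<gamma> * Y\<^sup>2 + C * \<nu> * Y * (X + Q))
        + p * (- 2 * \<gamma> * Z\<^sup>2 + C * X * Z) + l * (C * Q * (X + Y + \<nu> * Q))
      \<le> - \<beta> * (V + K * Y\<^sup>2 + p * Z\<^sup>2 - l * Q\<^sup>2)"
      unfolding lhs rhs using 1 2 3 4 5 6 7 8 9 10 sq by (simp add: algebra_simps)
  qed
qed

text \<open>Each \<open>d a\<close> is estimated by the full norm, which costs the number of
  indices. With rate 0 the bound also serves the phase defect.\<close>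

lemma sum_relaxation_bound:
  fixes d f :: "'a \<Rightarrow> real"
  assumes "finite A" and f: "\<And>a. a \<in> A \<Longrightarrow> \<bar>f a\<bar> \<le> F"
  shows "(\<Sum>a\<in>A. 2 * d a * (- \<gamma> * d a + f a)) \<le> - 2 * \<gamma> * (L2_set d A)\<^sup>2 + 2 * card A * L2_set d A * F"
proof -
  have "2 * d a * (- \<gamma> * d a + f a) \<le> - 2 * \<gamma> * (d a)\<^sup>2 + 2 * (L2_set d A * F)" if "a \<in> A" for a
  proof -
    have "(d a)\<^sup>2 \<le> (\<Sum>a\<in>A. (d a)\<^sup>2)"
      by (rule member_le_sum[OF that]) (use assms in auto)
    then have "\<bar>d a\<bar> \<le> L2_set d A"
      unfolding L2_set_def by (metis real_sqrt_abs real_sqrt_le_mono)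
    then have "\<bar>d a\<bar> * \<bar>f a\<bar> \<le> L2_set d A * F"
      using f[OF that] by (intro mult_mono) (auto simp: L2_set_nonneg)
    then have "d a * f a \<le> L2_set d A * F"
      by (metis abs_ge_self abs_mult order_trans)
    then show ?thesis by (simp add: algebra_simps power2_eq_square)
  qed
  then have "(\<Sum>a\<in>A. 2 * d a * (- \<gamma> * d a + f a)) \<le> (\<Sum>a\<in>A. - 2 * \<gamma> * (d a)\<^sup>2 + 2 * (L2_set d A * F))"
    by (rule sum_mono)
  also have "\<dots> = - 2 * \<gamma> * (\<Sum>a\<in>A. (d a)\<^sup>2) + 2 * card A * L2_set d A * F"
    by (simp add: sum.distrib sum_distrib_left sum_negf sum_subtractf)
  also have "(\<Sum>a\<in>A. (d a)\<^sup>2) = (L2_set d A)\<^sup>2"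
    by (simp add: L2_set_def sum_nonneg)
  finally show ?thesis .
qed

lemma bilinear_form_bound:
  fixes S :: "'a \<Rightarrow> 'a \<Rightarrow> real"
  assumes x: "\<And>i. i \<in> I \<Longrightarrow> \<bar>x i\<bar> \<le> X" and y: "\<And>i. i \<in> I \<Longrightarrow> \<bar>y i\<bar> \<le> Y"
  shows "(\<Sum>i\<in>I. \<Sum>j\<in>I. S i j * x i * y j) \<le> (\<Sum>i\<in>I. \<Sum>j\<in>I. \<bar>S i j\<bar>) * X * Y"
proof -
  have "S i j * x i * y j \<le> \<bar>S i j\<bar> * (X * Y)" if "i \<in> I" "j \<in> I" for i j
  proof -
    have "\<bar>x i\<bar> * \<bar>y j\<bar> \<le> X * Y" using x[OF that(1)] y[OF that(2)] by (intro mult_mono) auto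
    then have "\<bar>S i j\<bar> * (\<bar>x i\<bar> * \<bar>y j\<bar>) \<le> \<bar>S i j\<bar> * (X * Y)" by (rule mult_left_mono) simp
    then show ?thesis by (metis abs_ge_self abs_mult mult.assoc order_trans)
  qed
  then have "(\<Sum>i\<in>I. \<Sum>j\<in>I. S i j * x i * y j) \<le> (\<Sum>i\<in>I. \<Sum>j\<in>I. \<bar>S i j\<bar> * (X * Y))"
    by (intro sum_mono) auto
  then show ?thesis by (simp only: sum_distrib_right mult.assoc)
qed

lemma abs_sin_diff_le: "\<bar>sin x - x\<bar> \<le> x\<^sup>2 / 2" for x :: real
  using Maclaurin_sin_bound[of x 2]
  by (simp add: sin_coeff_def lessThan_nat_numeral numeral_2_eq_2 fact_numeral)

section \<open>Expansion of the velocities near the synchronous states\<close>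

context adaptive_network
begin

definition velocity :: "('n \<Rightarrow> real) \<Rightarrow> ('n \<Rightarrow> 'n \<Rightarrow> real) \<Rightarrow> 'n \<Rightarrow> real" where
  "velocity \<theta> k i = w i + (\<Sum>j\<in>UNIV. adj E i j * k i j * sin (\<theta> j - \<theta> i))"

definition cluster_velocity :: "('m \<Rightarrow> real) \<Rightarrow> ('m \<Rightarrow> 'm \<Rightarrow> real) \<Rightarrow> 'm \<Rightarrow> real" where
  "cluster_velocity \<phi> \<kappa> s = w (sel s) + (\<Sum>r\<in>UNIV - {s}. real (c s r) * \<kappa> s r * sin (\<phi> r - \<phi> s))"

definition nonselected :: "'n set" where
  "nonselected = {i. i \<noteq> sel (cl i)}"

text \<open>The matrices of all clusters, scaled by the resting coupling, as the diagonal blocks of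
  one matrix over the nonselected nodes; a single Lyapunov form then serves the whole
  network.\<close>

definition linearization :: "'n \<Rightarrow> 'n \<Rightarrow> real" where
  "linearization i z = (if cl i = cl z then \<kappa>0 * cluster_matrix E P sel (cl i) i z else 0)"

lemma velocity_synchronous:
  "velocity (\<lambda>i. \<phi> (cl i)) (\<lambda>i j. if cl i = cl j then \<kappa>0 else \<kappa> (cl i) (cl j)) i
    = cluster_velocity \<phi> \<kappa> (cl i)"
proof -
  have i: "i \<in> P (cl i)" by (simp add: mem_cluster_iff)
  have "(\<Sum>j\<in>P r. adj E i j * (if cl i = cl j then \<kappa>0 else \<kappa> (cl i) (cl j)) * sin (\<phi> (cl j) - \<phi> (cl i)))
      = (if r = cl i then 0 else real (c (cl i) r) * \<kappa> (cl i) r * sin (\<phi> r - \<phi> (cl i)))" for r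
  proof -
    have "(\<Sum>j\<in>P r. adj E i j * (if cl i = cl j then \<kappa>0 else \<kappa> (cl i) (cl j)) * sin (\<phi> (cl j) - \<phi> (cl i)))
        = (\<Sum>j\<in>P r. adj E i j * ((if cl i = r then \<kappa>0 else \<kappa> (cl i) r) * sin (\<phi> r - \<phi> (cl i))))"
      by (rule sum.cong) (auto simp: mem_cluster_iff)
    also have "\<dots> = (\<Sum>j\<in>P r. adj E i j) * ((if cl i = r then \<kappa>0 else \<kappa> (cl i) r) * sin (\<phi> r - \<phi> (cl i)))"
      by (simp only: sum_distrib_right)
    finally show ?thesis using degree[of "cl i" r i] i by auto
  qed
  note S = this
  have "w i = w (sel (cl i))" using w_eq[OF i sel_in] .
  moreover have "(\<Sum>j\<in>UNIV. adj E i j * (if cl i = cl j then \<kappa>0 else \<kappa> (cl i) (cl j)) * sin (\<phi> (cl j) - \<phi> (cl i)))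
      = (\<Sum>r\<in>UNIV - {cl i}. real (c (cl i) r) * \<kappa> (cl i) r * sin (\<phi> r - \<phi> (cl i)))"
    unfolding sum_clusters[OF partition, of _ "cl i"] S by (auto intro!: sum.cong)
  ultimately show ?thesis
    unfolding velocity_def cluster_velocity_def by simp
qed

text \<open>Inside a cluster, \<open>k * sin d - \<kappa>0 * d\<close> equals
  \<open>(k - \<kappa>0) * sin d + \<kappa>0 * (sin d - d)\<close>, which is of second order;
  between clusters the couplings are of order \<nu> up to the deviation \<open>Y\<close>. The errors
  carry two bounds: \<open>X\<close> for the linear dependence, and the confinement radius
  \<open>\<eta>\<close> as the small factor of the second-order terms.\<close>

lemma velocity_expansion:
  assumes \<theta>: "\<And>i. \<theta> i = e i + \<phi> (cl i)"
    and \<kappa>: "\<And>s r. \<bar>\<kappa> s r\<bar> \<le> \<nu> * \<delta> / \<gamma>" and \<nu>: "\<nu> \<ge> 0"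
    and e: "\<And>i. \<bar>e i\<bar> \<le> X" "\<And>i. \<bar>e i\<bar> \<le> \<eta>"
    and inter: "\<And>i j. (i, j) \<in> E \<Longrightarrow> cl i \<noteq> cl j \<Longrightarrow> \<bar>k i j - \<kappa> (cl i) (cl j)\<bar> \<le> Y"
    and intra: "\<And>i j. (i, j) \<in> E \<Longrightarrow> cl i = cl j \<Longrightarrow> \<bar>k i j - \<kappa>0\<bar> \<le> \<eta>"
    and Y: "Y \<ge> 0"
  shows "\<bar>velocity \<theta> k i - cluster_velocity \<phi> \<kappa> (cl i) - \<kappa>0 * (\<Sum>j\<in>P (cl i). adj E i j * (e j - e i))\<bar>
    \<le> CARD('n) * (((2 + 2 * \<bar>\<kappa>0\<bar>) * \<eta> + 2 * \<delta> / \<gamma> * \<nu>) * X + Y)"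
proof -
  have X: "X \<ge> 0" and \<eta>: "\<eta> \<ge> 0" using e[of undefined] by linarith+
  define B where "B = ((2 + 2 * \<bar>\<kappa>0\<bar>) * \<eta> + 2 * \<delta> / \<gamma> * \<nu>) * X + Y"
  have B1: "(2 + 2 * \<bar>\<kappa>0\<bar>) * \<eta> * X \<le> B" and B2: "Y + 2 * \<delta> / \<gamma> * \<nu> * X \<le> B" and B0: "0 \<le> B"
    unfolding B_def using X \<eta> Y \<nu> \<delta>_nonneg \<gamma>_pos by (auto simp: algebra_simps)
  define h where "h j = adj E i j * k i j * sin (\<theta> j - \<theta> i)
      - adj E i j * (if cl i = cl j then \<kappa>0 else \<kappa> (cl i) (cl j)) * sin (\<phi> (cl j) - \<phi> (cl i))
      - (if cl i = cl j then \<kappa>0 * (adj E i j * (e j - e i)) else 0)" for j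
  have "\<bar>h j\<bar> \<le> B" for j
  proof (cases "(i, j) \<in> E")
    case False
    then show ?thesis using B0 by (simp add: h_def adj_def)
  next
    case True
    define d where "d = e j - e i"
    have d: "\<bar>d\<bar> \<le> 2 * X" "\<bar>d\<bar> \<le> 2 * \<eta>"
      unfolding d_def using e(1)[of i] e(1)[of j] e(2)[of i] e(2)[of j] by linarith+
    show ?thesis
    proof (cases "cl i = cl j")
      case True
      have "\<bar>h j\<bar> = \<bar>(k i j - \<kappa>0) * sin d + \<kappa>0 * (sin d - d)\<bar>"
        using True \<open>(i, j) \<in> E\<close> by (simp add: h_def adj_def \<theta> d_def algebra_simps)
      also have "\<dots> \<le> \<bar>k i j - \<kappa>0\<bar> * \<bar>sin d\<bar> + \<bar>\<kappa>0\<bar> * \<bar>sin d - d\<bar>"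
        by (rule order_trans[OF abs_triangle_ineq]) (simp add: abs_mult)
      also have "\<dots> \<le> \<eta> * (2 * X) + \<bar>\<kappa>0\<bar> * (2 * \<eta> * X)"
      proof (intro add_mono mult_mono)
        show "\<bar>sin d\<bar> \<le> 2 * X" using abs_sin_x_le_abs_x[of d] d by linarith
        have "\<bar>d\<bar> * \<bar>d\<bar> \<le> (2 * \<eta>) * (2 * X)" using d \<eta> by (intro mult_mono) auto
        then have "d\<^sup>2 \<le> 4 * \<eta> * X" by (simp add: power2_eq_square)
        then show "\<bar>sin d - d\<bar> \<le> 2 * \<eta> * X" using abs_sin_diff_le[of d] by linarith
      qed (use intra[OF \<open>(i, j) \<in> E\<close> True] \<eta> X in auto)
      also have "\<dots> = (2 + 2 * \<bar>\<kappa>0\<bar>) * \<eta> * X" by (simp add: algebra_simps)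
      finally show ?thesis using B1 by linarith
    next
      case False
      define \<psi> where "\<psi> = \<phi> (cl j) - \<phi> (cl i)"
      have "\<bar>h j\<bar> = \<bar>(k i j - \<kappa> (cl i) (cl j)) * sin (d + \<psi>) + \<kappa> (cl i) (cl j) * (sin (d + \<psi>) - sin \<psi>)\<bar>"
        using False \<open>(i, j) \<in> E\<close> by (simp add: h_def adj_def \<theta> d_def \<psi>_def algebra_simps)
      also have "\<dots> \<le> \<bar>k i j - \<kappa> (cl i) (cl j)\<bar> * \<bar>sin (d + \<psi>)\<bar>
          + \<bar>\<kappa> (cl i) (cl j)\<bar> * \<bar>sin (d + \<psi>) - sin \<psi>\<bar>"
        by (rule order_trans[OF abs_triangle_ineq]) (simp add: abs_mult)
      also have "\<dots> \<le> Y * 1 + (\<nu> * \<delta> / \<gamma>) * (2 * X)"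
      proof (intro add_mono mult_mono)
        show "\<bar>sin (d + \<psi>) - sin \<psi>\<bar> \<le> 2 * X" using sin_lipschitz[of "d + \<psi>" \<psi>] d by simp
      qed (use inter[OF \<open>(i, j) \<in> E\<close> False] \<kappa> Y \<nu> \<delta>_nonneg \<gamma>_pos in auto)
      also have "\<dots> = Y + 2 * \<delta> / \<gamma> * \<nu> * X" by simp
      finally show ?thesis using B2 by linarith
    qed
  qed
  then have "\<bar>\<Sum>j\<in>UNIV. h j\<bar> \<le> (\<Sum>j\<in>(UNIV :: 'n set). B)"
    by (intro order_trans[OF sum_abs] sum_mono)
  moreover have "(\<Sum>j\<in>UNIV. h j)
      = velocity \<theta> k i - cluster_velocity \<phi> \<kappa> (cl i) - \<kappa>0 * (\<Sum>j\<in>P (cl i). adj E i j * (e j - e i))"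
  proof -
    have "P (cl i) = {j. cl i = cl j}" by (auto simp: mem_cluster_iff)
    then have "\<kappa>0 * (\<Sum>j\<in>P (cl i). adj E i j * (e j - e i))
        = (\<Sum>j\<in>UNIV. if cl i = cl j then \<kappa>0 * (adj E i j * (e j - e i)) else 0)"
      by (simp add: sum_distrib_left sum.If_cases)
    then show ?thesis
      unfolding velocity_synchronous[symmetric] h_def sum_subtractf velocity_def by simp
  qed
  ultimately show ?thesis by (simp add: B_def)
qed

text \<open>Since the error vanishes at the selected node, the sum may run over the whole cluster. A
  row of the cluster matrix then yields the coupling sum at \<open>i\<close> minus the one at the
  selected node.\<close>

lemma sum_linearization:
  assumes i: "i \<in> nonselected" and e: "\<And>s. e (sel s) = 0"
  shows "(\<Sum>z\<in>nonselected. linearization i z * e z)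
    = \<kappa>0 * (\<Sum>j\<in>P (cl i). adj E i j * (e j - e i))
      - \<kappa>0 * (\<Sum>j\<in>P (cl i). adj E (sel (cl i)) j * (e j - e (sel (cl i))))"
proof -
  let ?s = "cl i"
  have iP: "i \<in> P ?s" by (simp add: mem_cluster_iff)
  have "(\<Sum>z\<in>nonselected. linearization i z * e z)
      = (\<Sum>z\<in>P ?s. \<kappa>0 * cluster_matrix E P sel ?s i z * e z)"
  proof (rule sum.mono_neutral_cong)
    show "linearization i z * e z = \<kappa>0 * cluster_matrix E P sel ?s i z * e z"
      if "z \<in> nonselected \<inter> P ?s" for z
      using that by (simp add: linearization_def mem_cluster_iff)
    show "linearization i z * e z = 0" if "z \<in> nonselected - P ?s" for z
      using that by (auto simp: linearization_def mem_cluster_iff)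
    show "\<kappa>0 * cluster_matrix E P sel ?s i z * e z = 0" if "z \<in> P ?s - nonselected" for z
    proof -
      have "z = sel (cl z)" using that by (simp add: nonselected_def)
      then have "e z = 0" using e[of "cl z"] by simp
      then show ?thesis by simp
    qed
  qed auto
  also have "\<dots> = \<kappa>0 * (\<Sum>z\<in>P ?s. adj E i z * e z - adj E (sel ?s) z * e z
      - (if i = z then (\<Sum>j\<in>P ?s. adj E i j) * e i else 0))"
    unfolding sum_distrib_left by (rule sum.cong) (auto simp: cluster_matrix_def algebra_simps)
  also have "\<dots> = \<kappa>0 * ((\<Sum>z\<in>P ?s. adj E i z * e z) - (\<Sum>z\<in>P ?s. adj E (sel ?s) z * e z)
      - (\<Sum>j\<in>P ?s. adj E i j) * e i)"
    using iP by (simp add: sum_subtractf)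
  finally show ?thesis
    by (simp add: e algebra_simps sum_subtractf sum_distrib_left)
qed

abbreviation total_degree :: real where
  "total_degree \<equiv> (\<Sum>s\<in>UNIV. \<Sum>r\<in>UNIV. real (c s r))"

abbreviation node_const :: real where
  "node_const \<equiv> 3 + 3 * \<bar>\<kappa>0\<bar> + 2 * \<delta> / \<gamma>"

definition network_const :: real where
  "network_const = 2 * CARD('n) * (node_const)
     + 2 * total_degree * \<delta> / \<gamma> + 2 * \<delta> + 2 * \<bar>\<mu>t\<bar> * \<delta>"

lemma network_const_ge:
  "2 * CARD('n) * (node_const) \<le> network_const"
  "2 * total_degree * \<delta> / \<gamma> \<le> network_const"
  "2 * \<delta> \<le> network_const" "2 * \<bar>\<mu>t\<bar> * \<delta> \<le> network_const" "0 < network_const"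
proof -
  have 1: "0 < 2 * CARD('n) * (node_const)"
    using \<delta>_nonneg \<gamma>_pos by (intro mult_pos_pos add_pos_nonneg) auto
  have 2: "0 \<le> 2 * total_degree * \<delta> / \<gamma>"
    using \<delta>_nonneg \<gamma>_pos by (intro divide_nonneg_pos mult_nonneg_nonneg sum_nonneg) auto
  have 3: "0 \<le> 2 * \<delta>" "0 \<le> 2 * \<bar>\<mu>t\<bar> * \<delta>" using \<delta>_nonneg by auto
  show "2 * CARD('n) * (node_const) \<le> network_const"
    "2 * total_degree * \<delta> / \<gamma> \<le> network_const"
    "2 * \<delta> \<le> network_const" "2 * \<bar>\<mu>t\<bar> * \<delta> \<le> network_const" "0 < network_const"
    unfolding network_const_def using 1 2 3 by linarith+
qed

text \<open>The expansion is used at \<open>i\<close> and at the selected node of its cluster. Both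
  contain the same cluster velocity, which cancels.\<close>

lemma velocity_difference_linearization:
  assumes \<theta>: "\<And>i. \<theta> i = e i + \<phi> (cl i)" and sel0: "\<And>s. e (sel s) = 0"
    and \<kappa>: "\<And>s r. \<bar>\<kappa> s r\<bar> \<le> \<nu> * \<delta> / \<gamma>" and \<nu>: "\<nu> \<ge> 0"
    and e: "\<And>i. \<bar>e i\<bar> \<le> X" "\<And>i. \<bar>e i\<bar> \<le> \<eta>"
    and inter: "\<And>i j. (i, j) \<in> E \<Longrightarrow> cl i \<noteq> cl j \<Longrightarrow> \<bar>k i j - \<kappa> (cl i) (cl j)\<bar> \<le> Y"
    and intra: "\<And>i j. (i, j) \<in> E \<Longrightarrow> cl i = cl j \<Longrightarrow> \<bar>k i j - \<kappa>0\<bar> \<le> \<eta>"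
    and Y: "Y \<ge> 0" and i: "i \<in> nonselected"
  shows "\<bar>velocity \<theta> k i - velocity \<theta> k (sel (cl i)) - (\<Sum>z\<in>nonselected. linearization i z * e z)\<bar>
    \<le> network_const * ((\<eta> + \<nu>) * X + Y)"
proof -
  have X: "X \<ge> 0" and \<eta>: "\<eta> \<ge> 0" using e[of undefined] by linarith+
  have exp: "\<bar>velocity \<theta> k i - cluster_velocity \<phi> \<kappa> (cl i) - \<kappa>0 * (\<Sum>j\<in>P (cl i). adj E i j * (e j - e i))\<bar>
      \<le> CARD('n) * (((2 + 2 * \<bar>\<kappa>0\<bar>) * \<eta> + 2 * \<delta> / \<gamma> * \<nu>) * X + Y)" for i
    by (rule velocity_expansion) (fact \<theta> \<kappa> \<nu> e inter intra Y)+
  let ?B = "CARD('n) * (((2 + 2 * \<bar>\<kappa>0\<bar>) * \<eta> + 2 * \<delta> / \<gamma> * \<nu>) * X + Y)"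
  have "\<bar>velocity \<theta> k i - velocity \<theta> k (sel (cl i)) - (\<Sum>z\<in>nonselected. linearization i z * e z)\<bar> \<le> 2 * ?B"
    using exp[of i] exp[of "sel (cl i)"] unfolding sum_linearization[where e = e, OF i sel0] cl_sel by linarith
  also have "\<dots> \<le> 2 * (CARD('n) * ((node_const) * ((\<eta> + \<nu>) * X + Y)))"
  proof (intro mult_left_mono)
    have "((2 + 2 * \<bar>\<kappa>0\<bar>) * \<eta> + 2 * \<delta> / \<gamma> * \<nu>) * X \<le> ((node_const) * (\<eta> + \<nu>)) * X"
    proof (rule mult_right_mono[OF _ X])
      define D where "D = 2 * \<delta> / \<gamma>"
      have "0 \<le> D" using \<delta>_nonneg \<gamma>_pos by (simp add: D_def)
      then have "0 \<le> (1 + \<bar>\<kappa>0\<bar> + D) * \<eta> + (3 + 3 * \<bar>\<kappa>0\<bar>) * \<nu>" using \<eta> \<nu> by simp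
      then show "(2 + 2 * \<bar>\<kappa>0\<bar>) * \<eta> + 2 * \<delta> / \<gamma> * \<nu> \<le> (node_const) * (\<eta> + \<nu>)"
        unfolding D_def[symmetric] by (simp add: algebra_simps)
    qed
    moreover have "1 * Y \<le> (node_const) * Y"
    proof (intro mult_right_mono Y)
      have "0 \<le> 2 * \<delta> / \<gamma>" using \<delta>_nonneg \<gamma>_pos by simp
      then show "1 \<le> node_const" by linarith
    qed
    ultimately show "((2 + 2 * \<bar>\<kappa>0\<bar>) * \<eta> + 2 * \<delta> / \<gamma> * \<nu>) * X + Y
        \<le> (node_const) * ((\<eta> + \<nu>) * X + Y)"
      unfolding distrib_left[of _ "(\<eta> + \<nu>) * X"] by (simp add: mult.assoc)
  qed auto
  also have "\<dots> = 2 * CARD('n) * (node_const) * ((\<eta> + \<nu>) * X + Y)"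
    by simp
  also have "\<dots> \<le> network_const * ((\<eta> + \<nu>) * X + Y)"
    using X \<eta> \<nu> Y by (intro mult_right_mono network_const_ge) auto
  finally show ?thesis .
qed

text \<open>The frequencies cancel and the sines carry couplings of order \<nu>; this makes the
  growth rate of phase differences small.\<close>

lemma cluster_velocity_lipschitz:
  assumes \<kappa>: "\<And>s r. \<bar>\<kappa> s r\<bar> \<le> \<nu> * \<delta> / \<gamma>" and \<nu>: "\<nu> \<ge> 0" and Q: "\<And>s. \<bar>\<phi> s - \<psi> s\<bar> \<le> Q"
  shows "\<bar>cluster_velocity \<phi> \<kappa> s - cluster_velocity \<psi> \<kappa> s\<bar> \<le> network_const * (\<nu> * Q)"
proof -
  have Q0: "Q \<ge> 0" using Q[of undefined] by linarith
  have "\<bar>real (c s r) * \<kappa> s r * sin (\<phi> r - \<phi> s) - real (c s r) * \<kappa> s r * sin (\<psi> r - \<psi> s)\<bar>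
      \<le> real (c s r) * (\<nu> * \<delta> / \<gamma> * (2 * Q))" for r
  proof -
    have "\<bar>sin (\<phi> r - \<phi> s) - sin (\<psi> r - \<psi> s)\<bar> \<le> 2 * Q"
      using sin_lipschitz[of "\<phi> r - \<phi> s" "\<psi> r - \<psi> s"] Q[of s] Q[of r] by linarith
    then have "\<bar>\<kappa> s r\<bar> * \<bar>sin (\<phi> r - \<phi> s) - sin (\<psi> r - \<psi> s)\<bar> \<le> \<nu> * \<delta> / \<gamma> * (2 * Q)"
      using \<kappa>[of s r] by (intro mult_mono) (auto intro: order_trans[OF abs_ge_zero])
    then have "real (c s r) * (\<bar>\<kappa> s r\<bar> * \<bar>sin (\<phi> r - \<phi> s) - sin (\<psi> r - \<psi> s)\<bar>)
        \<le> real (c s r) * (\<nu> * \<delta> / \<gamma> * (2 * Q))" by (rule mult_left_mono) simp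
    moreover have "\<bar>real (c s r) * \<kappa> s r * sin (\<phi> r - \<phi> s) - real (c s r) * \<kappa> s r * sin (\<psi> r - \<psi> s)\<bar>
        = real (c s r) * (\<bar>\<kappa> s r\<bar> * \<bar>sin (\<phi> r - \<phi> s) - sin (\<psi> r - \<psi> s)\<bar>)"
      by (simp add: abs_mult flip: right_diff_distrib)
    ultimately show ?thesis by simp
  qed
  then have "\<bar>cluster_velocity \<phi> \<kappa> s - cluster_velocity \<psi> \<kappa> s\<bar>
      \<le> (\<Sum>r\<in>UNIV - {s}. real (c s r) * (\<nu> * \<delta> / \<gamma> * (2 * Q)))"
    unfolding cluster_velocity_def add_diff_cancel_left sum_subtractf[symmetric]
    by (intro order_trans[OF sum_abs] sum_mono) auto
  also have "\<dots> = (\<Sum>r\<in>UNIV - {s}. real (c s r)) * (\<nu> * \<delta> / \<gamma> * (2 * Q))"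
    by (simp only: sum_distrib_right)
  also have "\<dots> \<le> total_degree * (\<nu> * \<delta> / \<gamma> * (2 * Q))"
  proof (rule mult_right_mono)
    have "(\<Sum>r\<in>UNIV - {s}. real (c s r)) \<le> (\<Sum>r\<in>UNIV. real (c s r))"
      by (rule sum_mono2) auto
    also have "\<dots> \<le> total_degree"
      by (rule member_le_sum[of s]) (auto intro: sum_nonneg)
    finally show "(\<Sum>r\<in>UNIV - {s}. real (c s r)) \<le> total_degree" .
  qed (use \<nu> Q0 \<delta>_nonneg \<gamma>_pos in auto)
  also have "\<dots> = 2 * total_degree * \<delta> / \<gamma> * (\<nu> * Q)" by simp
  also have "\<dots> \<le> network_const * (\<nu> * Q)"
    using \<nu> Q0 by (intro mult_right_mono network_const_ge) auto
  finally show ?thesis .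
qed

text \<open>Three effects separate the node from the comparison orbit: errors of its neighbours,
  deviations of its inter-cluster couplings, and the phase difference, the last one only with the
  factor \<nu>.\<close>

lemma selected_velocity_difference:
  assumes \<theta>: "\<And>i. \<theta> i = e i + \<phi> (cl i)" and sel0: "\<And>s. e (sel s) = 0"
    and \<kappa>: "\<And>s r. \<bar>\<kappa> s r\<bar> \<le> \<nu> * \<delta> / \<gamma>" and \<nu>: "\<nu> \<ge> 0" "\<nu> \<le> 1" and \<eta>1: "\<eta> \<le> 1"
    and e: "\<And>i. \<bar>e i\<bar> \<le> X" "\<And>i. \<bar>e i\<bar> \<le> \<eta>"
    and inter: "\<And>i j. (i, j) \<in> E \<Longrightarrow> cl i \<noteq> cl j \<Longrightarrow> \<bar>k i j - \<kappa> (cl i) (cl j)\<bar> \<le> Y"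
    and intra: "\<And>i j. (i, j) \<in> E \<Longrightarrow> cl i = cl j \<Longrightarrow> \<bar>k i j - \<kappa>0\<bar> \<le> \<eta>"
    and Y: "Y \<ge> 0" and Q: "\<And>s. \<bar>\<phi> s - \<psi> s\<bar> \<le> Q"
  shows "\<bar>velocity \<theta> k (sel s) - cluster_velocity \<psi> \<kappa> s\<bar> \<le> network_const * (X + Y + \<nu> * Q)"
proof -
  have X: "X \<ge> 0" and \<eta>: "\<eta> \<ge> 0" using e[of undefined] by linarith+
  let ?L = "\<Sum>j\<in>P s. adj E (sel s) j * (e j - e (sel s))"
  have "\<bar>?L\<bar> \<le> CARD('n) * X"
  proof -
    have "\<bar>?L\<bar> \<le> (\<Sum>j\<in>P s. X)"
      by (intro order_trans[OF sum_abs] sum_mono) (use e X in \<open>auto simp: adj_def sel0\<close>)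
    also have "\<dots> \<le> CARD('n) * X" using X by (auto intro!: mult_right_mono card_mono)
    finally show ?thesis .
  qed
  then have L: "\<bar>\<kappa>0 * ?L\<bar> \<le> \<bar>\<kappa>0\<bar> * (CARD('n) * X)"
    unfolding abs_mult by (rule mult_left_mono) simp
  have "((2 + 2 * \<bar>\<kappa>0\<bar>) * \<eta> + 2 * \<delta> / \<gamma> * \<nu>) * X \<le> ((2 + 2 * \<bar>\<kappa>0\<bar>) * 1 + 2 * \<delta> / \<gamma> * 1) * X"
    using \<eta>1 \<nu> X \<delta>_nonneg \<gamma>_pos by (intro mult_right_mono add_mono mult_left_mono) auto
  then have coeff: "CARD('n) * (((2 + 2 * \<bar>\<kappa>0\<bar>) * \<eta> + 2 * \<delta> / \<gamma> * \<nu>) * X + Y)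
      \<le> CARD('n) * ((2 + 2 * \<bar>\<kappa>0\<bar> + 2 * \<delta> / \<gamma>) * X + Y)"
    by (intro mult_left_mono) auto
  have expansion: "\<bar>velocity \<theta> k (sel s) - cluster_velocity \<phi> \<kappa> s - \<kappa>0 * ?L\<bar>
      \<le> CARD('n) * (((2 + 2 * \<bar>\<kappa>0\<bar>) * \<eta> + 2 * \<delta> / \<gamma> * \<nu>) * X + Y)"
  proof -
    have "\<bar>velocity \<theta> k i - cluster_velocity \<phi> \<kappa> (cl i) - \<kappa>0 * (\<Sum>j\<in>P (cl i). adj E i j * (e j - e i))\<bar>
      \<le> CARD('n) * (((2 + 2 * \<bar>\<kappa>0\<bar>) * \<eta> + 2 * \<delta> / \<gamma> * \<nu>) * X + Y)" for i
      by (rule velocity_expansion) (fact \<theta> \<kappa> \<nu> e inter intra Y)+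
    from this[of "sel s"] show ?thesis by (simp only: cl_sel)
  qed
  have "\<bar>velocity \<theta> k (sel s) - cluster_velocity \<phi> \<kappa> s\<bar>
      \<le> \<bar>velocity \<theta> k (sel s) - cluster_velocity \<phi> \<kappa> s - \<kappa>0 * ?L\<bar> + \<bar>\<kappa>0 * ?L\<bar>"
    using abs_triangle_ineq[of "velocity \<theta> k (sel s) - cluster_velocity \<phi> \<kappa> s - \<kappa>0 * ?L" "\<kappa>0 * ?L"]
    by (simp only: diff_add_cancel)
  also have "\<dots> \<le> CARD('n) * ((2 + 2 * \<bar>\<kappa>0\<bar> + 2 * \<delta> / \<gamma>) * X + Y) + \<bar>\<kappa>0\<bar> * (CARD('n) * X)"
    by (rule add_mono[OF order_trans[OF expansion coeff] L])
  also have "\<dots> = CARD('n) * ((2 + 3 * \<bar>\<kappa>0\<bar> + 2 * \<delta> / \<gamma>) * X + 1 * Y)"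
    by (simp add: algebra_simps)
  also have "\<dots> \<le> CARD('n) * ((node_const) * X + (node_const) * Y)"
  proof (intro mult_left_mono add_mono mult_right_mono X Y)
    have "0 \<le> 2 * \<delta> / \<gamma>" using \<delta>_nonneg \<gamma>_pos by simp
    then show "1 \<le> node_const" by linarith
  qed auto
  also have "\<dots> = CARD('n) * (node_const) * (X + Y)"
    by (simp only: distrib_left[symmetric] mult.assoc)
  also have "\<dots> \<le> network_const * (X + Y)"
  proof (rule mult_right_mono)
    define B where "B = CARD('n) * (node_const)"
    have "0 \<le> B"
      unfolding B_def using \<delta>_nonneg \<gamma>_pos by (intro mult_nonneg_nonneg add_nonneg_nonneg) auto
    moreover have "2 * B \<le> network_const"
      using network_const_ge(1) by (simp only: B_def of_nat_mult of_nat_numeral mult.assoc)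
    ultimately have "B \<le> network_const" by linarith
    then show "CARD('n) * (node_const) \<le> network_const"
      by (simp only: B_def)
  qed (use X Y in auto)
  finally have "\<bar>velocity \<theta> k (sel s) - cluster_velocity \<phi> \<kappa> s\<bar> \<le> network_const * (X + Y)" .
  moreover have "\<bar>cluster_velocity \<phi> \<kappa> s - cluster_velocity \<psi> \<kappa> s\<bar> \<le> network_const * (\<nu> * Q)"
    by (rule cluster_velocity_lipschitz) (fact \<kappa> \<nu> Q)+
  ultimately show ?thesis unfolding distrib_left[of network_const "X + Y"] by linarith
qed

definition inter_edges :: "('n \<times> 'n) set" where
  "inter_edges = {(i, j). (i, j) \<in> E \<and> cl i \<noteq> cl j}"

definition intra_edges :: "('n \<times> 'n) set" where
  "intra_edges = {(i, j). (i, j) \<in> E \<and> cl i = cl j}"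

end

section \<open>Stability of the invariant toroidal manifold\<close>

text \<open>The linearization is block diagonal, so an eigenvector that is nonzero at
  \<open>i0\<close> restricts to one of the block of its cluster. The block is
  \<open>\<kappa>0\<close> times the cluster matrix, and \<open>\<kappa>0\<close> has the sign of
  \<open>\<Gamma> 0\<close>; hence the sign in the hypothesis.\<close>

lemma (in adaptive_network) linearization_stable:
  assumes \<mu>t: "\<mu>t > 0"
    and A4: "\<And>s l. eigenvalue_on (P s - {sel s}) (cluster_matrix E P sel s) l \<Longrightarrow> sgn (\<Gamma> 0) * Re l < 0"
    and l: "eigenvalue_on nonselected linearization l"
  shows "Re l < 0"
proof -
  obtain v i0 where i0: "i0 \<in> nonselected" "v i0 \<noteq> 0"
    and v: "\<And>i. i \<in> nonselected \<Longrightarrow> (\<Sum>z\<in>nonselected. complex_of_real (linearization i z) * v z) = l * v i"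
    using l unfolding eigenvalue_on_def by blast
  define s where "s = cl i0"
  define I where "I = P s - {sel s}"
  have I_iff: "i \<in> I \<longleftrightarrow> i \<in> nonselected \<and> cl i = s" for i
    by (auto simp: I_def nonselected_def mem_cluster_iff)
  have block: "(\<Sum>z\<in>I. complex_of_real (\<kappa>0 * cluster_matrix E P sel s i z) * v z) = l * v i" if "i \<in> I" for i
  proof -
    have i: "i \<in> nonselected" "cl i = s" using that I_iff by auto
    have "(\<Sum>z\<in>nonselected. complex_of_real (linearization i z) * v z)
        = (\<Sum>z\<in>I. complex_of_real (\<kappa>0 * cluster_matrix E P sel s i z) * v z)"
    proof (rule sum.mono_neutral_cong_right)
      show "I \<subseteq> nonselected" using I_iff by blast
      show "\<forall>z\<in>nonselected - I. complex_of_real (linearization i z) * v z = 0"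
      proof
        fix z assume "z \<in> nonselected - I"
        then have "cl z \<noteq> s" using I_iff[of z] by blast
        then show "complex_of_real (linearization i z) * v z = 0"
          using i(2) by (simp add: linearization_def)
      qed
      show "complex_of_real (linearization i z) * v z
          = complex_of_real (\<kappa>0 * cluster_matrix E P sel s i z) * v z" if "z \<in> I" for z
        using i(2) that I_iff[of z] by (simp add: linearization_def)
    qed simp
    then show ?thesis using v[OF i(1)] by simp
  qed
  show ?thesis
  proof (cases "\<Gamma> 0 = 0")
    \<comment> \<open>In this case the hypothesis excludes all eigenvalues, so that every cluster is a singleton.\<close>
    case True
    obtain n :: nat and p q T where
      qA: "\<And>a d. a < n \<Longrightarrow> d \<in> I \<Longrightarrow>
         (\<Sum>i\<in>I. q a i * complex_of_real (cluster_matrix E P sel s i d)) = (\<Sum>b<n. T a b * q b d)"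
      and pq: "\<And>i j. i \<in> I \<Longrightarrow> j \<in> I \<Longrightarrow> (\<Sum>a<n. p i a * q a j) = (if i = j then 1 else (0::complex))"
      and tri: "\<And>a b. a < n \<Longrightarrow> b < a \<Longrightarrow> T a b = 0"
      and eig: "\<And>a. a < n \<Longrightarrow> eigenvalue_on I (cluster_matrix E P sel s) (T a a)"
      by (rule triangular_coordinates[of I "cluster_matrix E P sel s"]) (simp, rule that, assumption+)
    have "n \<noteq> 0"
    proof
      assume "n = 0"
      then show False using pq[of i0 i0] i0 I_iff by (auto simp: s_def)
    qed
    then show ?thesis using A4[OF eig[of 0, unfolded I_def]] True by simp
  next
    case False
    then have \<kappa>0: "\<kappa>0 \<noteq> 0" and sgn: "sgn (\<Gamma> 0) = sgn \<kappa>0"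
      using \<mu>t \<gamma>_pos by (auto simp: \<kappa>0_def sgn_mult sgn_divide)
    have "eigenvalue_on I (cluster_matrix E P sel s) (l / complex_of_real \<kappa>0)"
      unfolding eigenvalue_on_def
    proof (intro exI[of _ v] conjI ballI)
      show "\<exists>i\<in>I. v i \<noteq> 0" using i0 I_iff by (auto simp: s_def)
      fix i assume "i \<in> I"
      from block[OF this] have "complex_of_real \<kappa>0 * (\<Sum>z\<in>I. complex_of_real (cluster_matrix E P sel s i z) * v z) = l * v i"
        by (simp add: sum_distrib_left mult.assoc)
      then show "(\<Sum>z\<in>I. complex_of_real (cluster_matrix E P sel s i z) * v z) = l / complex_of_real \<kappa>0 * v i"
        using \<kappa>0 by (simp add: field_simps)
    qed
    then have "sgn \<kappa>0 * Re (l / complex_of_real \<kappa>0) < 0"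
      using A4 unfolding I_def sgn by blast
    then have "Re l * (sgn \<kappa>0 / \<kappa>0) < 0" by (simp add: mult.commute)
    moreover have "sgn \<kappa>0 / \<kappa>0 > 0" using \<kappa>0 by (cases "\<kappa>0 > 0") (auto simp: sgn_if)
    ultimately show ?thesis by (metis mult_less_0_iff less_asym)
  qed
qed

section \<open>The quadratic form and the decay of the energy\<close>

locale lyapunov_network = adaptive_network E P sel w c \<gamma> \<mu>t \<delta> \<Gamma>
  for E :: "('n::finite \<times> 'n) set" and P :: "'m::finite \<Rightarrow> 'n set" and sel w c \<gamma> \<mu>t \<delta> \<Gamma> +
  fixes S :: "'n \<Rightarrow> 'n \<Rightarrow> real" and b m :: real
  assumes S_sym: "S i j = S j i" and b_pos: "b > 0" and m_pos: "m > 0"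
    and S_lower: "m * (\<Sum>i\<in>nonselected. (x i)\<^sup>2) \<le> (\<Sum>i\<in>nonselected. \<Sum>j\<in>nonselected. S i j * x i * x j)"
    and S_linearization: "(\<Sum>i\<in>nonselected. \<Sum>j\<in>nonselected. S i j * x i *
      (\<Sum>z\<in>nonselected. linearization j z * x z)) \<le> - b * (\<Sum>i\<in>nonselected. (x i)\<^sup>2)"
begin

definition form :: "('n \<Rightarrow> real) \<Rightarrow> real" where
  "form x = (\<Sum>i\<in>nonselected. \<Sum>j\<in>nonselected. S i j * x i * x j)"

definition form_norm :: real where
  "form_norm = (\<Sum>i\<in>nonselected. \<Sum>j\<in>nonselected. \<bar>S i j\<bar>)"

definition lyapunov_const :: real where
  "lyapunov_const = 2 * network_const *
     (form_norm + card inter_edges + card intra_edges + CARD('m)) + form_norm"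

lemma form_norm_nonneg: "0 \<le> form_norm"
  by (simp add: form_norm_def sum_nonneg)

lemma lyapunov_const_ge:
  "2 * form_norm * network_const \<le> lyapunov_const" "2 * card inter_edges * network_const \<le> lyapunov_const"
  "2 * card intra_edges * network_const \<le> lyapunov_const" "2 * CARD('m) * network_const \<le> lyapunov_const"
  "form_norm \<le> lyapunov_const" "0 < lyapunov_const"
proof -
  let ?n = network_const
  have eq: "lyapunov_const = 2 * form_norm * ?n + 2 * card inter_edges * ?n + 2 * card intra_edges * ?n
      + 2 * CARD('m) * ?n + form_norm"
    by (simp add: lyapunov_const_def algebra_simps)
  have nonneg: "0 \<le> 2 * form_norm * ?n" "0 \<le> 2 * card inter_edges * ?n" "0 \<le> 2 * card intra_edges * ?n"
      "0 < 2 * CARD('m) * ?n"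
    using form_norm_nonneg network_const_ge(5) by auto
  show "2 * form_norm * ?n \<le> lyapunov_const" "2 * card inter_edges * ?n \<le> lyapunov_const"
    "2 * card intra_edges * ?n \<le> lyapunov_const" "2 * CARD('m) * ?n \<le> lyapunov_const"
    "form_norm \<le> lyapunov_const" "0 < lyapunov_const"
    unfolding eq using nonneg form_norm_nonneg by linarith+
qed

lemma form_lower: "m * (\<Sum>i\<in>nonselected. (x i)\<^sup>2) \<le> form x"
  unfolding form_def by (rule S_lower)

lemma form_nonneg: "0 \<le> form x"
  by (rule order_trans[OF _ form_lower]) (use m_pos in \<open>simp add: sum_nonneg\<close>)

lemma form_upper:
  assumes "\<And>i. i \<in> nonselected \<Longrightarrow> \<bar>x i\<bar> \<le> X"
  shows "form x \<le> form_norm * X\<^sup>2"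
  unfolding form_def form_norm_def power2_eq_square mult.assoc[symmetric]
  by (rule bilinear_form_bound) (use assms in auto)

lemma form_derivative:
  assumes "\<And>i. i \<in> nonselected \<Longrightarrow> ((\<lambda>\<tau>. x \<tau> i) has_real_derivative x' i) (at t)"
  shows "((\<lambda>\<tau>. form (x \<tau>)) has_real_derivative
    2 * (\<Sum>i\<in>nonselected. \<Sum>j\<in>nonselected. S i j * x t i * x' j)) (at t)"
proof -
  have "((\<lambda>\<tau>. form (x \<tau>)) has_real_derivative
      (\<Sum>i\<in>nonselected. \<Sum>j\<in>nonselected. S i j * x t i * x' j + S i j * x' i * x t j)) (at t)"
    unfolding form_def
  proof (rule DERIV_sum, rule DERIV_sum)
    fix i j assume "i \<in> nonselected" "j \<in> nonselected"
    then show "((\<lambda>\<tau>. S i j * x \<tau> i * x \<tau> j) has_real_derivative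
        S i j * x t i * x' j + S i j * x' i * x t j) (at t)"
      by (auto intro!: derivative_eq_intros assms simp: algebra_simps)
  qed
  moreover have "(\<Sum>i\<in>nonselected. \<Sum>j\<in>nonselected. S i j * x' i * x t j)
      = (\<Sum>i\<in>nonselected. \<Sum>j\<in>nonselected. S i j * x t i * x' j)"
    by (subst sum.swap) (intro sum.cong refl, simp add: S_sym mult_ac)
  ultimately show ?thesis by (simp add: sum.distrib)
qed

end

text \<open>The constants are parameters because they are shared by all small \<nu>; in the
  inequality \<nu> stays universally quantified.\<close>

locale decaying_network = lyapunov_network E P sel w c \<gamma> \<mu>t \<delta> \<Gamma> S b m
  for E :: "('n::finite \<times> 'n) set" and P :: "'m::finite \<Rightarrow> 'n set" and sel w c \<gamma> \<mu>t \<delta> \<Gamma> S b m +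
  fixes \<beta> K p l \<epsilon> :: real
  assumes \<beta>_pos: "\<beta> > 0" and K_pos: "K > 0" and p_pos: "p > 0" and l_pos: "l > 0" and \<epsilon>_pos: "\<epsilon> > 0"
    and decay: "X \<ge> 0 \<Longrightarrow> Y \<ge> 0 \<Longrightarrow> Z \<ge> 0 \<Longrightarrow> Q \<ge> 0 \<Longrightarrow> 0 \<le> \<nu> \<Longrightarrow> \<nu> \<le> \<epsilon> \<Longrightarrow> \<sigma> \<le> \<epsilon> \<Longrightarrow>
      V \<le> lyapunov_const * X\<^sup>2 \<Longrightarrow>
      - 2 * b * X\<^sup>2 + lyapunov_const * X * (\<sigma> * X + Y)
        + K * (- 2 * \<gamma> * Y\<^sup>2 + lyapunov_const * \<nu> * Y * (X + Q))
        + p * (- 2 * \<gamma> * Z\<^sup>2 + lyapunov_const * X * Z) + l * (lyapunov_const * Q * (X + Y + \<nu> * Q))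
      \<le> - \<beta> * (V + K * Y\<^sup>2 + p * Z\<^sup>2 - l * Q\<^sup>2)"

text \<open>As the confinement radius is at most \<open>\<epsilon> / 2\<close>, the condition
  \<open>2 * \<nu> \<le> \<epsilon>\<close> keeps radius plus \<nu> within
  \<open>\<epsilon>\<close>. The slope condition makes a change of the base phase of the coupling
  deviations cost at most \<open>l\<close> times the defect.\<close>

locale slow_decaying_network =
  decaying_network E P sel w c \<gamma> \<mu>t \<delta> \<Gamma> S b m \<beta> K p l \<epsilon> + slow_adaptive_network E P sel w c \<gamma> \<mu>t \<delta> \<Gamma> \<nu>
  for E :: "('n::finite \<times> 'n) set" and P :: "'m::finite \<Rightarrow> 'n set" and sel w c \<gamma> \<mu>t \<delta> \<Gamma> S b m \<beta> K p l \<epsilon> \<nu> +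
  assumes \<nu>_le: "2 * \<nu> \<le> \<epsilon>" "\<nu> \<le> 1"
    and coupling_slope: "2 * K * card inter_edges * (8 * \<nu> * \<delta> / \<gamma>)\<^sup>2 \<le> l"
begin

definition err :: "real^'n \<Rightarrow> 'n \<Rightarrow> real" where
  "err \<theta> i = \<theta> $ i - \<theta> $ sel (cl i)"

definition phase :: "real^'n \<Rightarrow> real^'m" where
  "phase \<theta> = (\<chi> s. \<theta> $ sel s)"

text \<open>The base phase \<open>x\<close> is kept apart from the state: it is the phase of the
  comparison orbit or of the solution itself, depending on the use.\<close>

definition inter_dev :: "real^'n^'n \<Rightarrow> real^'m \<Rightarrow> 'n \<times> 'n \<Rightarrow> real" where
  "inter_dev k x a = k $ fst a $ snd a - reduced.slaved_coupling x (cl (fst a)) (cl (snd a))"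

definition intra_dev :: "real^'n^'n \<Rightarrow> 'n \<times> 'n \<Rightarrow> real" where
  "intra_dev k a = k $ fst a $ snd a - \<kappa>0"

definition energy :: "real^'n \<Rightarrow> real^'n^'n \<Rightarrow> real^'m \<Rightarrow> real" where
  "energy \<theta> k x = form (err \<theta>) + K * (\<Sum>a\<in>inter_edges. (inter_dev k x a)\<^sup>2)
     + p * (\<Sum>a\<in>intra_edges. (intra_dev k a)\<^sup>2)"

definition defect :: "real^'n \<Rightarrow> real^'m \<Rightarrow> real" where
  "defect \<theta> x = (\<Sum>s\<in>UNIV. (\<theta> $ sel s - x $ s)\<^sup>2)"

text \<open>Half of \<open>\<epsilon>\<close> is left for \<nu>; the bound 1 serves the crude
  estimate of the velocities at the selected nodes.\<close>

definition radius :: real where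
  "radius = min (\<epsilon> / 2) 1"

lemma radius: "0 < radius" "radius \<le> \<epsilon> / 2" "radius \<le> 1"
  using \<epsilon>_pos by (auto simp: radius_def)

definition confined :: "real^'n \<Rightarrow> real^'n^'n \<Rightarrow> bool" where
  "confined \<theta> k \<longleftrightarrow> (\<forall>i. \<bar>err \<theta> i\<bar> \<le> radius) \<and> (\<forall>a\<in>intra_edges. \<bar>intra_dev k a\<bar> \<le> radius)"

lemma sum_L2: "(\<Sum>a\<in>A. (f a)\<^sup>2) = (L2_set f A)\<^sup>2"
  by (simp add: L2_set_def sum_nonneg)

lemma abs_le_L2:
  assumes "finite A" "a \<in> A"
  shows "\<bar>f a\<bar> \<le> L2_set f A"
proof -
  have "(f a)\<^sup>2 \<le> (\<Sum>a\<in>A. (f a)\<^sup>2)"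
    by (rule member_le_sum[OF assms(2)]) (use assms in auto)
  then show ?thesis
    unfolding L2_set_def by (metis real_sqrt_abs real_sqrt_le_mono)
qed

lemma err_sel: "err \<theta> (sel s) = 0"
  by (simp add: err_def)

text \<open>Subtracting the phase defect makes the function decay without any cone condition: the
  couplings relax at a fixed rate, whereas phase differences alone grow only at a rate of order \<open>\<nu>\<close>.\<close>

lemma energy_defect_derivative:
  assumes net: "solution {0..} \<theta> k"
    and orbit: "reduced.slaved_orbit \<psi>"
    and t: "0 < t" and conf: "confined (\<theta> t) (k t)"
  shows "\<exists>D. ((\<lambda>\<tau>. energy (\<theta> \<tau>) (k \<tau>) (\<psi> \<tau>) - l * defect (\<theta> \<tau>) (\<psi> \<tau>)) has_real_derivative D) (at t) \<and>
    D \<le> - \<beta> * (energy (\<theta> t) (k t) (\<psi> t) - l * defect (\<theta> t) (\<psi> t))"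
proof -
  define \<kappa> where "\<kappa> = reduced.slaved_coupling (\<psi> t)"
  define v where "v = velocity (\<lambda>i. \<theta> t $ i) (\<lambda>i j. k t $ i $ j)"
  define V where "V s = cluster_velocity (\<lambda>s. \<psi> t $ s) \<kappa> s" for s
  define e where "e = err (\<theta> t)"
  define d where "d = inter_dev (k t) (\<psi> t)"
  define d' where "d' = intra_dev (k t)"
  define q where "q s = \<theta> t $ sel s - \<psi> t $ s" for s
  define X where "X = L2_set e nonselected"
  define Y where "Y = L2_set d inter_edges"
  define Z where "Z = L2_set d' intra_edges"
  define Q where "Q = L2_set q UNIV"
  define f where "f a = \<nu> * (\<Gamma> (\<theta> t $ snd a - \<theta> t $ fst a) - \<Gamma> (\<psi> t $ cl (snd a) - \<psi> t $ cl (fst a)))" for a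
  define f' where "f' a = \<mu>t * (\<Gamma> (\<theta> t $ snd a - \<theta> t $ fst a) - \<Gamma> 0)" for a
  have XYZQ: "0 \<le> X" "0 \<le> Y" "0 \<le> Z" "0 \<le> Q"
    by (simp_all add: X_def Y_def Z_def Q_def L2_set_nonneg)
  have at: "at t within {0..} = at t"
    by (rule at_within_interior) (use t in \<open>auto simp: interior_Ici\<close>)
  have \<theta>': "((\<lambda>\<tau>. \<theta> \<tau> $ i) has_real_derivative v i) (at t)" for i
    using network_solutionD(1)[OF net, of t i] t by (simp add: v_def velocity_def at)
  have k': "((\<lambda>\<tau>. k \<tau> $ i $ j) has_real_derivative
      - \<gamma> * k t $ i $ j + (if cl i = cl j then \<mu>t else \<nu>) * \<Gamma> (\<theta> t $ j - \<theta> t $ i)) (at t)"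
    if "(i, j) \<in> E" for i j
    using network_solutionD(2)[OF net, of t i j] t that by (simp add: same_cluster_iff at)
  have \<psi>': "((\<lambda>\<tau>. \<psi> \<tau> $ s) has_real_derivative V s) (at t)" for s
    using orbit by (simp add: reduced.full_orbit_def reduced.rate_def V_def cluster_velocity_def \<kappa>_def)
  \<comment> \<open>Differentiable because \<open>\<psi>\<close> is an orbit of the reduced system,
    whose couplings are the slaved ones.\<close>
  have \<kappa>': "((\<lambda>\<tau>. reduced.slaved_coupling (\<psi> \<tau>) s r) has_real_derivative
      - \<gamma> * \<kappa> s r + \<nu> * \<Gamma> (\<psi> t $ r - \<psi> t $ s)) (at t)" for s r
    using orbit unfolding reduced.full_orbit_def reduced.driven_def \<kappa>_def by blast
  have e': "((\<lambda>\<tau>. err (\<theta> \<tau>) i) has_real_derivative v i - v (sel (cl i))) (at t)" for i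
    unfolding err_def by (intro DERIV_diff \<theta>')
  have d_deriv: "((\<lambda>\<tau>. inter_dev (k \<tau>) (\<psi> \<tau>) a) has_real_derivative - \<gamma> * d a + f a) (at t)"
    if "a \<in> inter_edges" for a
  proof -
    obtain i j where a: "a = (i, j)" by (cases a)
    with that have "(i, j) \<in> E" "cl i \<noteq> cl j" by (auto simp: inter_edges_def)
    then have "((\<lambda>\<tau>. inter_dev (k \<tau>) (\<psi> \<tau>) a) has_real_derivative
        (- \<gamma> * k t $ i $ j + \<nu> * \<Gamma> (\<theta> t $ j - \<theta> t $ i))
        - (- \<gamma> * \<kappa> (cl i) (cl j) + \<nu> * \<Gamma> (\<psi> t $ cl j - \<psi> t $ cl i))) (at t)"
      unfolding inter_dev_def a fst_conv snd_conv using k'[of i j] by (intro DERIV_diff \<kappa>') simp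
    then show ?thesis by (simp add: d_def inter_dev_def f_def a \<kappa>_def algebra_simps)
  qed
  have d'_deriv: "((\<lambda>\<tau>. intra_dev (k \<tau>) a) has_real_derivative - \<gamma> * d' a + f' a) (at t)"
    if "a \<in> intra_edges" for a
  proof -
    obtain i j where a: "a = (i, j)" by (cases a)
    with that have "(i, j) \<in> E" "cl i = cl j" by (auto simp: intra_edges_def)
    then have "((\<lambda>\<tau>. intra_dev (k \<tau>) a) has_real_derivative
        (- \<gamma> * k t $ i $ j + \<mu>t * \<Gamma> (\<theta> t $ j - \<theta> t $ i)) - 0) (at t)"
      unfolding intra_dev_def a fst_conv snd_conv using k'[of i j] by (intro DERIV_diff DERIV_const) simp
    moreover have "\<gamma> * \<kappa>0 = \<mu>t * \<Gamma> 0" using \<gamma>_pos by (simp add: \<kappa>0_def)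
    ultimately show ?thesis by (simp add: d'_def intra_dev_def f'_def a algebra_simps)
  qed
  have q_deriv: "((\<lambda>\<tau>. \<theta> \<tau> $ sel s - \<psi> \<tau> $ s) has_real_derivative v (sel s) - V s) (at t)" for s
    by (intro DERIV_diff \<theta>' \<psi>')
  define D where "D = 2 * (\<Sum>i\<in>nonselected. \<Sum>j\<in>nonselected. S i j * e i * (v j - v (sel (cl j))))
      + K * (\<Sum>a\<in>inter_edges. 2 * d a * (- \<gamma> * d a + f a))
      + p * (\<Sum>a\<in>intra_edges. 2 * d' a * (- \<gamma> * d' a + f' a))
      - l * (\<Sum>s\<in>UNIV. 2 * q s * (v (sel s) - V s))"
  have sq: "((\<lambda>\<tau>. (h \<tau>)\<^sup>2) has_real_derivative 2 * h t * h') (at t)"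
    if "(h has_real_derivative h') (at t)" for h h'
    using DERIV_power[OF that, of 2] by (simp add: mult_ac)
  have deriv: "((\<lambda>\<tau>. energy (\<theta> \<tau>) (k \<tau>) (\<psi> \<tau>) - l * defect (\<theta> \<tau>) (\<psi> \<tau>)) has_real_derivative D) (at t)"
    unfolding energy_def defect_def D_def e_def d_def d'_def q_def
    by (intro DERIV_add DERIV_diff DERIV_cmult DERIV_sum form_derivative e' sq
        d_deriv[unfolded d_def] d'_deriv[unfolded d'_def] q_deriv)
  have e_le: "\<bar>e i\<bar> \<le> X" for i
  proof (cases "i \<in> nonselected")
    case True
    then show ?thesis unfolding X_def by (intro abs_le_L2) auto
  next
    case False
    then have "i = sel (cl i)" by (simp add: nonselected_def)
    then have "e i = 0" unfolding e_def using err_sel[of "\<theta> t" "cl i"] by simp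
    then show ?thesis using XYZQ by simp
  qed
  have d_le: "\<bar>d a\<bar> \<le> Y" if "a \<in> inter_edges" for a
    unfolding Y_def using that by (intro abs_le_L2) auto
  have q_le: "\<bar>q s\<bar> \<le> Q" for s
    unfolding Q_def by (intro abs_le_L2) auto
  have \<kappa>_le: "\<bar>\<kappa> s r\<bar> \<le> \<nu> * \<delta> / \<gamma>" for s r
    unfolding \<kappa>_def by (rule reduced.slaved_coupling_bound)
  have \<theta>_split: "\<theta> t $ i = e i + \<theta> t $ sel (cl i)" for i
    by (simp add: e_def err_def)
  have e_sel: "e (sel s) = 0" for s unfolding e_def by (rule err_sel)
  have \<nu>_nonneg: "0 \<le> \<nu>" using \<nu>_pos by simp
  have conf_e: "\<bar>e i\<bar> \<le> radius" for i using conf by (simp add: confined_def e_def)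
  have conf_k: "\<bar>k t $ i $ j - \<kappa>0\<bar> \<le> radius" if "(i, j) \<in> E" "cl i = cl j" for i j
    using conf that by (force simp: confined_def intra_dev_def intra_edges_def)
  have inter_le: "\<bar>k t $ i $ j - \<kappa> (cl i) (cl j)\<bar> \<le> Y" if "(i, j) \<in> E" "cl i \<noteq> cl j" for i j
    using d_le[of "(i, j)"] that by (simp add: d_def inter_dev_def inter_edges_def \<kappa>_def)
  have R1: "\<bar>(v i - v (sel (cl i))) - (\<Sum>z\<in>nonselected. linearization i z * e z)\<bar>
      \<le> network_const * ((radius + \<nu>) * X + Y)" if "i \<in> nonselected" for i
    unfolding v_def
    by (rule velocity_difference_linearization[where \<phi> = "\<lambda>s. \<theta> t $ sel s" and e = e and \<kappa> = \<kappa>])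
      (fact \<theta>_split e_sel \<kappa>_le \<nu>_nonneg e_le conf_e inter_le conf_k XYZQ that)+
  have R2: "\<bar>v (sel s) - V s\<bar> \<le> network_const * (X + Y + \<nu> * Q)" for s
    unfolding v_def V_def
    by (rule selected_velocity_difference[where \<phi> = "\<lambda>s. \<theta> t $ sel s" and e = e and \<eta> = radius])
      (fact \<theta>_split e_sel \<kappa>_le \<nu>_nonneg \<nu>_le radius e_le conf_e inter_le conf_k XYZQ q_le[unfolded q_def])+
  have R3: "\<bar>f a\<bar> \<le> network_const * (\<nu> * (X + Q))" for a
  proof -
    let ?i = "fst a" and ?j = "snd a"
    have "\<bar>(\<theta> t $ ?j - \<theta> t $ ?i) - (\<psi> t $ cl ?j - \<psi> t $ cl ?i)\<bar> \<le> 2 * (X + Q)"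
    proof -
      have "(\<theta> t $ ?j - \<theta> t $ ?i) - (\<psi> t $ cl ?j - \<psi> t $ cl ?i)
          = (e ?j - e ?i) + (q (cl ?j) - q (cl ?i))"
        by (simp add: q_def e_def err_def)
      moreover have "\<bar>(e ?j - e ?i) + (q (cl ?j) - q (cl ?i))\<bar> \<le> (X + X) + (Q + Q)"
        by (rule order_trans[OF abs_triangle_ineq],
            rule order_trans[OF add_mono[OF abs_triangle_ineq4 abs_triangle_ineq4]])
          (intro add_mono e_le q_le)
      ultimately show ?thesis by simp
    qed
    then have "\<delta> * \<bar>(\<theta> t $ ?j - \<theta> t $ ?i) - (\<psi> t $ cl ?j - \<psi> t $ cl ?i)\<bar> \<le> \<delta> * (2 * (X + Q))"
      by (intro mult_left_mono \<delta>_nonneg)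
    then have "\<bar>\<Gamma> (\<theta> t $ ?j - \<theta> t $ ?i) - \<Gamma> (\<psi> t $ cl ?j - \<psi> t $ cl ?i)\<bar> \<le> \<delta> * (2 * (X + Q))"
      by (rule order_trans[OF \<Gamma>_lipschitz])
    then have "\<nu> * \<bar>\<Gamma> (\<theta> t $ ?j - \<theta> t $ ?i) - \<Gamma> (\<psi> t $ cl ?j - \<psi> t $ cl ?i)\<bar> \<le> \<nu> * (\<delta> * (2 * (X + Q)))"
      by (rule mult_left_mono) (rule \<nu>_nonneg)
    then have "\<bar>f a\<bar> \<le> 2 * \<delta> * (\<nu> * (X + Q))"
      using \<nu>_pos by (simp add: f_def abs_mult mult_ac)
    also have "\<dots> \<le> network_const * (\<nu> * (X + Q))"
      using \<nu>_pos XYZQ by (intro mult_right_mono network_const_ge) auto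
    finally show ?thesis .
  qed
  have R4: "\<bar>f' a\<bar> \<le> network_const * X" if "a \<in> intra_edges" for a
  proof -
    let ?i = "fst a" and ?j = "snd a"
    have "cl ?i = cl ?j" using that by (auto simp: intra_edges_def)
    then have "\<bar>(\<theta> t $ ?j - \<theta> t $ ?i) - 0\<bar> \<le> 2 * X"
      using e_le[of ?i] e_le[of ?j] \<theta>_split[of ?i] \<theta>_split[of ?j] by simp
    then have "\<delta> * \<bar>(\<theta> t $ ?j - \<theta> t $ ?i) - 0\<bar> \<le> \<delta> * (2 * X)"
      by (intro mult_left_mono \<delta>_nonneg)
    then have "\<bar>\<Gamma> (\<theta> t $ ?j - \<theta> t $ ?i) - \<Gamma> 0\<bar> \<le> \<delta> * (2 * X)"
      by (rule order_trans[OF \<Gamma>_lipschitz])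
    then have "\<bar>\<mu>t\<bar> * \<bar>\<Gamma> (\<theta> t $ ?j - \<theta> t $ ?i) - \<Gamma> 0\<bar> \<le> \<bar>\<mu>t\<bar> * (\<delta> * (2 * X))"
      by (rule mult_left_mono) simp
    then have "\<bar>f' a\<bar> \<le> 2 * \<bar>\<mu>t\<bar> * \<delta> * X" by (simp add: f'_def abs_mult mult_ac)
    also have "\<dots> \<le> network_const * X" using XYZQ by (intro mult_right_mono network_const_ge) auto
    finally show ?thesis .
  qed
  define \<sigma> where "\<sigma> = radius + \<nu>"
  have \<sigma>: "0 \<le> \<sigma>" "\<sigma> \<le> \<epsilon>" using radius \<nu>_le \<nu>_pos by (auto simp: \<sigma>_def)
  let ?C = lyapunov_const
  have B1: "2 * (\<Sum>i\<in>nonselected. \<Sum>j\<in>nonselected. S i j * e i * (v j - v (sel (cl j))))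
      \<le> - 2 * b * X\<^sup>2 + ?C * X * (\<sigma> * X + Y)"
  proof -
    \<comment> \<open>The linear part is left to the Lyapunov inequality, the remainder to the norm
      of the form.\<close>
    have "(\<Sum>i\<in>nonselected. \<Sum>j\<in>nonselected. S i j * e i * (v j - v (sel (cl j))))
        = (\<Sum>i\<in>nonselected. \<Sum>j\<in>nonselected. S i j * e i * (\<Sum>z\<in>nonselected. linearization j z * e z))
        + (\<Sum>i\<in>nonselected. \<Sum>j\<in>nonselected. S i j * e i *
            ((v j - v (sel (cl j))) - (\<Sum>z\<in>nonselected. linearization j z * e z)))"
      by (simp add: sum.distrib[symmetric] algebra_simps)
    also have "\<dots> \<le> - b * X\<^sup>2 + form_norm * X * (network_const * (\<sigma> * X + Y))"
    proof (rule add_mono)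
      show "(\<Sum>i\<in>nonselected. \<Sum>j\<in>nonselected. S i j * e i * (\<Sum>z\<in>nonselected. linearization j z * e z))
          \<le> - b * X\<^sup>2"
        using S_linearization[of e] by (simp add: sum_L2 X_def)
      show "(\<Sum>i\<in>nonselected. \<Sum>j\<in>nonselected. S i j * e i *
            ((v j - v (sel (cl j))) - (\<Sum>z\<in>nonselected. linearization j z * e z)))
          \<le> form_norm * X * (network_const * (\<sigma> * X + Y))"
        unfolding form_norm_def by (rule bilinear_form_bound) (use e_le R1 in \<open>auto simp: \<sigma>_def\<close>)
    qed
    finally have "2 * (\<Sum>i\<in>nonselected. \<Sum>j\<in>nonselected. S i j * e i * (v j - v (sel (cl j))))
        \<le> 2 * (- b * X\<^sup>2 + form_norm * X * (network_const * (\<sigma> * X + Y)))"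
      by (rule mult_left_mono) simp
    also have "\<dots> = - 2 * b * X\<^sup>2 + (2 * form_norm * network_const) * (X * (\<sigma> * X + Y))"
      by (simp add: algebra_simps)
    also have "\<dots> \<le> - 2 * b * X\<^sup>2 + ?C * (X * (\<sigma> * X + Y))"
      using XYZQ \<sigma> by (intro add_left_mono mult_right_mono lyapunov_const_ge) auto
    finally show ?thesis by (simp add: mult.assoc)
  qed
  have B2: "(\<Sum>a\<in>inter_edges. 2 * d a * (- \<gamma> * d a + f a)) \<le> - 2 * \<gamma> * Y\<^sup>2 + ?C * \<nu> * Y * (X + Q)"
  proof -
    have "(\<Sum>a\<in>inter_edges. 2 * d a * (- \<gamma> * d a + f a))
        \<le> - 2 * \<gamma> * Y\<^sup>2 + 2 * card inter_edges * Y * (network_const * (\<nu> * (X + Q)))"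
      unfolding Y_def by (rule sum_relaxation_bound) (use R3 in auto)
    also have "\<dots> = - 2 * \<gamma> * Y\<^sup>2 + (2 * card inter_edges * network_const) * (\<nu> * Y * (X + Q))" by simp
    also have "\<dots> \<le> - 2 * \<gamma> * Y\<^sup>2 + ?C * (\<nu> * Y * (X + Q))"
      using XYZQ \<nu>_pos by (intro add_left_mono mult_right_mono lyapunov_const_ge) auto
    finally show ?thesis by (simp add: mult.assoc)
  qed
  have B3: "(\<Sum>a\<in>intra_edges. 2 * d' a * (- \<gamma> * d' a + f' a)) \<le> - 2 * \<gamma> * Z\<^sup>2 + ?C * X * Z"
  proof -
    have "(\<Sum>a\<in>intra_edges. 2 * d' a * (- \<gamma> * d' a + f' a))
        \<le> - 2 * \<gamma> * Z\<^sup>2 + 2 * card intra_edges * Z * (network_const * X)"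
      unfolding Z_def by (rule sum_relaxation_bound) (use R4 in auto)
    also have "\<dots> = - 2 * \<gamma> * Z\<^sup>2 + (2 * card intra_edges * network_const) * (X * Z)" by simp
    also have "\<dots> \<le> - 2 * \<gamma> * Z\<^sup>2 + ?C * (X * Z)"
      using XYZQ by (intro add_left_mono mult_right_mono lyapunov_const_ge) auto
    finally show ?thesis by (simp add: mult.assoc)
  qed
  \<comment> \<open>The defect enters the function with a minus sign, so its decrease has to be
    bounded; the relaxation estimate is applied with rate 0.\<close>
  have B4: "- (\<Sum>s\<in>UNIV. 2 * q s * (v (sel s) - V s)) \<le> ?C * Q * (X + Y + \<nu> * Q)"
  proof -
    have "- (\<Sum>s\<in>UNIV. 2 * q s * (v (sel s) - V s)) = (\<Sum>s\<in>UNIV. 2 * q s * (- 0 * q s + (V s - v (sel s))))"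
      unfolding sum_negf[symmetric] by (rule sum.cong) (auto simp: algebra_simps)
    also have "\<dots> \<le> - 2 * 0 * Q\<^sup>2 + 2 * CARD('m) * Q * (network_const * (X + Y + \<nu> * Q))"
      unfolding Q_def by (rule sum_relaxation_bound) (use R2 in \<open>auto simp: abs_minus_commute Q_def\<close>)
    also have "\<dots> = (2 * CARD('m) * network_const) * (Q * (X + Y + \<nu> * Q))" by simp
    also have "\<dots> \<le> ?C * (Q * (X + Y + \<nu> * Q))"
      using XYZQ \<nu>_pos by (intro mult_right_mono lyapunov_const_ge) auto
    finally show ?thesis by (simp add: mult.assoc)
  qed
  have "D \<le> - 2 * b * X\<^sup>2 + ?C * X * (\<sigma> * X + Y) + K * (- 2 * \<gamma> * Y\<^sup>2 + ?C * \<nu> * Y * (X + Q))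
      + p * (- 2 * \<gamma> * Z\<^sup>2 + ?C * X * Z) + l * (?C * Q * (X + Y + \<nu> * Q))"
    unfolding D_def diff_conv_add_uminus mult_minus_right[symmetric]
    using B1 B2 B3 B4 K_pos p_pos l_pos by (intro add_mono mult_left_mono) auto
  also have "\<dots> \<le> - \<beta> * (form e + K * Y\<^sup>2 + p * Z\<^sup>2 - l * Q\<^sup>2)"
  proof (rule decay)
    have "form e \<le> form_norm * X\<^sup>2" by (rule form_upper) (rule e_le)
    also have "\<dots> \<le> ?C * X\<^sup>2" by (intro mult_right_mono lyapunov_const_ge) simp
    finally show "form e \<le> ?C * X\<^sup>2" .
  qed (use XYZQ \<sigma> \<nu>_pos \<nu>_le in auto)
  also have "form e + K * Y\<^sup>2 + p * Z\<^sup>2 - l * Q\<^sup>2 = energy (\<theta> t) (k t) (\<psi> t) - l * defect (\<theta> t) (\<psi> t)"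
    by (simp add: energy_def defect_def e_def Y_def Z_def Q_def d_def d'_def q_def[abs_def] sum_L2)
  finally show ?thesis using deriv by blast
qed

end

text \<open>Chord and arc: points of the circle that are an angle \<open>2 * h\<close> apart have
  distance \<open>2 * \<bar>sin h\<bar>\<close>. Rounding selects the lift of \<open>y\<close> with
  \<open>\<bar>h\<bar> \<le> pi / 2\<close>, where
  \<open>\<bar>h\<bar> \<le> 3 * \<bar>sin h\<bar>\<close>.\<close>

lemma torus_point_close:
  fixes x y :: "real^'m::finite"
  assumes r: "dist (torus_point x) (torus_point y) \<le> r"
  shows "\<exists>z. torus_period z \<and> (\<forall>s. \<bar>x $ s - (y + z) $ s\<bar> \<le> 3 * r)"
proof -
  have "\<exists>n. \<bar>x $ s - y $ s - 2 * pi * of_int n\<bar> \<le> 3 * r" for s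
  proof -
    define u where "u = (x $ s - y $ s) / (2 * pi)"
    have u: "x $ s - y $ s = 2 * pi * u" by (simp add: u_def)
    define n where "n = round u"
    define h where "h = (x $ s - y $ s - 2 * pi * of_int n) / 2"
    have "\<bar>of_int n - u\<bar> \<le> 1 / 2"
      unfolding n_def by (rule of_int_round_abs_le)
    then have "2 * pi * \<bar>of_int n - u\<bar> \<le> 2 * pi * (1 / 2)"
      by (rule mult_left_mono) simp
    moreover have "2 * pi * \<bar>of_int n - u\<bar> = \<bar>2 * pi * (of_int n - u)\<bar>"
      by (simp add: abs_mult)
    moreover have "2 * pi * (of_int n - u) = - (2 * h)"
      unfolding h_def u by (simp add: field_simps)
    ultimately have "\<bar>h\<bar> \<le> pi / 2" by simp
    then have h2: "\<bar>h\<bar> \<le> 2" using pi_less_4 by linarith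
    \<comment> \<open>With \<open>\<bar>h\<bar> \<le> 2\<close> the cubic Taylor bound is at most
      two thirds of \<open>\<bar>h\<bar>\<close>, hence the factor 3.\<close>
    have "\<bar>sin h - h\<bar> \<le> \<bar>h\<bar> ^ 3 / 6"
      using Maclaurin_sin_bound[of h 3]
      by (simp add: sin_coeff_def lessThan_nat_numeral numeral_3_eq_3 numeral_2_eq_2 fact_numeral)
    also have "\<bar>h\<bar> ^ 3 = \<bar>h\<bar> * \<bar>h\<bar>\<^sup>2" by (simp add: power3_eq_cube power2_eq_square)
    also have "\<bar>h\<bar> * \<bar>h\<bar>\<^sup>2 / 6 \<le> \<bar>h\<bar> * 2\<^sup>2 / 6"
      using h2 by (intro divide_right_mono mult_left_mono power_mono) auto
    finally have "\<bar>sin h - h\<bar> \<le> 2 / 3 * \<bar>h\<bar>" by simp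
    moreover have "\<bar>h\<bar> \<le> \<bar>sin h - h\<bar> + \<bar>sin h\<bar>"
      using abs_triangle_ineq4[of "sin h" "sin h - h"] by simp
    ultimately have sin_h: "\<bar>h\<bar> \<le> 3 * \<bar>sin h\<bar>" by linarith
    have "cis (x $ s) - cis (y $ s) = cis (y $ s + h) * (cis h - cis (- h))"
    proof -
      have "cis (x $ s) = cis (y $ s + 2 * h)"
      proof -
        have "x $ s = (y $ s + 2 * h) + 2 * pi * of_int n" by (simp add: h_def field_simps)
        then show ?thesis by (simp add: cis_mult[symmetric] cis_multiple_2pi)
      qed
      moreover have "y $ s + h + h = y $ s + 2 * h" by simp
      ultimately show ?thesis by (simp only: right_diff_distrib cis_mult) simp
    qed
    also have "cis h - cis (- h) = 2 * \<i> * complex_of_real (sin h)"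
      by (simp add: complex_eq_iff)
    finally have "norm (cis (x $ s) - cis (y $ s)) = 2 * \<bar>sin h\<bar>"
      by (simp add: norm_mult)
    moreover have "norm (cis (x $ s) - cis (y $ s)) \<le> r"
      using order_trans[OF Finite_Cartesian_Product.norm_nth_le[of "torus_point x - torus_point y" s] r[unfolded dist_norm]]
      by (simp add: torus_point_def)
    ultimately have "2 * \<bar>h\<bar> \<le> 3 * r" using sin_h by linarith
    then have "\<bar>x $ s - y $ s - 2 * pi * of_int n\<bar> \<le> 3 * r" by (simp add: h_def)
    then show ?thesis by blast
  qed
  then obtain n where n: "\<And>s. \<bar>x $ s - y $ s - 2 * pi * of_int (n s)\<bar> \<le> 3 * r" by metis
  define z :: "real^'m" where "z = (\<chi> s. 2 * pi * of_int (n s))"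
  have "torus_period z" unfolding torus_period_def z_def vec_lambda_beta by blast
  moreover have "\<bar>x $ s - (y + z) $ s\<bar> \<le> 3 * r" for s
    using n[of s] by (simp add: z_def algebra_simps)
  ultimately show ?thesis by blast
qed

section \<open>Confinement and the basin of attraction\<close>

context slow_decaying_network
begin

lemma energy_nonneg: "0 \<le> energy \<theta> k x"
  unfolding energy_def using form_nonneg K_pos p_pos by (simp add: sum_nonneg)

lemma continuous_on_network_solution:
  assumes "solution {0..} \<theta> k"
  shows "continuous_on {0..T} (\<lambda>t. \<theta> t $ i)" "(i, j) \<in> E \<Longrightarrow> continuous_on {0..T} (\<lambda>t. k t $ i $ j)"
proof -
  have "continuous_on {0..} (\<lambda>t. \<theta> t $ i)"
    using network_solutionD(1)[OF assms] by (rule DERIV_continuous_on)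
  then show "continuous_on {0..T} (\<lambda>t. \<theta> t $ i)" by (rule continuous_on_subset) auto
  assume "(i, j) \<in> E"
  then have "continuous_on {0..} (\<lambda>t. k t $ i $ j)"
    using network_solutionD(2)[OF assms] by (intro DERIV_continuous_on) auto
  then show "continuous_on {0..T} (\<lambda>t. k t $ i $ j)" by (rule continuous_on_subset) auto
qed

lemma continuous_on_deviations:
  assumes "solution {0..} \<theta> k"
  shows "continuous_on {0..T} (\<lambda>t. err (\<theta> t) i)"
    and "a \<in> intra_edges \<Longrightarrow> continuous_on {0..T} (\<lambda>t. intra_dev (k t) a)"
proof -
  show "continuous_on {0..T} (\<lambda>t. err (\<theta> t) i)"
    unfolding err_def by (intro continuous_on_diff continuous_on_network_solution(1)[OF assms])
  show "continuous_on {0..T} (\<lambda>t. intra_dev (k t) a)" if "a \<in> intra_edges"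
    unfolding intra_dev_def
    by (intro continuous_on_diff continuous_on_const continuous_on_network_solution(2)[OF assms])
      (use that in \<open>auto simp: intra_edges_def\<close>)
qed

lemma energy_defect_decay:
  assumes net: "solution {0..} \<theta> k"
    and orbit: "reduced.slaved_orbit \<psi>"
    and T: "0 \<le> T" and conf: "\<And>t. 0 < t \<Longrightarrow> t < T \<Longrightarrow> confined (\<theta> t) (k t)"
  shows "energy (\<theta> T) (k T) (\<psi> T) - l * defect (\<theta> T) (\<psi> T)
    \<le> exp (- \<beta> * T) * (energy (\<theta> 0) (k 0) (\<psi> 0) - l * defect (\<theta> 0) (\<psi> 0))"
proof -
  let ?H = "\<lambda>t. energy (\<theta> t) (k t) (\<psi> t) - l * defect (\<theta> t) (\<psi> t)"
  have \<psi>: "continuous_on {0..T} (\<lambda>t. \<psi> t $ s)" for s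
  proof -
    have "continuous_on UNIV (\<lambda>t. \<psi> t $ s)"
      using orbit unfolding reduced.full_orbit_def by (intro DERIV_continuous_on) auto
    then show ?thesis by (rule continuous_on_subset) simp
  qed
  have \<kappa>: "continuous_on {0..T} (\<lambda>t. reduced.slaved_coupling (\<psi> t) s r)" for s r
    using reduced.driven_continuous[of \<psi> "\<lambda>t. reduced.slaved_coupling (\<psi> t)" s r] orbit
    by (auto simp: reduced.full_orbit_def intro: continuous_on_subset)
  have inter: "continuous_on {0..T} (\<lambda>t. inter_dev (k t) (\<psi> t) a)" if "a \<in> inter_edges" for a
    unfolding inter_dev_def
    by (intro continuous_on_diff \<kappa> continuous_on_network_solution(2)[OF net])
      (use that in \<open>auto simp: inter_edges_def\<close>)
  have "continuous_on {0..T} ?H"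
    unfolding energy_def defect_def form_def
    by (intro continuous_on_diff continuous_on_add continuous_on_mult continuous_on_sum
        continuous_on_power continuous_on_const continuous_on_deviations[OF net] inter \<psi>
        continuous_on_network_solution(1)[OF net])
  then have "?H T \<le> exp (- \<beta> * (T - 0)) * ?H 0"
    by (intro exp_decay[where D = ?H and a = 0, OF T] energy_defect_derivative[OF net orbit] conf)
  then show ?thesis by simp
qed

text \<open>Moving the base phase from \<open>x\<close> to that of the state changes each
  inter-cluster deviation by at most the Lipschitz constant of the slaved couplings times the root
  of the defect. After \<open>(u + v)\<^sup>2 \<le> 2 * u\<^sup>2 + 2 * v\<^sup>2\<close> the slope
  condition lets the subtracted defect absorb the change.\<close>

lemma energy_change_phase: "energy \<theta> k x - l * defect \<theta> x \<le> 2 * energy \<theta> k (phase \<theta>)"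
proof -
  define a where "a = sqrt (defect \<theta> x)"
  have defect0: "0 \<le> defect \<theta> x" by (simp add: defect_def sum_nonneg)
  then have a2: "a\<^sup>2 = defect \<theta> x" by (simp add: a_def)
  define h where "h = 8 * \<nu> * \<delta> / \<gamma>"
  have phase_le: "\<bar>phase \<theta> $ s - x $ s\<bar> \<le> a" for s
    using abs_le_L2[of UNIV s "\<lambda>s. \<theta> $ sel s - x $ s"]
    by (simp add: phase_def a_def defect_def L2_set_def)
  have "(inter_dev k x e)\<^sup>2 \<le> 2 * (inter_dev k (phase \<theta>) e)\<^sup>2 + 2 * (h\<^sup>2 * defect \<theta> x)" for e
  proof -
    have "\<bar>inter_dev k x e - inter_dev k (phase \<theta>) e\<bar> \<le> h * a"
      using reduced.slaved_coupling_lipschitz[of "phase \<theta>" x a "cl (fst e)" "cl (snd e)"] phase_le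
      by (simp add: inter_dev_def h_def)
    then have "\<bar>inter_dev k x e - inter_dev k (phase \<theta>) e\<bar>\<^sup>2 \<le> (h * a)\<^sup>2"
      by (rule power_mono) simp
    then have "(inter_dev k x e - inter_dev k (phase \<theta>) e)\<^sup>2 \<le> h\<^sup>2 * defect \<theta> x"
      by (simp add: power_mult_distrib a2)
    moreover have "(u + v)\<^sup>2 \<le> 2 * u\<^sup>2 + 2 * v\<^sup>2" for u v :: real
      using zero_le_power2[of "u - v"] by (simp add: power2_eq_square algebra_simps)
    from this[of "inter_dev k (phase \<theta>) e" "inter_dev k x e - inter_dev k (phase \<theta>) e"]
    have "(inter_dev k x e)\<^sup>2 \<le> 2 * (inter_dev k (phase \<theta>) e)\<^sup>2
        + 2 * (inter_dev k x e - inter_dev k (phase \<theta>) e)\<^sup>2" by simp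
    ultimately show ?thesis by linarith
  qed
  then have "(\<Sum>e\<in>inter_edges. (inter_dev k x e)\<^sup>2)
      \<le> (\<Sum>e\<in>inter_edges. 2 * (inter_dev k (phase \<theta>) e)\<^sup>2 + 2 * (h\<^sup>2 * defect \<theta> x))"
    by (intro sum_mono)
  also have "\<dots> = 2 * (\<Sum>e\<in>inter_edges. (inter_dev k (phase \<theta>) e)\<^sup>2)
      + 2 * card inter_edges * h\<^sup>2 * defect \<theta> x"
    by (simp add: sum.distrib sum_distrib_left)
  finally have "K * (\<Sum>e\<in>inter_edges. (inter_dev k x e)\<^sup>2)
      \<le> K * (2 * (\<Sum>e\<in>inter_edges. (inter_dev k (phase \<theta>) e)\<^sup>2)
      + 2 * card inter_edges * h\<^sup>2 * defect \<theta> x)"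
    using K_pos by (intro mult_left_mono) auto
  also have "\<dots> = 2 * (K * (\<Sum>e\<in>inter_edges. (inter_dev k (phase \<theta>) e)\<^sup>2))
      + (2 * K * card inter_edges * h\<^sup>2) * defect \<theta> x"
    by (simp add: algebra_simps)
  also have "\<dots> \<le> 2 * (K * (\<Sum>e\<in>inter_edges. (inter_dev k (phase \<theta>) e)\<^sup>2)) + l * defect \<theta> x"
    using coupling_slope defect0 unfolding h_def by (intro add_left_mono mult_right_mono) auto
  finally have "K * (\<Sum>e\<in>inter_edges. (inter_dev k x e)\<^sup>2)
      \<le> 2 * (K * (\<Sum>e\<in>inter_edges. (inter_dev k (phase \<theta>) e)\<^sup>2)) + l * defect \<theta> x" .
  moreover have "0 \<le> p * (\<Sum>a\<in>intra_edges. (intra_dev k a)\<^sup>2)"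
    using p_pos by (simp add: sum_nonneg)
  moreover have "u + a + c - d \<le> 2 * (u + b + c)" if "a \<le> 2 * b + d" "0 \<le> c" "0 \<le> u" for u a b c d :: real
    using that unfolding distrib_left by linarith
  ultimately show ?thesis
    unfolding energy_def using form_nonneg[of "err \<theta>"] by blast
qed

text \<open>The comparison orbit is chosen to have the phase of the solution at the final time, where the
  defect then vanishes.\<close>

lemma energy_decay:
  assumes net: "solution {0..} \<theta> k"
    and T: "0 \<le> T" and conf: "\<And>t. 0 < t \<Longrightarrow> t < T \<Longrightarrow> confined (\<theta> t) (k t)"
  shows "energy (\<theta> T) (k T) (phase (\<theta> T)) \<le> 2 * exp (- \<beta> * T) * energy (\<theta> 0) (k 0) (phase (\<theta> 0))"
proof -
  obtain \<psi> where \<psi>: "reduced.slaved_orbit \<psi>" "\<psi> T = phase (\<theta> T)"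
    by (rule reduced.slaved_orbit_exists)
  have "defect (\<theta> T) (\<psi> T) = 0" by (simp add: defect_def \<psi>(2) phase_def)
  then have "energy (\<theta> T) (k T) (phase (\<theta> T))
      \<le> exp (- \<beta> * T) * (energy (\<theta> 0) (k 0) (\<psi> 0) - l * defect (\<theta> 0) (\<psi> 0))"
    using energy_defect_decay[OF net \<psi>(1) T conf] by (simp add: \<psi>(2))
  also have "\<dots> \<le> exp (- \<beta> * T) * (2 * energy (\<theta> 0) (k 0) (phase (\<theta> 0)))"
    by (intro mult_left_mono energy_change_phase) simp
  finally show ?thesis by (simp add: mult_ac)
qed

text \<open>The quantities that confinement refers to, as one continuous function of time to which a
  first-exit argument applies; it contains no slaved coupling.\<close>

definition deviation :: "real^'n \<Rightarrow> real^'n^'n \<Rightarrow> real" where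
  "deviation \<theta> k = (\<Sum>i\<in>nonselected. (err \<theta> i)\<^sup>2) + (\<Sum>a\<in>intra_edges. (intra_dev k a)\<^sup>2)"

lemma sum_err_le: "(\<Sum>i\<in>nonselected. (err \<theta> i)\<^sup>2) \<le> 1 / m * energy \<theta> k x"
proof -
  have "m * (\<Sum>i\<in>nonselected. (err \<theta> i)\<^sup>2) \<le> form (err \<theta>)" by (rule form_lower)
  also have "\<dots> \<le> energy \<theta> k x"
    unfolding energy_def using K_pos p_pos by (simp add: sum_nonneg)
  finally show ?thesis using m_pos by (simp add: field_simps)
qed

lemma sum_intra_le: "(\<Sum>a\<in>intra_edges. (intra_dev k a)\<^sup>2) \<le> 1 / p * energy \<theta> k x"
proof -
  have "p * (\<Sum>a\<in>intra_edges. (intra_dev k a)\<^sup>2) \<le> energy \<theta> k x"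
    unfolding energy_def using K_pos form_nonneg by (simp add: sum_nonneg)
  then show ?thesis using p_pos by (simp add: field_simps)
qed

lemma sum_inter_le: "(\<Sum>a\<in>inter_edges. (inter_dev k x a)\<^sup>2) \<le> 1 / K * energy \<theta> k x"
proof -
  have "K * (\<Sum>a\<in>inter_edges. (inter_dev k x a)\<^sup>2) \<le> energy \<theta> k x"
    unfolding energy_def using p_pos form_nonneg by (simp add: sum_nonneg)
  then show ?thesis using K_pos by (simp add: field_simps)
qed

lemma deviation_le: "deviation \<theta> k \<le> (1 / m + 1 / p) * energy \<theta> k x"
  using sum_err_le[of \<theta> k x] sum_intra_le[of k \<theta> x] unfolding deviation_def distrib_right by linarith

lemma confined_if_deviation:
  assumes "deviation \<theta> k \<le> radius\<^sup>2"
  shows "confined \<theta> k"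
proof -
  have e: "(\<Sum>i\<in>nonselected. (err \<theta> i)\<^sup>2) \<le> radius\<^sup>2" and k: "(\<Sum>a\<in>intra_edges. (intra_dev k a)\<^sup>2) \<le> radius\<^sup>2"
    using assms sum_nonneg[of nonselected "\<lambda>i. (err \<theta> i)\<^sup>2"] sum_nonneg[of intra_edges "\<lambda>a. (intra_dev k a)\<^sup>2"]
    unfolding deviation_def by auto
  have "\<bar>err \<theta> i\<bar> \<le> radius" for i
  proof (cases "i \<in> nonselected")
    case True
    then have "(err \<theta> i)\<^sup>2 \<le> radius\<^sup>2" by (intro order_trans[OF member_le_sum e]) auto
    then show ?thesis using radius by (simp add: abs_le_square_iff[symmetric])
  next
    case False
    then have "i = sel (cl i)" by (simp add: nonselected_def)
    then have "err \<theta> i = 0" using err_sel[of \<theta> "cl i"] by simp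
    then show ?thesis using radius by simp
  qed
  moreover have "\<bar>intra_dev k a\<bar> \<le> radius" if "a \<in> intra_edges" for a
  proof -
    have "(intra_dev k a)\<^sup>2 \<le> radius\<^sup>2" using that by (intro order_trans[OF member_le_sum k]) auto
    then show ?thesis using radius by (simp add: abs_le_square_iff[symmetric])
  qed
  ultimately show ?thesis by (simp add: confined_def)
qed

text \<open>Before the first time \<open>t1\<close> at which the deviation reaches the squared
  radius, the solution is confined, so the energy estimate keeps the deviation below
  \<open>c0\<close>. By continuity it would take the value halfway between \<open>c0\<close> and the
  squared radius before \<open>t1\<close>, a contradiction.\<close>

lemma deviation_small:
  assumes net: "solution {0..} \<theta> k"
    and small: "2 * (1 / m + 1 / p) * energy (\<theta> 0) (k 0) (phase (\<theta> 0)) < radius\<^sup>2"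
    and T: "0 \<le> T"
  shows "deviation (\<theta> T) (k T) < radius\<^sup>2"
proof (rule ccontr)
  assume "\<not> deviation (\<theta> T) (k T) < radius\<^sup>2"
  define F where "F t = deviation (\<theta> t) (k t)" for t
  define c0 where "c0 = 2 * (1 / m + 1 / p) * energy (\<theta> 0) (k 0) (phase (\<theta> 0))"
  define A where "A = {t \<in> {0..T}. radius\<^sup>2 \<le> F t}"
  have cont: "continuous_on {0..T} F"
    unfolding F_def deviation_def
    by (intro continuous_on_add continuous_on_sum continuous_on_power continuous_on_deviations[OF net])
  have "closed A"
    unfolding A_def by (intro continuous_on_closed_Collect_le cont continuous_on_const) auto
  moreover have "bounded A" by (rule bounded_subset[of "{0..T}"]) (auto simp: A_def)
  ultimately have "compact A" by (simp add: compact_eq_bounded_closed)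
  moreover have "T \<in> A" using T \<open>\<not> deviation (\<theta> T) (k T) < radius\<^sup>2\<close> by (simp add: A_def F_def)
  ultimately obtain t1 where t1: "t1 \<in> A" "\<And>t. t \<in> A \<Longrightarrow> t1 \<le> t"
    by (metis compact_attains_inf empty_iff)
  have t1': "0 \<le> t1" "t1 \<le> T" "radius\<^sup>2 \<le> F t1" using t1(1) by (auto simp: A_def)
  have F_le: "F t \<le> c0" if "0 \<le> t" "t < t1" for t
  proof -
    have "confined (\<theta> s) (k s)" if "0 < s" "s < t" for s
    proof (rule confined_if_deviation)
      have "s \<notin> A" using t1(2)[of s] that \<open>t < t1\<close> by fastforce
      then show "deviation (\<theta> s) (k s) \<le> radius\<^sup>2"
        using that \<open>t < t1\<close> t1' by (auto simp: A_def F_def)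
    qed
    from energy_decay[OF net that(1) this]
    have "energy (\<theta> t) (k t) (phase (\<theta> t)) \<le> 2 * exp (- \<beta> * t) * energy (\<theta> 0) (k 0) (phase (\<theta> 0))" .
    also have "\<dots> \<le> 2 * 1 * energy (\<theta> 0) (k 0) (phase (\<theta> 0))"
      using that \<beta>_pos energy_nonneg by (intro mult_right_mono mult_left_mono) auto
    finally have "(1 / m + 1 / p) * energy (\<theta> t) (k t) (phase (\<theta> t))
        \<le> (1 / m + 1 / p) * (2 * 1 * energy (\<theta> 0) (k 0) (phase (\<theta> 0)))"
      using m_pos p_pos by (intro mult_left_mono) auto
    also have "\<dots> = c0" by (simp add: c0_def algebra_simps)
    finally show ?thesis
      using deviation_le[of "\<theta> t" "k t" "phase (\<theta> t)"] unfolding F_def by (rule order_trans[rotated])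
  qed
  have c0: "c0 < radius\<^sup>2" using small by (simp add: c0_def)
  have F0: "F 0 \<le> c0"
  proof -
    have "0 \<le> (1 / m + 1 / p) * energy (\<theta> 0) (k 0) (phase (\<theta> 0))"
      using m_pos p_pos energy_nonneg by simp
    then show ?thesis
      using deviation_le[of "\<theta> 0" "k 0" "phase (\<theta> 0)"] unfolding F_def c0_def by linarith
  qed
  obtain t2 where t2: "0 \<le> t2" "t2 \<le> t1" "F t2 = (c0 + radius\<^sup>2) / 2"
    using IVT'[of F 0 "(c0 + radius\<^sup>2) / 2" t1] F0 c0 t1' continuous_on_subset[OF cont, of "{0..t1}"]
    by fastforce
  then have "t2 < t1" using c0 t1' by (cases "t2 = t1") auto
  then show False using F_le[OF t2(1)] t2(3) c0 by simp
qed

lemma energy_decay_small: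
  assumes net: "solution {0..} \<theta> k"
    and small: "2 * (1 / m + 1 / p) * energy (\<theta> 0) (k 0) (phase (\<theta> 0)) < radius\<^sup>2"
    and T: "0 \<le> T"
  shows "energy (\<theta> T) (k T) (phase (\<theta> T)) \<le> 2 * exp (- \<beta> * T) * energy (\<theta> 0) (k 0) (phase (\<theta> 0))"
  by (rule energy_decay[OF net T confined_if_deviation], rule less_imp_le, rule deviation_small[OF net small]) simp

text \<open>Comparison with the point of the manifold over the same phase: the distance then
  involves only the entries of \<open>e\<close> and \<open>k\<close>, each deviating by at most the
  root of a multiple of the energy.\<close>

lemma infdist_manifold_le:
  assumes e: "\<And>i. e $ i = err \<theta> i" and k: "\<And>i j. (i, j) \<notin> E \<Longrightarrow> k $ i $ j = 0"
  shows "infdist (e, k, torus_point (phase \<theta>)) (torus_graph coupling)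
    \<le> (CARD('n) + (CARD('n))\<^sup>2) * sqrt ((1 / m + 1 / p + 1 / K) * energy \<theta> k (phase \<theta>))"
proof -
  define R where "R = (1 / m + 1 / p + 1 / K) * energy \<theta> k (phase \<theta>)"
  have nonneg: "0 \<le> 1 / m * energy \<theta> k (phase \<theta>)" "0 \<le> 1 / p * energy \<theta> k (phase \<theta>)"
      "0 \<le> 1 / K * energy \<theta> k (phase \<theta>)"
    using m_pos p_pos K_pos energy_nonneg by auto
  have R: "1 / m * energy \<theta> k (phase \<theta>) \<le> R" "1 / p * energy \<theta> k (phase \<theta>) \<le> R"
      "1 / K * energy \<theta> k (phase \<theta>) \<le> R" "0 \<le> R"
    unfolding R_def distrib_right using nonneg by linarith+
  have e_le: "\<bar>e $ i\<bar> \<le> sqrt R" for i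
  proof (cases "i \<in> nonselected")
    case True
    then have "(err \<theta> i)\<^sup>2 \<le> (\<Sum>i\<in>nonselected. (err \<theta> i)\<^sup>2)" by (intro member_le_sum) auto
    then have "(err \<theta> i)\<^sup>2 \<le> R" using sum_err_le[of \<theta> k "phase \<theta>"] R by linarith
    then show ?thesis unfolding e using real_sqrt_le_mono by fastforce
  next
    case False
    then have "i = sel (cl i)" by (simp add: nonselected_def)
    then have "err \<theta> i = 0" using err_sel[of \<theta> "cl i"] by simp
    then show ?thesis using R by (simp add: e)
  qed
  have k_le: "\<bar>(k - coupling (phase \<theta>)) $ i $ j\<bar> \<le> sqrt R" for i j
  proof -
    consider "(i, j) \<notin> E" | "(i, j) \<in> inter_edges" | "(i, j) \<in> intra_edges"
      by (auto simp: inter_edges_def intra_edges_def)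
    then show ?thesis
    proof cases
      case 1
      then show ?thesis using R k by (simp add: coupling_nth)
    next
      case 2
      then have "(inter_dev k (phase \<theta>) (i, j))\<^sup>2 \<le> (\<Sum>a\<in>inter_edges. (inter_dev k (phase \<theta>) a)\<^sup>2)"
        by (intro member_le_sum) auto
      then have "(inter_dev k (phase \<theta>) (i, j))\<^sup>2 \<le> R"
        using sum_inter_le[of k "phase \<theta>" \<theta>] R by linarith
      moreover have "(k - coupling (phase \<theta>)) $ i $ j = inter_dev k (phase \<theta>) (i, j)"
        using 2 by (auto simp: coupling_nth inter_dev_def inter_edges_def)
      ultimately show ?thesis using real_sqrt_le_mono by fastforce
    next
      case 3
      then have "(intra_dev k (i, j))\<^sup>2 \<le> (\<Sum>a\<in>intra_edges. (intra_dev k a)\<^sup>2)"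
        by (intro member_le_sum) auto
      then have "(intra_dev k (i, j))\<^sup>2 \<le> R"
        using sum_intra_le[of k \<theta> "phase \<theta>"] R by linarith
      moreover have "(k - coupling (phase \<theta>)) $ i $ j = intra_dev k (i, j)"
        using 3 by (auto simp: coupling_nth intra_dev_def intra_edges_def)
      ultimately show ?thesis using real_sqrt_le_mono by fastforce
    qed
  qed
  have "norm e \<le> (\<Sum>i\<in>(UNIV :: 'n set). sqrt R)"
    by (rule order_trans[OF norm_le_l1_cart sum_mono[OF e_le]])
  moreover have "norm (k - coupling (phase \<theta>)) \<le> (\<Sum>i\<in>(UNIV :: 'n set). \<Sum>j\<in>(UNIV :: 'n set). sqrt R)"
  proof -
    have "norm (k - coupling (phase \<theta>)) \<le> (\<Sum>i\<in>UNIV. norm ((k - coupling (phase \<theta>)) $ i))"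
      unfolding norm_vec_def by (rule L2_set_le_sum) auto
    also have "\<dots> \<le> (\<Sum>i\<in>(UNIV :: 'n set). \<Sum>j\<in>(UNIV :: 'n set). sqrt R)"
      by (intro sum_mono order_trans[OF norm_le_l1_cart] k_le)
    finally show ?thesis .
  qed
  ultimately have "norm e + norm (k - coupling (phase \<theta>)) \<le> (CARD('n) + (CARD('n))\<^sup>2) * sqrt R"
    by (simp add: algebra_simps power2_eq_square)
  moreover have "dist (e, k, torus_point (phase \<theta>)) (0, coupling (phase \<theta>), torus_point (phase \<theta>))
      \<le> norm e + norm (k - coupling (phase \<theta>))"
    by (simp add: dist_prod_def dist_norm sqrt_sum_squares_le_sum)
  moreover have "infdist (e, k, torus_point (phase \<theta>)) (torus_graph coupling)
      \<le> dist (e, k, torus_point (phase \<theta>)) (0, coupling (phase \<theta>), torus_point (phase \<theta>))"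
    by (rule infdist_le) (auto simp: torus_graph_def)
  ultimately show ?thesis unfolding R_def by linarith
qed

text \<open>The 24 is the 8 of the Lipschitz constant of the slaved couplings times the 3 between
  chordal and angular distance; the 1 is the distance of the couplings themselves.\<close>

definition closeness_const :: real where
  "closeness_const = form_norm + K * card inter_edges * (1 + 24 * \<nu> * \<delta> / \<gamma>)\<^sup>2 + p * card intra_edges"

text \<open>A close point of the manifold has, in a suitable lift, a close phase, and carrying the
  slaved couplings from there to the phase of the state costs their Lipschitz constant.\<close>

lemma energy_le_infdist:
  assumes e: "\<And>i. e $ i = err \<theta> i"
    and r: "infdist (e, k, torus_point (phase \<theta>)) (torus_graph coupling) < r"
  shows "energy \<theta> k (phase \<theta>) \<le> closeness_const * r\<^sup>2"
proof -
  have "torus_graph coupling \<noteq> {}" by (simp add: torus_graph_def)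
  then obtain q where q: "q \<in> torus_graph coupling" "dist (e, k, torus_point (phase \<theta>)) q < r"
    using r cInf_lessD[of "(\<lambda>a. dist (e, k, torus_point (phase \<theta>)) a) ` torus_graph coupling" r]
    by (auto simp: infdist_notempty)
  obtain \<psi>0 where q': "q = (0, coupling \<psi>0, torus_point \<psi>0)" using q(1) by (auto simp: torus_graph_def)
  have "dist e 0 \<le> r" "dist (k, torus_point (phase \<theta>)) (coupling \<psi>0, torus_point \<psi>0) \<le> r"
    using dist_fst_le[of "(e, k, torus_point (phase \<theta>))" q] dist_snd_le[of "(e, k, torus_point (phase \<theta>))" q] q(2)
    by (auto simp: q')
  then have d: "norm e \<le> r" "dist k (coupling \<psi>0) \<le> r" "dist (torus_point (phase \<theta>)) (torus_point \<psi>0) \<le> r"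
    using dist_fst_le[of "(k, torus_point (phase \<theta>))" "(coupling \<psi>0, torus_point \<psi>0)"]
      dist_snd_le[of "(k, torus_point (phase \<theta>))" "(coupling \<psi>0, torus_point \<psi>0)"]
    by auto
  have r0: "0 \<le> r" using d(1) norm_ge_zero order_trans by blast
  obtain z where z: "torus_period z" "\<And>s. \<bar>phase \<theta> $ s - (\<psi>0 + z) $ s\<bar> \<le> 3 * r"
    using torus_point_close[OF d(3)] by blast
  define \<psi> where "\<psi> = \<psi>0 + z"
  define h where "h = 1 + 24 * \<nu> * \<delta> / \<gamma>"
  have k_le: "\<bar>k $ i $ j - coupling \<psi> $ i $ j\<bar> \<le> r" for i j
  proof -
    have "\<bar>(k - coupling \<psi>0) $ i $ j\<bar> \<le> norm ((k - coupling \<psi>0) $ i)" by (rule component_le_norm_cart)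
    also have "\<dots> \<le> norm (k - coupling \<psi>0)" by (rule Finite_Cartesian_Product.norm_nth_le)
    also have "\<dots> \<le> r" using d(2) by (simp add: dist_norm)
    finally show ?thesis using coupling_periodic[OF z(1), of \<psi>0] by (simp add: \<psi>_def)
  qed
  have "form (err \<theta>) \<le> form_norm * r\<^sup>2"
  proof (rule form_upper)
    show "\<bar>err \<theta> i\<bar> \<le> r" for i
      using order_trans[OF component_le_norm_cart d(1), of i] by (simp add: e)
  qed
  moreover have "(\<Sum>a\<in>inter_edges. (inter_dev k (phase \<theta>) a)\<^sup>2) \<le> (\<Sum>a\<in>inter_edges. ((1 + 24 * \<nu> * \<delta> / \<gamma>) * r)\<^sup>2)"
  proof (rule sum_mono)
    fix a assume a: "a \<in> inter_edges"
    obtain i j where ij: "a = (i, j)" by (cases a)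
    have "\<bar>reduced.slaved_coupling \<psi> (cl i) (cl j) - reduced.slaved_coupling (phase \<theta>) (cl i) (cl j)\<bar>
        \<le> 8 * \<nu> * \<delta> / \<gamma> * (3 * r)"
      by (rule reduced.slaved_coupling_lipschitz) (use z(2) in \<open>simp add: \<psi>_def abs_minus_commute\<close>)
    moreover have "\<bar>k $ i $ j - reduced.slaved_coupling \<psi> (cl i) (cl j)\<bar> \<le> r"
      using k_le[of i j] a by (simp add: ij inter_edges_def coupling_nth)
    ultimately have "\<bar>inter_dev k (phase \<theta>) a\<bar> \<le> r + 8 * \<nu> * \<delta> / \<gamma> * (3 * r)"
      unfolding inter_dev_def ij fst_conv snd_conv by linarith
    also have "\<dots> = (1 + 24 * \<nu> * \<delta> / \<gamma>) * r" by (simp add: algebra_simps)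
    finally have "\<bar>inter_dev k (phase \<theta>) a\<bar>\<^sup>2 \<le> ((1 + 24 * \<nu> * \<delta> / \<gamma>) * r)\<^sup>2"
      by (rule power_mono) simp
    then show "(inter_dev k (phase \<theta>) a)\<^sup>2 \<le> ((1 + 24 * \<nu> * \<delta> / \<gamma>) * r)\<^sup>2" by simp
  qed
  then have "K * (\<Sum>a\<in>inter_edges. (inter_dev k (phase \<theta>) a)\<^sup>2)
      \<le> K * (card inter_edges * ((1 + 24 * \<nu> * \<delta> / \<gamma>) * r)\<^sup>2)"
    using K_pos by (intro mult_left_mono) auto
  moreover have "(\<Sum>a\<in>intra_edges. (intra_dev k a)\<^sup>2) \<le> (\<Sum>a\<in>intra_edges. r\<^sup>2)"
  proof (rule sum_mono)
    fix a assume a: "a \<in> intra_edges"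
    obtain i j where ij: "a = (i, j)" by (cases a)
    have "\<bar>intra_dev k a\<bar> \<le> r"
      using k_le[of i j] a by (simp add: ij intra_edges_def coupling_nth intra_dev_def)
    then have "\<bar>intra_dev k a\<bar>\<^sup>2 \<le> r\<^sup>2" by (rule power_mono) simp
    then show "(intra_dev k a)\<^sup>2 \<le> r\<^sup>2" by simp
  qed
  then have "p * (\<Sum>a\<in>intra_edges. (intra_dev k a)\<^sup>2) \<le> p * (card intra_edges * r\<^sup>2)"
    using p_pos by (intro mult_left_mono) auto
  ultimately have "energy \<theta> k (phase \<theta>) \<le> form_norm * r\<^sup>2
      + K * (card inter_edges * (h * r)\<^sup>2) + p * (card intra_edges * r\<^sup>2)"
    unfolding energy_def h_def by linarith
  also have "\<dots> = closeness_const * r\<^sup>2"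
    unfolding closeness_const_def h_def[symmetric] by (simp add: power_mult_distrib distrib_right mult.assoc)
  finally show ?thesis .
qed

lemma closeness_const_nonneg: "0 \<le> closeness_const"
  unfolding closeness_const_def using form_norm_nonneg K_pos p_pos by simp

text \<open>Chosen so that the energy bound at this distance meets the smallness condition of the
  bootstrap; the summand 1 makes that inequality strict and the denominator positive.\<close>

definition basin_radius :: real where
  "basin_radius = radius / sqrt (2 * (1 / m + 1 / p) * closeness_const + 1)"

lemma basin_radius:
  "0 < basin_radius" "2 * (1 / m + 1 / p) * (closeness_const * basin_radius\<^sup>2) < radius\<^sup>2"
proof -
  define C where "C = 2 * (1 / m + 1 / p) * closeness_const"
  have C: "0 \<le> C" unfolding C_def using closeness_const_nonneg m_pos p_pos by simp
  show "0 < basin_radius"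
    unfolding basin_radius_def C_def[symmetric] using radius C by (intro divide_pos_pos) auto
  have "basin_radius\<^sup>2 = radius\<^sup>2 / (C + 1)"
    unfolding basin_radius_def C_def[symmetric] using C by (simp add: power_divide)
  then have "C * basin_radius\<^sup>2 < radius\<^sup>2"
  proof -
    have "0 < basin_radius\<^sup>2" using \<open>0 < basin_radius\<close> by simp
    moreover have "(C + 1) * basin_radius\<^sup>2 = radius\<^sup>2"
      using \<open>basin_radius\<^sup>2 = radius\<^sup>2 / (C + 1)\<close> C by simp
    ultimately show ?thesis unfolding distrib_right mult_1_left by linarith
  qed
  then show "2 * (1 / m + 1 / p) * (closeness_const * basin_radius\<^sup>2) < radius\<^sup>2"
    by (simp add: C_def mult.assoc)
qed

text \<open>The initial distance controls the initial energy, the energy decays exponentially, and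
  it controls the later distance in turn. The energy is evaluated on the lift of the trajectory to
  the network.\<close>

lemma trajectory_attracted:
  assumes x: "x \<in> trajectories {0..}"
    and r: "infdist (x 0) (torus_graph coupling) < r" "r \<le> basin_radius" and t: "0 \<le> t"
  shows "x t \<in> state_space E sel"
    and "infdist (x t) (torus_graph coupling) \<le> (CARD('n) + (CARD('n))\<^sup>2) *
      sqrt ((1 / m + 1 / p + 1 / K) * (2 * exp (- \<beta> * t) * (closeness_const * r\<^sup>2)))"
proof -
  obtain e k \<phi> where sol: "err_solution {0..} e k \<phi>"
    and x_eq: "\<And>t. 0 \<le> t \<Longrightarrow> x t = (e t, k t, torus_point (\<phi> t))"
    using x unfolding error_trajectories_def by auto
  define \<theta> where "\<theta> t = (\<chi> i. (if i = sel (cl i) then 0 else e t $ i) + \<phi> t $ cl i)" for t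
  have net: "solution {0..} \<theta> k"
    unfolding \<theta>_def by (rule error_solution_network_solution[OF sol])
  have e_sel: "e t $ sel s = 0" and k_off: "(i, j) \<notin> E \<Longrightarrow> k t $ i $ j = 0" if "0 \<le> t" for t s i j
    using sol that unfolding error_solution_def by auto
  have phase: "phase (\<theta> t) = \<phi> t" for t
    by (simp add: phase_def \<theta>_def vec_eq_iff)
  have e_err: "e t $ i = err (\<theta> t) i" if "0 \<le> t" for t i
  proof (cases "i = sel (cl i)")
    case True
    then have "e t $ i = 0" using e_sel[OF that, of "cl i"] by simp
    moreover have "err (\<theta> t) i = 0" using err_sel[of "\<theta> t" "cl i"] True by simp
    ultimately show ?thesis by simp
  next
    case False
    then show ?thesis by (simp add: err_def \<theta>_def)
  qed
  have r0: "0 \<le> r" using r(1) infdist_nonneg[of "x 0" "torus_graph coupling"] by linarith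
  have energy0: "energy (\<theta> 0) (k 0) (phase (\<theta> 0)) \<le> closeness_const * r\<^sup>2"
    by (rule energy_le_infdist[where e = "e 0"]) (use r(1) e_err in \<open>auto simp: x_eq phase\<close>)
  also have "\<dots> \<le> closeness_const * basin_radius\<^sup>2"
    using r r0 closeness_const_nonneg by (intro mult_left_mono power_mono) auto
  finally have "2 * (1 / m + 1 / p) * energy (\<theta> 0) (k 0) (phase (\<theta> 0))
      \<le> 2 * (1 / m + 1 / p) * (closeness_const * basin_radius\<^sup>2)"
    using m_pos p_pos by (intro mult_left_mono) auto
  also have "\<dots> < radius\<^sup>2" by (rule basin_radius)
  finally have "energy (\<theta> t) (k t) (phase (\<theta> t)) \<le> 2 * exp (- \<beta> * t) * energy (\<theta> 0) (k 0) (phase (\<theta> 0))"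
    by (rule energy_decay_small[OF net _ t])
  also have "\<dots> \<le> 2 * exp (- \<beta> * t) * (closeness_const * r\<^sup>2)"
    by (intro mult_left_mono energy0) simp
  finally have en: "energy (\<theta> t) (k t) (phase (\<theta> t)) \<le> 2 * exp (- \<beta> * t) * (closeness_const * r\<^sup>2)" .
  show "x t \<in> state_space E sel"
    using t e_sel k_off by (auto simp: x_eq state_space_def)
  have "infdist (x t) (torus_graph coupling) \<le> (CARD('n) + (CARD('n))\<^sup>2) *
      sqrt ((1 / m + 1 / p + 1 / K) * energy (\<theta> t) (k t) (phase (\<theta> t)))"
    using infdist_manifold_le[of "e t" "\<theta> t" "k t"] e_err[OF t] k_off[OF t] by (simp add: x_eq[OF t] phase)
  also have "\<dots> \<le> (CARD('n) + (CARD('n))\<^sup>2) *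
      sqrt ((1 / m + 1 / p + 1 / K) * (2 * exp (- \<beta> * t) * (closeness_const * r\<^sup>2)))"
    using en m_pos p_pos K_pos by (intro mult_left_mono real_sqrt_le_mono) auto
  finally show "infdist (x t) (torus_graph coupling) \<le> (CARD('n) + (CARD('n))\<^sup>2) *
      sqrt ((1 / m + 1 / p + 1 / K) * (2 * exp (- \<beta> * t) * (closeness_const * r\<^sup>2)))" .
qed

text \<open>One estimate, a constant times \<open>r\<close> times a decaying exponential, serves
  both halves: small \<open>r\<close> gives Lyapunov stability, large times give attraction.\<close>

lemma torus_graph_coupling_stable:
  "locally_asymptotically_stable (state_space E sel)
     (trajectories {0..}) (torus_graph coupling)"
  (is "locally_asymptotically_stable ?S ?T ?M")
proof -
  define N where "N = real (CARD('n) + (CARD('n))\<^sup>2)"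
  define G where "G = (1 / m + 1 / p + 1 / K) * (2 * closeness_const)"
  have G: "0 \<le> G" unfolding G_def using m_pos p_pos K_pos closeness_const_nonneg by simp
  have attracted: "infdist (x t) ?M \<le> N * (sqrt (G * exp (- \<beta> * t)) * r)"
    if "x \<in> ?T" "infdist (x 0) ?M < r" "r \<le> basin_radius" "0 \<le> t" for x r t
  proof -
    have "0 \<le> r" using that(2) infdist_nonneg[of "x 0" ?M] by linarith
    then have "sqrt ((1 / m + 1 / p + 1 / K) * (2 * exp (- \<beta> * t) * (closeness_const * r\<^sup>2)))
        = sqrt (G * exp (- \<beta> * t)) * r"
      using real_sqrt_mult[of "G * exp (- \<beta> * t)" "r\<^sup>2"] by (simp add: G_def mult_ac)
    then show ?thesis using trajectory_attracted(2)[OF that] by (simp add: N_def)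
  qed
  define V where "V r = ?S \<inter> {x. infdist x ?M < r}" for r
  have V_open: "openin (top_of_set ?S) (V r)" for r
    unfolding V_def by (intro openin_open_Int open_Collect_less continuous_intros)
  have M_S: "?M \<subseteq> ?S"
    using invariant_toroidal_manifold_coupling by (simp add: invariant_toroidal_manifold_def)
  have M_V: "?M \<subseteq> V r" if "0 < r" for r
    using M_S that by (auto simp: V_def)
  have M_ne: "?M \<noteq> {}" by (simp add: torus_graph_def)
  show ?thesis
    unfolding locally_asymptotically_stable_def
  proof (intro conjI allI impI)
    fix U assume U: "openin (top_of_set ?S) U \<and> ?M \<subseteq> U"
    then obtain U' where U': "open U'" "U = ?S \<inter> U'" by (auto simp: openin_open)
    \<comment> \<open>By compactness the neighbourhood contains a tube of uniform width around the
      manifold.\<close>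
    then obtain \<rho> where \<rho>: "0 < \<rho>" "(\<Union>x\<in>?M. ball x \<rho>) \<subseteq> U'"
      using compact_subset_open_imp_ball_epsilon_subset[OF compact_torus_graph_coupling U'(1)] U by blast
    \<comment> \<open>The summand 1 keeps the denominator positive and makes the resulting bound
      strictly smaller than \<open>\<rho>\<close>.\<close>
    define r where "r = min basin_radius (\<rho> / (N * sqrt G + 1))"
    have NG: "0 \<le> N * sqrt G" using G by (simp add: N_def)
    have r: "0 < r" "r \<le> basin_radius" "r \<le> \<rho> / (N * sqrt G + 1)"
      using basin_radius \<rho> NG by (auto simp: r_def)
    have "N * sqrt G * r < \<rho>"
    proof -
      have "N * sqrt G * r < (N * sqrt G + 1) * r" using r by simp
      also have "\<dots> \<le> (N * sqrt G + 1) * (\<rho> / (N * sqrt G + 1))"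
        using r NG by (intro mult_left_mono) auto
      also have "\<dots> = \<rho>" using NG by simp
      finally show ?thesis .
    qed
    have "x t \<in> U" if x: "x \<in> ?T" "x 0 \<in> V r" and t: "0 \<le> t" for x t
    proof -
      have "infdist (x t) ?M \<le> N * (sqrt (G * exp (- \<beta> * t)) * r)"
        using attracted[OF x(1) _ r(2) t] x(2) by (simp add: V_def)
      also have "\<dots> \<le> N * (sqrt G * r)"
      proof -
        have "G * exp (- \<beta> * t) \<le> G * 1" using G \<beta>_pos t by (intro mult_left_mono) auto
        then show ?thesis
          using r by (intro mult_left_mono mult_right_mono real_sqrt_le_mono) (auto simp: N_def)
      qed
      also have "\<dots> < \<rho>" using \<open>N * sqrt G * r < \<rho>\<close> by (simp add: mult.assoc)
      finally have "infdist (x t) ?M < \<rho>" .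
      then obtain y where y: "y \<in> ?M" "dist (x t) y < \<rho>"
        using cInf_lessD[of "(\<lambda>a. dist (x t) a) ` ?M" \<rho>] M_ne by (auto simp: infdist_notempty)
      then have "x t \<in> ball y \<rho>" by (simp add: dist_commute)
      then have "x t \<in> U'" using \<rho>(2) y(1) by blast
      moreover have "x t \<in> ?S"
        using trajectory_attracted(1)[OF x(1) _ r(2) t] x(2) by (simp add: V_def)
      ultimately show ?thesis by (simp add: U')
    qed
    then show "\<exists>V. openin (top_of_set ?S) V \<and> ?M \<subseteq> V \<and> (\<forall>x\<in>?T. x 0 \<in> V \<longrightarrow> (\<forall>t\<ge>0. x t \<in> U))"
      using V_open M_V[OF r(1)] by blast
  next
    have "((\<lambda>t. infdist (x t) ?M) \<longlongrightarrow> 0) at_top" if x: "x \<in> ?T" "x 0 \<in> V basin_radius" for x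
    proof (rule tendsto_sandwich)
      show "\<forall>\<^sub>F t in at_top. 0 \<le> infdist (x t) ?M" by (simp add: infdist_nonneg)
      show "\<forall>\<^sub>F t in at_top. infdist (x t) ?M \<le> N * (sqrt (G * exp (- \<beta> * t)) * basin_radius)"
        unfolding eventually_at_top_linorder
        using attracted[OF x(1) _ order_refl] x(2) by (intro exI[of _ 0]) (simp add: V_def)
      have "filterlim (\<lambda>t. - \<beta> * t) at_bot at_top"
        using \<beta>_pos by (intro filterlim_tendsto_neg_mult_at_bot[OF tendsto_const]) (auto simp: filterlim_ident)
      then have "((\<lambda>t. exp (- \<beta> * t)) \<longlongrightarrow> 0) at_top"
        by (rule filterlim_compose[OF exp_at_bot])
      then have "((\<lambda>t. N * (sqrt (G * exp (- \<beta> * t)) * basin_radius)) \<longlongrightarrow> N * (sqrt (G * 0) * basin_radius)) at_top"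
        by (intro tendsto_intros)
      then show "((\<lambda>t. N * (sqrt (G * exp (- \<beta> * t)) * basin_radius)) \<longlongrightarrow> 0) at_top" by simp
    qed simp
    then show "\<exists>V. openin (top_of_set ?S) V \<and> ?M \<subseteq> V \<and>
        (\<forall>x\<in>?T. x 0 \<in> V \<longrightarrow> ((\<lambda>t. infdist (x t) ?M) \<longlongrightarrow> 0) at_top)"
      using V_open M_V[OF basin_radius(1)] by blast
  qed
qed

end

section \<open>Bounds for \<Gamma> and the choice of the threshold\<close>

lemma periodic_bounded:
  fixes f :: "real \<Rightarrow> real"
  assumes "continuous_on UNIV f" "\<And>x. f (x + 2 * pi) = f x"
  shows "bounded (range f)"
proof -
  \<comment> \<open>A periodic function of one variable is a function on the one-dimensional torus,
    whose range is compact.\<close>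
  have "torus_continuous (\<lambda>v :: real^1. f (v $ 1))"
    unfolding torus_continuous_def
  proof (intro conjI allI)
    show "continuous_on UNIV (\<lambda>v :: real^1. f (v $ 1))"
      by (intro continuous_on_compose2[OF assms(1)] continuous_intros) auto
    show "f ((v + axis s (2 * pi)) $ 1) = f (v $ 1)" for v :: "real^1" and s
      using assms(2) by (simp add: axis_def)
  qed
  then have "bounded (range (\<lambda>v :: real^1. f (v $ 1)))"
    by (intro compact_imp_bounded torus_continuous_compact_range)
  moreover have "range f \<subseteq> range (\<lambda>v :: real^1. f (v $ 1))"
  proof
    fix y assume "y \<in> range f"
    then obtain x where "y = f x" by blast
    then have "y = f ((\<chi> i. x :: real^1) $ 1)" by simp
    then show "y \<in> range (\<lambda>v :: real^1. f (v $ 1))" by blast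
  qed
  ultimately show ?thesis by (rule bounded_subset)
qed

text \<open>The suprema in the norm are upper bounds only because \<Gamma> and its derivative,
  continuous and periodic, are bounded. The slope estimate is the mean value inequality.\<close>

lemma periodic_C1_bounds:
  assumes per: "\<And>x. \<Gamma> (x + 2 * pi) = \<Gamma> x" and C1: "\<Gamma> C1_differentiable_on UNIV"
  shows "\<bar>\<Gamma> x\<bar> \<le> C1_norm \<Gamma>" "\<bar>\<Gamma> x - \<Gamma> y\<bar> \<le> C1_norm \<Gamma> * \<bar>x - y\<bar>"
proof -
  obtain D where D: "\<And>x. (\<Gamma> has_real_derivative D x) (at x)" and cont_D: "continuous_on UNIV D"
    using C1 unfolding C1_differentiable_on_def has_real_derivative_iff_has_vector_derivative by blast
  have deriv: "deriv \<Gamma> = D" using D by (auto intro: DERIV_imp_deriv)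
  have "D (x + 2 * pi) = D x" for x
  proof -
    have "((\<lambda>x. \<Gamma> (x + 2 * pi)) has_real_derivative D (x + 2 * pi)) (at x)"
      using D[of "x + 2 * pi"] by (simp add: DERIV_shift)
    then show ?thesis using D[of x] by (simp add: per DERIV_unique)
  qed
  then have "bounded (range D)" by (rule periodic_bounded[OF cont_D])
  moreover have "continuous_on UNIV \<Gamma>" using D by (intro DERIV_continuous_on) auto
  then have "bounded (range \<Gamma>)" by (rule periodic_bounded) (rule per)
  ultimately have "bdd_above (range (\<lambda>x. \<bar>D x\<bar>))" "bdd_above (range (\<lambda>x. \<bar>\<Gamma> x\<bar>))"
    unfolding bounded_iff bdd_above_def by auto
  then have "\<bar>D x\<bar> \<le> (SUP x. \<bar>D x\<bar>)" "\<bar>\<Gamma> x\<bar> \<le> (SUP x. \<bar>\<Gamma> x\<bar>)" for x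
    by (auto intro: cSUP_upper)
  then have D_le: "\<bar>D x\<bar> \<le> C1_norm \<Gamma>" and \<Gamma>_le: "\<bar>\<Gamma> x\<bar> \<le> C1_norm \<Gamma>" for x
    unfolding C1_norm_def deriv by (auto intro: max.coboundedI1 max.coboundedI2)
  show "\<bar>\<Gamma> x\<bar> \<le> C1_norm \<Gamma>" by (rule \<Gamma>_le)
  have "norm (\<Gamma> x - \<Gamma> y) \<le> C1_norm \<Gamma> * norm (x - y)"
    by (rule field_differentiable_bound[of UNIV]) (use D D_le in auto)
  then show "\<bar>\<Gamma> x - \<Gamma> y\<bar> \<le> C1_norm \<Gamma> * \<bar>x - y\<bar>" by simp
qed

theorem theorem2:
  fixes E :: "('n::finite \<times> 'n) set"
    and P :: "'m::finite \<Rightarrow> 'n set"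
    and sel :: "'m \<Rightarrow> 'n"
    and w :: "'n \<Rightarrow> real"
    and c :: "'m \<Rightarrow> 'm \<Rightarrow> nat"
    and \<gamma> \<mu>t \<mu> \<delta> c_max w_min w_max :: real
    and c_out :: nat
    and \<Gamma> :: "real \<Rightarrow> real"
  assumes "CARD('m) > 1"
    and "irrefl E"
    and "is_partition P"
    and "\<forall>s. sel s \<in> P s"
    and "\<gamma> > 0" and "\<mu>t > 0" and "\<mu> > 0"
    and "\<forall>x. \<Gamma> (x + 2 * pi) = \<Gamma> x" and "\<Gamma> C1_differentiable_on UNIV"
    and "\<delta> = C1_norm \<Gamma>" and "\<delta> > 0"
    and A1: "\<forall>s. \<forall>i\<in>P s. \<forall>j\<in>P s. w i = w j"
    and A2: "\<forall>s r. s \<noteq> r \<longrightarrow> (\<forall>i\<in>P s. (\<Sum>j\<in>P r. adj E i j) = real (c s r))"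
    and "c_max = Max (range (\<lambda>s. \<Sum>r\<in>UNIV - {s}. real (c s r)))"
    and "w_min = Min (range (\<lambda>i. \<bar>w i\<bar>))"
    and "w_max = Max (range (\<lambda>i. \<bar>w i\<bar>))"
    and "c_out = num_inter_edges E P"
    and A3: "w_min - \<mu> / \<gamma> * \<delta> * c_max > 0"
      "4 * (\<mu> / \<gamma>\<^sup>2) * \<delta> * sqrt (real c_out) * (\<Sum>s\<in>UNIV. \<Sum>r\<in>UNIV - {s}. real (c s r))
         * ((w_max + \<mu> / \<gamma> * \<delta> * c_max) / (w_min - \<mu> / \<gamma> * \<delta> * c_max)) < 1"
    and A4: "\<forall>s l. eigenvalue_on (P s - {sel s}) (cluster_matrix E P sel s) l \<longrightarrow>
        sgn (\<Gamma> 0) * Re l < 0"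
  shows "\<exists>\<mu>0. 0 < \<mu>0 \<and> \<mu>0 \<le> \<mu> \<and> (\<forall>\<nu>. 0 < \<nu> \<and> \<nu> < \<mu>0 \<longrightarrow>
    (\<exists>M. invariant_toroidal_manifold E P sel w \<gamma> \<mu>t \<nu> \<Gamma> M) \<and>
    (\<forall>M. invariant_toroidal_manifold E P sel w \<gamma> \<mu>t \<nu> \<Gamma> M \<longrightarrow>
       locally_asymptotically_stable (state_space E sel)
         (error_trajectories E P sel w \<gamma> \<mu>t \<nu> \<Gamma> {0..}) M))"
proof -
  have \<Gamma>: "\<bar>\<Gamma> x\<bar> \<le> \<delta>" "\<bar>\<Gamma> x - \<Gamma> y\<bar> \<le> \<delta> * \<bar>x - y\<bar>" for x y
    unfolding \<open>\<delta> = C1_norm \<Gamma>\<close>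
    by (rule periodic_C1_bounds; use \<open>\<forall>x. \<Gamma> (x + 2 * pi) = \<Gamma> x\<close> \<open>\<Gamma> C1_differentiable_on UNIV\<close> in blast)+
  interpret adaptive_network E P sel w c \<gamma> \<mu>t \<delta> \<Gamma>
  proof unfold_locales
    show "is_partition P" "\<gamma> > 0" by fact+
    show "sel s \<in> P s" for s using \<open>\<forall>s. sel s \<in> P s\<close> by blast
    show "\<delta> \<ge> 0" using \<open>\<delta> > 0\<close> by simp
    show "\<bar>\<Gamma> x\<bar> \<le> \<delta>" "\<bar>\<Gamma> x - \<Gamma> y\<bar> \<le> \<delta> * \<bar>x - y\<bar>" for x y by (fact \<Gamma>)+
    show "\<Gamma> (x + 2 * pi) = \<Gamma> x" for x using \<open>\<forall>x. \<Gamma> (x + 2 * pi) = \<Gamma> x\<close> by blast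
    show "w i = w j" if "i \<in> P s" "j \<in> P s" for i j s using A1 that by blast
    show "(\<Sum>j\<in>P r. adj E i j) = real (c s r)" if "s \<noteq> r" "i \<in> P s" for s r i using A2 that by blast
  qed
  \<comment> \<open>The form is fixed before \<nu>: the linearization involves only intra-cluster
    couplings, whose resting value does not depend on \<nu>.\<close>
  obtain S b m where S: "\<And>i j. S i j = S j i" "b > 0" "m > 0"
    "\<And>x. m * (\<Sum>i\<in>nonselected. (x i)\<^sup>2) \<le> (\<Sum>i\<in>nonselected. \<Sum>j\<in>nonselected. S i j * x i * x j)"
    "\<And>x. (\<Sum>i\<in>nonselected. \<Sum>j\<in>nonselected. S i j * x i * (\<Sum>z\<in>nonselected. linearization j z * x z))
      \<le> - b * (\<Sum>i\<in>nonselected. (x i)\<^sup>2)"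
  proof (rule lyapunov_form[of nonselected linearization])
    show "Re l < 0" if "eigenvalue_on nonselected linearization l" for l
      by (rule linearization_stable[OF \<open>\<mu>t > 0\<close> _ that]) (use A4 in blast)
  qed (simp, rule that)
  interpret lyapunov_network E P sel w c \<gamma> \<mu>t \<delta> \<Gamma> S b m
    by unfold_locales (use S in auto)
  show ?thesis
  proof (rule decay_constants[OF b_pos lyapunov_const_ge(6) \<gamma>_pos])
    fix \<beta> K p l \<epsilon> :: real
    assume pos: "\<beta> > 0" "K > 0" "p > 0" "l > 0" "\<epsilon> > 0"
      and decay: "\<And>X Y Z Q \<nu> \<sigma> V. X \<ge> 0 \<Longrightarrow> Y \<ge> 0 \<Longrightarrow> Z \<ge> 0 \<Longrightarrow> Q \<ge> 0 \<Longrightarrow> 0 \<le> \<nu> \<Longrightarrow> \<nu> \<le> \<epsilon> \<Longrightarrow> \<sigma> \<le> \<epsilon> \<Longrightarrow>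
        V \<le> lyapunov_const * X\<^sup>2 \<Longrightarrow>
        - 2 * b * X\<^sup>2 + lyapunov_const * X * (\<sigma> * X + Y)
          + K * (- 2 * \<gamma> * Y\<^sup>2 + lyapunov_const * \<nu> * Y * (X + Q))
          + p * (- 2 * \<gamma> * Z\<^sup>2 + lyapunov_const * X * Z) + l * (lyapunov_const * Q * (X + Y + \<nu> * Q))
        \<le> - \<beta> * (V + K * Y\<^sup>2 + p * Z\<^sup>2 - l * Q\<^sup>2)"
    interpret decaying_network E P sel w c \<gamma> \<mu>t \<delta> \<Gamma> S b m \<beta> K p l \<epsilon>
      by unfold_locales (use pos decay in auto)
    define A where "A = CARD('m) * (12 * (\<Sum>s\<in>UNIV. \<Sum>r\<in>UNIV. real (c s r)) * \<delta> / \<gamma>\<^sup>2)"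
    define B where "B = 2 * K * card inter_edges * (8 * \<delta> / \<gamma>)\<^sup>2"
    have A: "0 \<le> A" unfolding A_def using \<delta>_nonneg by (simp add: sum_nonneg)
    have B: "0 \<le> B" unfolding B_def using pos by simp
    \<comment> \<open>\<open>A * \<nu>\<close> is the left-hand side of the contraction condition.
      \<open>B * \<nu>\<^sup>2\<close> is that of the slope condition, at most
      \<open>B * \<nu>\<close> since \<nu> is below 1. The added 1 in the denominators avoids
      division by zero.\<close>
    define \<mu>0 where "\<mu>0 = Min {\<mu>, 1, \<epsilon> / 2, 1 / (2 * (A + 1)), l / (B + 1)}"
    have \<mu>0: "0 < \<mu>0" "\<mu>0 \<le> \<mu>" "\<mu>0 \<le> 1" "\<mu>0 \<le> \<epsilon> / 2" "\<mu>0 \<le> 1 / (2 * (A + 1))" "\<mu>0 \<le> l / (B + 1)"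
    proof -
      show "0 < \<mu>0" unfolding \<mu>0_def using \<open>\<mu> > 0\<close> pos A B by (subst Min_gr_iff) auto
      show "\<mu>0 \<le> \<mu>" "\<mu>0 \<le> 1" "\<mu>0 \<le> \<epsilon> / 2" "\<mu>0 \<le> 1 / (2 * (A + 1))" "\<mu>0 \<le> l / (B + 1)"
        unfolding \<mu>0_def by (rule Min_le; simp)+
    qed
    have main: "(\<exists>M. invariant_toroidal_manifold E P sel w \<gamma> \<mu>t \<nu> \<Gamma> M) \<and>
      (\<forall>M. invariant_toroidal_manifold E P sel w \<gamma> \<mu>t \<nu> \<Gamma> M \<longrightarrow>
         locally_asymptotically_stable (state_space E sel)
           (error_trajectories E P sel w \<gamma> \<mu>t \<nu> \<Gamma> {0..}) M)" if \<nu>: "0 < \<nu>" "\<nu> < \<mu>0" for \<nu>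
    proof -
      have A\<nu>: "A * \<nu> \<le> 1 / 2"
      proof -
        have "A * \<nu> \<le> (A + 1) * (1 / (2 * (A + 1)))"
          using A \<nu> \<mu>0 by (intro mult_mono) auto
        also have "\<dots> = 1 / 2" using A by simp
        finally show ?thesis .
      qed
      have B\<nu>: "B * \<nu>\<^sup>2 \<le> l"
      proof -
        have "\<nu>\<^sup>2 \<le> \<nu>" using \<nu> \<mu>0 by (simp add: power2_eq_square mult_left_le)
        then have "B * \<nu>\<^sup>2 \<le> (B + 1) * (l / (B + 1))"
          using B \<nu> \<mu>0 by (intro mult_mono) auto
        also have "\<dots> = l" using B by simp
        finally show ?thesis .
      qed
      interpret slow_decaying_network E P sel w c \<gamma> \<mu>t \<delta> \<Gamma> S b m \<beta> K p l \<epsilon> \<nu>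
      proof unfold_locales
        show "CARD('m) * (12 * (\<Sum>s\<in>UNIV. \<Sum>r\<in>UNIV. real (c s r)) * \<delta> * \<nu> / \<gamma>\<^sup>2) \<le> 1 / 2"
          using A\<nu> by (simp add: A_def mult_ac)
        show "2 * K * card inter_edges * (8 * \<nu> * \<delta> / \<gamma>)\<^sup>2 \<le> l"
          using B\<nu> by (simp add: B_def power_mult_distrib power_divide mult_ac)
      qed (use \<nu> \<mu>0 in auto)
      \<comment> \<open>Uniqueness transfers stability from the constructed graph to every manifold
        of the given form.\<close>
      show ?thesis
        using invariant_toroidal_manifold_coupling invariant_toroidal_manifold_unique
          torus_graph_coupling_stable by blast
    qed
    show ?thesis using \<mu>0 main by (intro exI[of _ \<mu>0]) blast
  qed
qed

end
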